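(* As $\beta\to\infty$, $$\exp\big(-\pi^2\beta(1+o(1))\big)\ \le\ f^{Coul}(\beta)\ =\ f^{IV}(\beta^{-1})-f^{GFF}(\beta^{-1})\ =\ f^{Vil}(\beta)-f^{GFF}(\beta).$$
   Context: Graph. $\Lambda_n$ is the box $[-n,n]^2\cap\mathbb Z^2$ with nearest-neighbour edges (free boundary conditions), with edge set $E$ and a marked vertex $v_0$ (e.g. the origin); one may equally use zero boundary conditions (adding a vertex $\infty$ connected to the boundary vertices, and taking $v_0=\infty$), and the free energies below are the same. A 0-form is a function $w$ on vertices with $w(v_0)=0$; $\mathrm d w(\overrightarrow{xy})=w(y)-w(x)$; $\langle w_1,w_2\rangle=\sum_vw_1(v)w_2(v)$, $\langle h_1,h_2\rangle=\sum_{e\in E}h_1(e)h_2(e)$; $-\Delta$ is the positive definite graph Laplacian on 0-forms, $\langle w,(-\Delta)w\rangle=\langle\mathrm dw,\mathrm dw\rangle$. Partition functions on $\Lambda_n$ (with $\beta>0$): $Z^{GFF}_{\beta}=\int e^{-\frac\beta2\langle\mathrm d\phi,\mathrm d\phi\rangle}d\phi$ (over real 0-forms, Lebesgue measure); $Z^{IV}_{\beta}=\sum_\Psi e^{-\frac{\beta}{2}\langle\mathrm d\Psi,\mathrm d\Psi\rangle}$ (over $\mathbb Z$-valued 0-forms; used at $\beta^{-1}$); $Z^{Coul}_\beta=\sum_qe^{-\frac{(2\pi)^2\beta}{2}\langle q,(-\Delta)^{-1}q\rangle}$ (over $\mathbb Z$-valued 0-forms); $Z^{Vil}_\beta=\int\sum_{m\in\mathbb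 Z^E}e^{-\frac\beta2\langle\mathrm d\theta+2\pi m,\mathrm d\theta+2\pi m\rangle}d\theta$ (over 0-forms $\theta$ with values in $[0,2\pi)$). Free energies: $f^{\bullet}(\beta):=\lim_{n\to\infty}\frac1{|\Lambda_n|}\log Z^\bullet_{\beta,\Lambda_n}$ for $\bullet\in\{GFF,IV,Coul,Vil\}$. These limits exist and do not depend on free versus zero boundary conditions, nor on whether the models are defined on the vertices or (by duality) on the faces of the graph. *)

theory Defs
  imports "HOL-Analysis.Analysis"
begin

text \<open>
  A finite simple graph is given by its vertex set \<open>V\<close> and a set \<open>E\<close> of ordered pairs containing
  every edge in exactly one (arbitrary) orientation; \<open>v0\<close> is the marked vertex.  Forms are
  functions on the whole type that vanish off the graph, and integer-valued forms are
  real-valued functions with values in \<open>\<int>\<close>.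
\<close>

definition zero_forms :: "'v set \<Rightarrow> 'v \<Rightarrow> ('v \<Rightarrow> real) set" where
  "zero_forms V v0 = {w. \<forall>x. x \<notin> V - {v0} \<longrightarrow> w x = 0}"

definition int_zero_forms :: "'v set \<Rightarrow> 'v \<Rightarrow> ('v \<Rightarrow> real) set" where
  "int_zero_forms V v0 = {w \<in> zero_forms V v0. \<forall>x. w x \<in> \<int>}"

definition int_one_forms :: "('v \<times> 'v) set \<Rightarrow> ('v \<times> 'v \<Rightarrow> real) set" where
  "int_one_forms E = {m. (\<forall>e. m e \<in> \<int>) \<and> (\<forall>e. e \<notin> E \<longrightarrow> m e = 0)}"

definition grad :: "('v \<Rightarrow> real) \<Rightarrow> 'v \<times> 'v \<Rightarrow> real" where
  "grad w e = w (snd e) - w (fst e)"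

text \<open>The inner product of 0-forms (\<open>A = V\<close>) or of 1-forms (\<open>A = E\<close>).\<close>

definition form_inner :: "'a set \<Rightarrow> ('a \<Rightarrow> real) \<Rightarrow> ('a \<Rightarrow> real) \<Rightarrow> real" where
  "form_inner A f g = (\<Sum>a\<in>A. f a * g a)"

definition neg_laplacian ::
  "'v set \<Rightarrow> ('v \<times> 'v) set \<Rightarrow> 'v \<Rightarrow> ('v \<Rightarrow> real) \<Rightarrow> 'v \<Rightarrow> real" where
  "neg_laplacian V E v0 w x =
     (if x \<in> V - {v0} then \<Sum>y \<in> {y \<in> V. (x, y) \<in> E \<or> (y, x) \<in> E}. w x - w y else 0)"

lemma form_inner_neg_laplacian:
  assumes V: "finite V" and E: "E \<subseteq> V \<times> V" "E \<inter> E\<inverse> = {}" and w: "w \<in> zero_forms V v0"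
  shows "form_inner V w (neg_laplacian V E v0 w) = form_inner E (grad w) (grad w)"
proof -
  have fE: "finite E"
    using V E(1) finite_subset by blast
  have fst_sum: "(\<Sum>x\<in>V. \<Sum>y\<in>{y \<in> V. (x, y) \<in> E}. f x y) = (\<Sum>(x, y)\<in>E. f x y)"
    for f :: "'a \<Rightarrow> 'a \<Rightarrow> real"
    using V E(1) by (subst sum.Sigma) (auto intro!: sum.cong)
  have snd_sum: "(\<Sum>x\<in>V. \<Sum>y\<in>{y \<in> V. (y, x) \<in> E}. f x y) = (\<Sum>(x, y)\<in>E. f y x)"
    for f :: "'a \<Rightarrow> 'a \<Rightarrow> real"
    using V E(1) by (subst sum.Sigma)
      (auto intro!: sum.reindex_bij_witness[where i = "\<lambda>(x, y). (y, x)" and j = "\<lambda>(x, y). (y, x)"])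
  have "w x * neg_laplacian V E v0 w x =
      (\<Sum>y\<in>{y \<in> V. (x, y) \<in> E}. w x * (w x - w y)) + (\<Sum>y\<in>{y \<in> V. (y, x) \<in> E}. w x * (w x - w y))"
    if "x \<in> V" for x
  proof -
    have "{y \<in> V. (x, y) \<in> E \<or> (y, x) \<in> E} = {y \<in> V. (x, y) \<in> E} \<union> {y \<in> V. (y, x) \<in> E}"
      by auto
    moreover have "{y \<in> V. (x, y) \<in> E} \<inter> {y \<in> V. (y, x) \<in> E} = {}"
      using E(2) by auto
    ultimately have "(\<Sum>y\<in>{y \<in> V. (x, y) \<in> E \<or> (y, x) \<in> E}. w x * (w x - w y)) =
      (\<Sum>y\<in>{y \<in> V. (x, y) \<in> E}. w x * (w x - w y)) + (\<Sum>y\<in>{y \<in> V. (y, x) \<in> E}. w x * (w x - w y))"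
      using V by (simp add: sum.union_disjoint)
    moreover have "w x * neg_laplacian V E v0 w x =
      (\<Sum>y\<in>{y \<in> V. (x, y) \<in> E \<or> (y, x) \<in> E}. w x * (w x - w y))"
      using w that by (cases "x = v0") (auto simp: neg_laplacian_def zero_forms_def sum_distrib_left)
    ultimately show ?thesis by simp
  qed
  then have "form_inner V w (neg_laplacian V E v0 w) =
      (\<Sum>(x, y)\<in>E. w x * (w x - w y)) + (\<Sum>(x, y)\<in>E. w y * (w y - w x))"
    by (simp add: form_inner_def sum.distrib fst_sum snd_sum)
  also have "\<dots> = form_inner E (grad w) (grad w)"
    by (auto simp: form_inner_def grad_def sum.distrib[symmetric] algebra_simps intro!: sum.cong)
  finally show ?thesis .
qed

definition inv_neg_laplacian ::
  "'v set \<Rightarrow> ('v \<times> 'v) set \<Rightarrow> 'v \<Rightarrow> ('v \<Rightarrow> real) \<Rightarrow> 'v \<Rightarrow> real" where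
  "inv_neg_laplacian V E v0 = inv_into (zero_forms V v0) (neg_laplacian V E v0)"

text \<open>
  Elements of the product measure space over \<open>V - {v0}\<close> are \<open>undefined\<close> off \<open>V - {v0}\<close>;
  \<open>as_form\<close> turns them into 0-forms.
\<close>

definition as_form :: "'v set \<Rightarrow> 'v \<Rightarrow> ('v \<Rightarrow> real) \<Rightarrow> 'v \<Rightarrow> real" where
  "as_form V v0 w x = (if x \<in> V - {v0} then w x else 0)"

definition lebesgue_forms :: "'v set \<Rightarrow> 'v \<Rightarrow> ('v \<Rightarrow> real) measure" where
  "lebesgue_forms V v0 = (\<Pi>\<^sub>M x\<in>V - {v0}. lborel)"

definition Z_GFF :: "'v set \<Rightarrow> ('v \<times> 'v) set \<Rightarrow> 'v \<Rightarrow> real \<Rightarrow> real" where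
  "Z_GFF V E v0 \<beta> =
     (LINT \<phi>|lebesgue_forms V v0.
        exp (- \<beta> / 2 * form_inner E (grad (as_form V v0 \<phi>)) (grad (as_form V v0 \<phi>))))"

definition Z_IV :: "'v set \<Rightarrow> ('v \<times> 'v) set \<Rightarrow> 'v \<Rightarrow> real \<Rightarrow> real" where
  "Z_IV V E v0 \<beta> =
     (\<Sum>\<^sub>\<infinity>\<Psi>\<in>int_zero_forms V v0. exp (- \<beta> / 2 * form_inner E (grad \<Psi>) (grad \<Psi>)))"

definition Z_Coul :: "'v set \<Rightarrow> ('v \<times> 'v) set \<Rightarrow> 'v \<Rightarrow> real \<Rightarrow> real" where
  "Z_Coul V E v0 \<beta> =
     (\<Sum>\<^sub>\<infinity>q\<in>int_zero_forms V v0.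
        exp (- ((2 * pi)\<^sup>2 * \<beta>) / 2 * form_inner V q (inv_neg_laplacian V E v0 q)))"

definition Z_Vil :: "'v set \<Rightarrow> ('v \<times> 'v) set \<Rightarrow> 'v \<Rightarrow> real \<Rightarrow> real" where
  "Z_Vil V E v0 \<beta> =
     (LINT \<theta>:(\<Pi>\<^sub>E x\<in>V - {v0}. {0..<2 * pi})|lebesgue_forms V v0.
        \<Sum>\<^sub>\<infinity>m\<in>int_one_forms E.
          exp (- \<beta> / 2 * form_inner E
            (\<lambda>e. grad (as_form V v0 \<theta>) e + 2 * pi * m e)
            (\<lambda>e. grad (as_form V v0 \<theta>) e + 2 * pi * m e)))"

definition lattice_box :: "nat \<Rightarrow> (int \<times> int) set" where
  "lattice_box n = {- int n..int n} \<times> {- int n..int n}"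

definition box_edges :: "nat \<Rightarrow> ((int \<times> int) \<times> (int \<times> int)) set" where
  "box_edges n =
     {((a, b), (c, d)) | a b c d. (a, b) \<in> lattice_box n \<and> (c, d) \<in> lattice_box n \<and>
        (c = a + 1 \<and> d = b \<or> c = a \<and> d = b + 1)}"

type_synonym partition_function =
  "(int \<times> int) set \<Rightarrow> ((int \<times> int) \<times> (int \<times> int)) set \<Rightarrow> int \<times> int \<Rightarrow> real \<Rightarrow> real"

text \<open>The marked vertex of the \<open>n\<close>-th box is \<open>v0 n\<close>.\<close>

definition box_free_energy ::
  "partition_function \<Rightarrow> (nat \<Rightarrow> int \<times> int) \<Rightarrow> real \<Rightarrow> nat \<Rightarrow> real" where
  "box_free_energy Z v0 \<beta> n = ln (Z (lattice_box n) (box_edges n) (v0 n) \<beta>) / real (card (lattice_box n))"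

definition free_energy :: "partition_function \<Rightarrow> (nat \<Rightarrow> int \<times> int) \<Rightarrow> real \<Rightarrow> real" where
  "free_energy Z v0 \<beta> = lim (box_free_energy Z v0 \<beta>)"

end

theory Submission
  imports Defs "HOL-Probability.Probability" "HOL-Real_Asymp.Real_Asymp"
begin

text \<open>
  Three ideas carry the proof.

  Poisson summation.  The gradient energy of a finite connected graph is a positive definite quadratic
  form in the heights away from the marked vertex.  Poisson summation for this form gives, in every
  finite volume, the identity of \<open>Z_IV\<close> at \<open>inverse \<beta>\<close> with the product of \<open>Z_GFF\<close> at
  \<open>inverse \<beta>\<close> and \<open>Z_Coul\<close> at \<open>\<beta>\<close> (\<open>partition_functions\<close>).  The formula in many variables
  follows from the one on the line by completing the square one coordinate at a time
  (\<open>gaussian_poisson_data\<close>).  Applied to the edge variables of the Villain model, it turns the integral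
  over the angles into a sum over divergence-free integer flows.  On a box every such flow is the rotated
  gradient of an integer height function on the faces, so \<open>Z_Vil\<close> at \<open>\<beta>\<close> is an explicit constant
  times the partition function at \<open>1 / \<beta>\<close> of integer heights on the faces with zero boundary
  conditions (\<open>Z_Vil_box\<close>).

  Boundary conditions and limits.  By Poisson summation a Gaussian sum over a shifted lattice is at most
  the sum over the lattice itself, and by harmonic extension the same holds for sums with nonzero boundary
  values (\<open>boundary_le\<close>).  Hence a vertex with a neighbour of height zero can be summed out at the price
  of a constant factor (\<open>discrete_gaussian_insert_le\<close>), and summing out the outermost ring of a box
  shows that free and zero boundary conditions differ by a factor that is only exponential in the side
  length.  With zero boundary conditions the logarithm of the partition function is superadditive: over
  two disjoint sets of vertices, averaging over a flip of the sign of all heights in one of them can only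
  lower the sum, because the interaction factor averages to a hyperbolic cosine
  (\<open>sum_exp_superadditive\<close>).  This gives the limits (\<open>box_limit\<close>).  For the Gaussian free field
  the same inequalities hold because they are homogeneous and its partition function is the limit of
  rescaled integer-valued ones.

  The lower bound.  Superadditivity also holds for the Coulomb energy.  Applied to dipoles on the edges of
  a matching, it bounds \<open>Z_Coul\<close> below by the product of \<open>1 + 2 * exp (- 2 * pi\<^sup>2 * \<beta> * R)\<close> over these
  edges, where \<open>R\<close> is the effective resistance (\<open>coulomb_sum_ge_matching\<close>).  Four matchings cover
  the box.  By Foster's theorem the mean of \<open>R\<close> over all edges is the number of vertices less one
  divided by the number of edges (\<open>foster\<close>), which tends to \<open>1/2\<close>.  By convexity the free energy
  is at least \<open>exp (- (pi\<^sup>2 * \<beta>)) / 3\<close>.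
\<close>

section \<open>Poisson summation on the line\<close>

text \<open>
  Unordered sums over \<open>int\<close> or over integer-valued forms are enumerated, which reduces the exchange
  to the one for series.
\<close>

lemma integral_infsum:
  fixes f :: "'i \<Rightarrow> 'a \<Rightarrow> complex"
  assumes I: "countable I"
    and f: "\<And>i. i \<in> I \<Longrightarrow> integrable M (f i)"
    and x: "\<And>x. x \<in> space M \<Longrightarrow> (\<lambda>i. norm (f i x)) summable_on I"
    and s: "(\<lambda>i. \<integral>x. norm (f i x) \<partial>M) summable_on I"
  shows "(\<integral>x. (\<Sum>\<^sub>\<infinity>i\<in>I. f i x) \<partial>M) = (\<Sum>\<^sub>\<infinity>i\<in>I. \<integral>x. f i x \<partial>M)"
proof (cases "finite I")
  case True
  then show ?thesis
    using f by (simp add: Bochner_Integration.integral_sum)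
next
  case False
  define e where "e = from_nat_into I"
  have e: "bij_betw e UNIV I"
    unfolding e_def using I False by (rule bij_betw_from_nat_into)
  have eI: "e n \<in> I" for n
    using e by (auto simp: bij_betw_def)
  have sx: "summable (\<lambda>n. norm (f (e n) x))" if "x \<in> space M" for x
    using x[OF that] summable_on_reindex_bij_betw[OF e, of "\<lambda>i. norm (f i x)"]
    by (intro summable_on_imp_summable) simp
  have ss: "summable (\<lambda>n. \<integral>x. norm (f (e n) x) \<partial>M)"
    using s summable_on_reindex_bij_betw[OF e, of "\<lambda>i. \<integral>x. norm (f i x) \<partial>M"]
    by (intro summable_on_imp_summable) simp
  have inf: "(\<Sum>\<^sub>\<infinity>i\<in>I. g i) = (\<Sum>n. g (e n))" if "(\<lambda>i. norm (g i)) summable_on I" for g :: "'i \<Rightarrow> complex"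
  proof -
    have "(\<lambda>n. norm (g (e n))) summable_on UNIV"
      using that summable_on_reindex_bij_betw[OF e, of "\<lambda>i. norm (g i)"] by simp
    then have "((\<lambda>n. g (e n)) has_sum (\<Sum>\<^sub>\<infinity>n. g (e n))) UNIV"
      by (simp add: abs_summable_summable)
    then have "(\<lambda>n. g (e n)) sums (\<Sum>\<^sub>\<infinity>n. g (e n))"
      by (rule has_sum_imp_sums)
    then show ?thesis
      using infsum_reindex_bij_betw[OF e, of g] by (simp add: sums_unique)
  qed
  have n: "(\<lambda>i. norm (\<integral>x. f i x \<partial>M)) summable_on I"
    using s by (rule summable_on_comparison_test) (auto intro: integral_norm_bound)
  have ae: "AE x in M. summable (\<lambda>n. norm (f (e n) x))"
    using sx by auto
  have eq: "(\<Sum>\<^sub>\<infinity>i\<in>I. f i x) = (\<Sum>n. f (e n) x)" if "x \<in> space M" for x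
    using inf[OF x[OF that]] .
  have "(\<integral>x. (\<Sum>\<^sub>\<infinity>i\<in>I. f i x) \<partial>M) = (\<integral>x. (\<Sum>n. f (e n) x) \<partial>M)"
    using eq by (intro Bochner_Integration.integral_cong) auto
  also have "\<dots> = (\<Sum>n. \<integral>x. f (e n) x \<partial>M)"
    using f eI ae ss by (intro integral_suminf) auto
  also have "\<dots> = (\<Sum>\<^sub>\<infinity>i\<in>I. \<integral>x. f i x \<partial>M)"
    using inf[OF n] by simp
  finally show ?thesis .
qed

lemma summable_on_int_inverse_square: "(\<lambda>t::int. 1 / (1 + (real_of_int t)\<^sup>2)) summable_on UNIV"
proof -
  have n: "(\<lambda>n::nat. 1 / (1 + (real n)\<^sup>2)) summable_on UNIV"
  proof (rule norm_summable_imp_summable_on, rule summable_comparison_test_ev)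
    show "\<forall>\<^sub>F n in sequentially. norm (norm (1 / (1 + (real n)\<^sup>2))) \<le> 1 / real n ^ 2"
      using eventually_gt_at_top[of 0] by eventually_elim (simp add: frac_le)
    show "summable (\<lambda>n. 1 / real n ^ 2)"
      using inverse_power_summable[of 2, where 'a=real] by (simp add: field_simps)
  qed
  have "(\<lambda>t::int. 1 / (1 + (real_of_int t)\<^sup>2)) summable_on range int"
    using n by (subst summable_on_reindex) (auto simp: o_def)
  moreover have "(\<lambda>t::int. 1 / (1 + (real_of_int t)\<^sup>2)) summable_on range (\<lambda>n. - int n)"
    using n by (subst summable_on_reindex) (auto simp: o_def inj_on_def)
  moreover have "(UNIV :: int set) = range int \<union> range (\<lambda>n. - int n)"
    by (auto intro: int_cases2)
  ultimately show ?thesis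
    using summable_on_union by metis
qed

lemma sin_ge_half: "\<bar>y\<bar> / 2 \<le> \<bar>sin y\<bar>" if "\<bar>y\<bar> \<le> pi / 2" for y :: real
proof -
  have "pi \<le> 4" using pi_less_4 by simp
  have "\<bar>sin y - y\<bar> \<le> \<bar>y\<bar> ^ 3 / 6"
    using Maclaurin_sin_bound[of y 3] by (simp add: eval_nat_numeral sin_coeff_def)
  moreover have "\<bar>y\<bar> ^ 3 / 6 \<le> \<bar>y\<bar> / 2"
  proof -
    have "pi / 2 \<le> 1.7" using pi_approx by simp
    then have "\<bar>y\<bar> * \<bar>y\<bar> \<le> 1.7 * 1.7"
      using that by (intro mult_mono) auto
    then have "\<bar>y\<bar> * (\<bar>y\<bar> * \<bar>y\<bar>) \<le> \<bar>y\<bar> * 3"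
      by (intro mult_left_mono) auto
    then show ?thesis by (simp add: power3_eq_cube)
  qed
  ultimately show ?thesis by linarith
qed

lemma norm_cis_diff_one: "norm (cis y - 1) = 2 * \<bar>sin (y / 2)\<bar>"
proof -
  have "cis y - 1 = cis (y / 2) * (2 * \<i> * complex_of_real (sin (y / 2)))"
    using cos_double_sin[of "y / 2"] sin_double[of "y / 2"]
    by (simp add: complex_eq_iff power2_eq_square)
  then show ?thesis by (simp add: norm_mult)
qed

text \<open>
  The denominator by which \<open>poisson_summation\<close> divides vanishes only linearly at the two ends of the
  period.
\<close>

lemma norm_cis_diff_one_ge:
  assumes "0 \<le> x" "x \<le> 1"
  shows "2 * min x (1 - x) \<le> norm (cis (2 * pi * x) - 1)"
proof (cases "x \<le> 1/2")
  case True
  then have "\<bar>pi * x\<bar> / 2 \<le> \<bar>sin (pi * x)\<bar>"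
    using assms by (intro sin_ge_half) (auto simp: abs_mult)
  moreover have "2 * x \<le> pi * x" using pi_ge_two assms by (intro mult_right_mono) auto
  ultimately show ?thesis using assms True by (simp add: norm_cis_diff_one abs_mult)
next
  case False
  have "sin (pi * x) = sin (pi - pi * x)" by simp
  also have "\<dots> = sin (pi * (1 - x))" by (simp add: algebra_simps)
  finally have s: "sin (pi * x) = sin (pi * (1 - x))" .
  have "\<bar>pi * (1 - x)\<bar> / 2 \<le> \<bar>sin (pi * (1 - x))\<bar>"
    using assms False by (intro sin_ge_half) (auto simp: abs_mult)
  moreover have "2 * (1 - x) \<le> pi * (1 - x)" using pi_ge_two assms by (intro mult_right_mono) auto
  ultimately show ?thesis using assms False by (simp add: norm_cis_diff_one abs_mult s)
qed

lemma integral_cis_int: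
  fixes L :: real and j :: int
  assumes L: "0 < L"
  shows "(\<integral>x. indicator {0..<L} x *\<^sub>R cis (2 * pi * j * x / L) \<partial>lborel) = (if j = 0 then L else 0)"
proof -
  have [measurable]: "(\<lambda>x. cis (2 * pi * j * x / L)) \<in> borel_measurable borel"
    using L by (intro borel_measurable_continuous_onI continuous_intros) auto
  have "(\<integral>x. indicator {0..<L} x *\<^sub>R cis (2 * pi * j * x / L) \<partial>lborel) =
        (\<integral>x. indicator {0..L} x *\<^sub>R cis (2 * pi * j * x / L) \<partial>lborel)"
  proof (rule integral_cong_AE)
    show "AE x in lborel. indicator {0..<L} x *\<^sub>R cis (2 * pi * j * x / L) = indicator {0..L} x *\<^sub>R cis (2 * pi * j * x / L)"
      using AE_lborel_singleton[of L] by eventually_elim (auto simp: indicator_def)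
  qed auto
  also have "\<dots> = (if j = 0 then L else 0)"
  proof (cases "j = 0")
    case True
    then show ?thesis using L by (simp add: scaleR_conv_of_real)
  next
    case False
    define w :: complex where "w = \<i> * of_real (2 * pi * j / L)"
    have w0: "w \<noteq> 0" using False L by (auto simp: w_def)
    have cw: "cis (2 * pi * j * x / L) = exp (w * of_real x)" for x
      by (simp add: cis_conv_exp w_def algebra_simps)
    have "(\<integral>x. indicator {0..L} x *\<^sub>R exp (w * of_real x) \<partial>lborel) = exp (w * of_real L) / w - exp (w * of_real 0) / w"
    proof (rule integral_FTC_Icc)
      show "((\<lambda>x. exp (w * of_real x) / w) has_vector_derivative exp (w * of_real x)) (at x within {0..L})" for x
        using w0 by (intro has_vector_derivative_real_field) (auto intro!: derivative_eq_intros)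
      show "continuous_on {0..L} (\<lambda>x. exp (w * of_real x))"
        by (intro continuous_intros)
    qed (use L in auto)
    moreover have "exp (w * of_real L) = 1"
    proof -
      have "exp (w * of_real L) = cis (2 * pi * j)"
        using L by (simp add: cis_conv_exp w_def)
      also have "\<dots> = 1" by (simp add: cis_multiple_2pi)
      finally show ?thesis .
    qed
    ultimately show ?thesis using False by (simp add: cw)
  qed
  finally show ?thesis .
qed

lemma borel_measurable_cnj [measurable (raw)]:
  "f \<in> borel_measurable M \<Longrightarrow> (\<lambda>x. cnj (f x)) \<in> borel_measurable M"
  by (rule measurable_compose[of f M borel cnj borel]) (auto intro!: borel_measurable_continuous_onI continuous_intros)

text \<open>
  Subtracting from \<open>k\<close> one more of its projections lowers the square integral by exactly the square
  of that coefficient, and leaves the remaining coefficients unchanged.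
\<close>

lemma (in prob_space) bessel_inequality:
  fixes k :: "'a \<Rightarrow> complex" and e :: "'i \<Rightarrow> 'a \<Rightarrow> complex"
  assumes k[measurable]: "k \<in> borel_measurable M" and K: "\<And>x. x \<in> space M \<Longrightarrow> norm (k x) \<le> K"
    and e[measurable]: "\<And>p. e p \<in> borel_measurable M" and e1: "\<And>p x. x \<in> space M \<Longrightarrow> norm (e p x) = 1"
    and orth: "\<And>p q. p \<noteq> q \<Longrightarrow> (\<integral>x. e p x * cnj (e q x) \<partial>M) = 0"
    and P: "finite P"
  shows "(\<Sum>p\<in>P. (norm (\<integral>x. k x * cnj (e p x) \<partial>M))\<^sup>2) \<le> (\<integral>x. (norm (k x))\<^sup>2 \<partial>M)"
proof -
  define a where "a p = (\<integral>x. k x * cnj (e p x) \<partial>M)" for p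
  define S where "S P x = k x - (\<Sum>p\<in>P. a p * e p x)" for P x
  have [measurable]: "S P \<in> borel_measurable M" for P
    unfolding S_def by measurable
  have SB: "norm (S P x) \<le> K + (\<Sum>p\<in>P. norm (a p))" if "x \<in> space M" for P x
  proof -
    have "norm (\<Sum>p\<in>P. a p * e p x) \<le> (\<Sum>p\<in>P. norm (a p))"
      using e1[OF that] by (intro sum_norm_le) (simp add: norm_mult)
    then show ?thesis
      unfolding S_def using K[OF that] norm_triangle_ineq4[of "k x" "\<Sum>p\<in>P. a p * e p x"] by linarith
  qed
  have iS: "integrable M (\<lambda>x. S P x * cnj (e q x))" for P q
    by (rule integrable_const_bound[where B = "K + (\<Sum>p\<in>P. norm (a p))"]) (auto intro!: AE_I2 simp: norm_mult e1 SB)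
  have ie: "integrable M (\<lambda>x. e p x * cnj (e q x))" for p q
    by (rule integrable_const_bound[where B = 1]) (auto intro!: AE_I2 simp: norm_mult e1)
  have iS2: "integrable M (\<lambda>x. (norm (S P x))\<^sup>2)" for P
    by (rule integrable_const_bound[where B = "(K + (\<Sum>p\<in>P. norm (a p)))\<^sup>2"]) (auto intro!: AE_I2 power_mono SB)
  have "(\<forall>q. q \<notin> P \<longrightarrow> (\<integral>x. S P x * cnj (e q x) \<partial>M) = a q) \<and>
        (\<integral>x. (norm (S P x))\<^sup>2 \<partial>M) = (\<integral>x. (norm (k x))\<^sup>2 \<partial>M) - (\<Sum>p\<in>P. (norm (a p))\<^sup>2)"
    using P
  proof induction
    case empty
    then show ?case by (simp add: S_def a_def)
  next
    case (insert p P)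
    have SS: "S (insert p P) x = S P x - a p * e p x" for x
      using insert by (simp add: S_def)
    have "(\<integral>x. S (insert p P) x * cnj (e q x) \<partial>M) = a q" if "q \<notin> insert p P" for q
    proof -
      have "(\<integral>x. S (insert p P) x * cnj (e q x) \<partial>M) = (\<integral>x. S P x * cnj (e q x) - a p * (e p x * cnj (e q x)) \<partial>M)"
        by (simp add: SS algebra_simps)
      also have "\<dots> = (\<integral>x. S P x * cnj (e q x) \<partial>M) - a p * (\<integral>x. e p x * cnj (e q x) \<partial>M)"
        using iS ie by (subst Bochner_Integration.integral_diff) auto
      also have "\<dots> = a q" using insert that orth[of p q] by auto
      finally show ?thesis .
    qed
    moreover have "(\<integral>x. (norm (S (insert p P) x))\<^sup>2 \<partial>M) = (\<integral>x. (norm (S P x))\<^sup>2 \<partial>M) - (norm (a p))\<^sup>2"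
    proof -
      have pt: "(norm (S (insert p P) x))\<^sup>2 = (norm (S P x))\<^sup>2 - 2 * Re (cnj (a p) * (S P x * cnj (e p x))) + (norm (a p))\<^sup>2"
        if "x \<in> space M" for x
      proof -
        have "norm (e p x) = 1" using e1 that by simp
        then have 1: "(Re (e p x))\<^sup>2 + (Im (e p x))\<^sup>2 = 1" by (simp add: cmod_def)
        have "(norm (a p * e p x))\<^sup>2 = (norm (a p))\<^sup>2"
            and "Re (cnj (a p * e p x) * S P x) = Re (cnj (a p) * (S P x * cnj (e p x)))" using e1[OF that] by (simp_all add: norm_mult mult_ac)
        moreover have "(norm (s - w))\<^sup>2 = (norm s)\<^sup>2 - 2 * Re (cnj w * s) + (norm w)\<^sup>2" for s w :: complex
          unfolding cmod_power2 by (simp add: power2_eq_square algebra_simps)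
        ultimately show ?thesis
          unfolding SS by metis
      qed
      have "(\<integral>x. (norm (S (insert p P) x))\<^sup>2 \<partial>M) =
         (\<integral>x. (norm (S P x))\<^sup>2 - 2 * Re (cnj (a p) * (S P x * cnj (e p x))) + (norm (a p))\<^sup>2 \<partial>M)"
        using pt by (intro Bochner_Integration.integral_cong) auto
      also have "\<dots> = (\<integral>x. (norm (S P x))\<^sup>2 \<partial>M) - 2 * (\<integral>x. Re (cnj (a p) * (S P x * cnj (e p x))) \<partial>M) + (norm (a p))\<^sup>2"
        using iS2 iS by (simp add: integrable_Re prob_space del: times_complex.simps)
      also have "(\<integral>x. Re (cnj (a p) * (S P x * cnj (e p x))) \<partial>M) = Re (cnj (a p) * a p)"
        using iS insert by (subst integral_Re) auto
      also have "\<dots> = (norm (a p))\<^sup>2" unfolding cmod_power2 by (simp add: power2_eq_square)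
      finally show ?thesis by simp
    qed
    ultimately show ?case using insert by auto
  qed
  moreover have "0 \<le> (\<integral>x. (norm (S P x))\<^sup>2 \<partial>M)" by simp
  ultimately show ?thesis by (simp add: a_def)
qed


lemma inverse_square_shift:
  fixes x t :: real
  assumes "0 \<le> x" "x \<le> 1"
  shows "1 / (1 + (x + t)\<^sup>2) \<le> 3 / (1 + t\<^sup>2)"
proof -
  define u v where "u = (x + t)\<^sup>2" and "v = x\<^sup>2"
  have "t\<^sup>2 \<le> 2 * u + 2 * v"
    unfolding u_def v_def using zero_le_power2[of "2 * x + t"] by (simp add: power2_eq_square algebra_simps)
  moreover have "v \<le> 1" unfolding v_def using assms by (simp add: power_le_one)
  moreover have "0 \<le> u" by (simp add: u_def)
  ultimately have "1 + t\<^sup>2 \<le> 3 * (1 + u)" by (smt (verit))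
  moreover have "0 < 1 + t\<^sup>2" "0 < 1 + u" by (auto simp: u_def intro: add_pos_nonneg)
  ultimately show ?thesis unfolding u_def[symmetric] by (simp add: field_simps)
qed

text \<open>
  Cutting the line into unit intervals turns the Fourier coefficients of a periodised function into
  values of the Fourier transform of the function.
\<close>

lemma integral_periodize:
  fixes G :: "real \<Rightarrow> complex"
  assumes G: "integrable lborel G"
  shows "((\<lambda>t::int. \<integral>x. indicator {0..<1} x *\<^sub>R G (x + of_int t) \<partial>lborel) has_sum (\<integral>x. G x \<partial>lborel)) UNIV"
proof -
  define f where "f t x = indicator {real_of_int t..<of_int t + 1} x *\<^sub>R G x" for t x
  have fx: "f t x = (if t = \<lfloor>x\<rfloor> then G x else 0)" for t x
    by (auto simp: f_def indicator_def floor_eq_iff) (metis floor_unique less_le_not_le not_less)+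
  have iG: "integrable lborel (\<lambda>x. norm (G x))" using G by simp
  have int: "integrable lborel (f t)" for t
    unfolding f_def using G by (intro integrable_mult_indicator) auto
  have nf: "norm (f t x) = (if t = \<lfloor>x\<rfloor> then norm (G x) else 0)" for t x
    by (simp add: fx)
  have bd: "(\<Sum>t\<in>F. \<integral>x. norm (f t x) \<partial>lborel) \<le> (\<integral>x. norm (G x) \<partial>lborel)" if "finite F" for F
  proof -
    have "(\<Sum>t\<in>F. \<integral>x. norm (f t x) \<partial>lborel) = (\<integral>x. (\<Sum>t\<in>F. norm (f t x)) \<partial>lborel)"
      using int by (subst Bochner_Integration.integral_sum) auto
    also have "\<dots> \<le> (\<integral>x. norm (G x) \<partial>lborel)"
    proof (rule integral_mono[OF _ iG])
      show "integrable lborel (\<lambda>x. \<Sum>t\<in>F. norm (f t x))" using int by auto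
    qed (auto simp: nf sum.delta that)
    finally show ?thesis .
  qed
  have s: "(\<lambda>t. \<integral>x. norm (f t x) \<partial>lborel) summable_on UNIV"
    using bd by (intro nonneg_bdd_above_summable_on) (auto intro!: bdd_aboveI2)
  have sx: "(\<lambda>t. norm (f t x)) summable_on UNIV" for x
    by (rule finite_nonzero_values_imp_summable_on) (rule finite_subset[of _ "{\<lfloor>x\<rfloor>}"], auto simp: fx split: if_splits)
  have "(\<Sum>\<^sub>\<infinity>t. f t x) = (\<Sum>t\<in>{\<lfloor>x\<rfloor>}. f t x)" for x
    by (subst infsum_finite[symmetric, OF finite.insertI[OF finite.emptyI]], rule infsum_cong_neutral) (auto simp: fx)
  then have "(\<Sum>\<^sub>\<infinity>t. f t x) = G x" for x by (simp add: fx)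
  then have "(\<integral>x. G x \<partial>lborel) = (\<Sum>\<^sub>\<infinity>t. \<integral>x. f t x \<partial>lborel)"
    using integral_infsum[of UNIV lborel f] int sx s by simp
  moreover have "(\<lambda>t. \<integral>x. f t x \<partial>lborel) summable_on UNIV"
    by (rule abs_summable_summable, rule summable_on_comparison_test[OF s]) (auto intro: integral_norm_bound)
  ultimately have "((\<lambda>t. \<integral>x. f t x \<partial>lborel) has_sum (\<integral>x. G x \<partial>lborel)) UNIV"
    by simp
  moreover have "(\<integral>x. f t x \<partial>lborel) = (\<integral>x. indicator {0..<1} x *\<^sub>R G (x + of_int t) \<partial>lborel)" for t
    by (subst lborel_integral_real_affine[where c = 1 and t = "of_int t"])
       (auto simp: f_def indicator_def add.commute intro!: Bochner_Integration.integral_cong)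
  ultimately show ?thesis by simp
qed

text \<open>
  The periodisation \<open>H\<close> of \<open>g\<close> is Lipschitz and \<open>H 1 = H 0\<close>, so
  \<open>k x = (H x - H 0) / (cis (2 * pi * x) - 1)\<close> is bounded on the period.  Multiplication by
  \<open>cis (2 * pi * x)\<close> shifts the Fourier index by one, so the Fourier coefficients \<open>b\<close> of \<open>k\<close> satisfy
  \<open>b (p - 1) - b p = a p\<close> except at \<open>p = 0\<close>, where \<open>H 0\<close> is subtracted on the right.  Symmetric
  partial sums of \<open>a\<close> therefore telescope to \<open>H 0\<close> plus a difference of values of \<open>b\<close>, which tend to \<open>0\<close> by
  Bessel's inequality.
\<close>

theorem poisson_summation:
  fixes g g' :: "real \<Rightarrow> complex" and C :: real and a :: "int \<Rightarrow> complex"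
  assumes deriv: "\<And>x. (g has_vector_derivative g' x) (at x)"
    and g: "\<And>x. norm (g x) \<le> C / (1 + x\<^sup>2)" and g': "\<And>x. norm (g' x) \<le> C / (1 + x\<^sup>2)"
    and int: "integrable lborel g"
    and a: "\<And>p. (\<integral>x. g x * cis (- 2 * pi * of_int p * x) \<partial>lborel) = a p"
    and sa: "(\<lambda>p. norm (a p)) summable_on UNIV"
  shows "(\<Sum>\<^sub>\<infinity>t::int. g (of_int t)) = (\<Sum>\<^sub>\<infinity>p. a p)"
proof -
  define D where "D t = 3 * C / (1 + (real_of_int t)\<^sup>2)" for t :: int
  define K where "K = (\<Sum>\<^sub>\<infinity>t. D t)"
  have C0: "0 \<le> C" using order_trans[OF norm_ge_zero g[of 0]] by simp
  have sD: "D summable_on UNIV"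
    using summable_on_cmult_right[OF summable_on_int_inverse_square, of "3 * C"] by (simp add: D_def[abs_def])
  have D0: "0 \<le> D t" for t using C0 by (simp add: D_def)
  have K0: "0 \<le> K" unfolding K_def using D0 by (intro infsum_nonneg) auto
  have shift: "C / (1 + (x + of_int t)\<^sup>2) \<le> D t" if "0 \<le> x" "x \<le> 1" for x t
    using mult_left_mono[OF inverse_square_shift[OF that, of "of_int t"] C0] by (simp add: D_def mult.commute)
  have gD: "norm (g (x + of_int t)) \<le> D t" if "0 \<le> x" "x \<le> 1" for x t
    using g[of "x + of_int t"] shift[OF that, of t] by linarith
  have lip: "norm (g (x + of_int t) - g (y + of_int t)) \<le> D t * \<bar>x - y\<bar>"
    if "0 \<le> x" "x \<le> 1" "0 \<le> y" "y \<le> 1" for x y t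
  proof -
    have "norm (g (x + of_int t) - g (y + of_int t)) \<le> D t * norm (x - y)"
    proof (rule differentiable_bound[where S = "{0..1}" and f = "\<lambda>x. g (x + of_int t)" and f' = "\<lambda>x h. h *\<^sub>R g' (x + of_int t)"])
      fix z :: real assume z: "z \<in> {0..1}"
      have "((\<lambda>x. g (x + of_int t)) has_derivative (\<lambda>h. h *\<^sub>R g' (z + of_int t))) (at z)"
        using deriv[of "z + of_int t"] unfolding has_vector_derivative_def
        by (rule has_derivative_compose[rotated, of g "\<lambda>h. h *\<^sub>R g' (z + of_int t)" "\<lambda>x. x + of_int t" z "\<lambda>h. h" UNIV])
           (auto intro!: derivative_eq_intros)
      then show "((\<lambda>x. g (x + of_int t)) has_derivative (\<lambda>h. h *\<^sub>R g' (z + of_int t))) (at z within {0..1})"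
        by (rule has_derivative_at_withinI)
      have "norm (g' (z + of_int t)) \<le> D t" using g'[of "z + of_int t"] shift[of z t] z by auto
      then show "onorm (\<lambda>h. h *\<^sub>R g' (z + of_int t)) \<le> D t"
        by (intro onorm_le) (simp, subst mult.commute, rule mult_right_mono, auto)
    qed (use that in auto)
    then show ?thesis by simp
  qed
  define H where "H x = (\<Sum>\<^sub>\<infinity>t. g (x + of_int t))" for x
  have sg: "(\<lambda>t. norm (g (x + of_int t))) summable_on UNIV" if "0 \<le> x" "x \<le> 1" for x
    using gD[OF that] by (intro summable_on_comparison_test[OF sD]) auto
  have sg': "(\<lambda>t. g (x + of_int t)) summable_on UNIV" if "0 \<le> x" "x \<le> 1" for x
    using sg[OF that] by (rule abs_summable_summable)
  have Hlip: "norm (H x - H y) \<le> K * \<bar>x - y\<bar>" if "0 \<le> x" "x \<le> 1" "0 \<le> y" "y \<le> 1" for x y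
  proof -
    have "H x - H y = (\<Sum>\<^sub>\<infinity>t. g (x + of_int t) - g (y + of_int t))"
      unfolding H_def using infsum_add[OF sg'[of x], of "\<lambda>t. - g (y + of_int t)"] sg'[of y] that
      by (simp add: infsum_uminus summable_on_uminus)
    also have "norm \<dots> \<le> (\<Sum>\<^sub>\<infinity>t. D t * \<bar>x - y\<bar>)"
    proof (rule norm_infsum_le)
      have s: "(\<lambda>t. D t * \<bar>x - y\<bar>) summable_on UNIV"
        using sD by (intro summable_on_cmult_left)
      then show "((\<lambda>t. D t * \<bar>x - y\<bar>) has_sum (\<Sum>\<^sub>\<infinity>t. D t * \<bar>x - y\<bar>)) UNIV"
        by (rule has_sum_infsum)
      have "(\<lambda>t. g (x + of_int t) - g (y + of_int t)) summable_on UNIV"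
        by (rule abs_summable_summable, rule summable_on_comparison_test[OF s]) (use lip[OF that] in auto)
      then show "((\<lambda>t. g (x + of_int t) - g (y + of_int t)) has_sum (\<Sum>\<^sub>\<infinity>t. g (x + of_int t) - g (y + of_int t))) UNIV"
        by (rule has_sum_infsum)
    qed (use lip[OF that] in auto)
    also have "\<dots> = K * \<bar>x - y\<bar>" using sD by (simp add: K_def infsum_cmult_left)
    finally show ?thesis .
  qed
  have H1: "H 1 = H 0"
    unfolding H_def by (rule infsum_reindex_bij_witness[where i = "\<lambda>t. t - 1" and j = "\<lambda>t. t + 1"]) (auto simp: add.commute)
  define M where "M = restrict_space lborel {0..<1::real}"
  have M: "prob_space M"
    by (rule prob_spaceI) (simp add: M_def emeasure_restrict_space)
  interpret prob_space M by (rule M)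
  have spM: "space M = {0..<1}" by (simp add: M_def space_restrict_space)
  have intM: "(\<integral>x. f x \<partial>M) = (\<integral>x. indicator {0..<1} x *\<^sub>R f x \<partial>lborel)" for f :: "real \<Rightarrow> complex"
    unfolding M_def by (subst integral_restrict_space) auto
  have mM: "f \<in> borel_measurable M" if "f \<in> borel_measurable borel" for f :: "real \<Rightarrow> complex"
    using that unfolding M_def by (simp add: measurable_restrict_space1)
  have contM: "f \<in> borel_measurable M" if "continuous_on {0..<1} f" for f :: "real \<Rightarrow> complex"
  proof -
    have "f \<in> borel_measurable (restrict_space borel {0..<1})"
      using that by (rule borel_measurable_continuous_on_restrict)
    moreover have "sets M = sets (restrict_space borel {0..<1})"
      unfolding M_def by (rule sets_restrict_space_cong) simp
    then have "borel_measurable M = (borel_measurable (restrict_space borel {0..<1}) :: (real \<Rightarrow> complex) set)"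
      by (rule measurable_cong_sets) (rule refl)
    ultimately show ?thesis by blast
  qed
  have Hcont: "continuous_on {0..<1} H"
  proof (rule continuous_on_subset[of "{0..1}"])
    have "K-lipschitz_on {0..1} H"
      using Hlip K0 by (intro lipschitz_onI) (auto simp: dist_norm)
    then show "continuous_on {0..1} H" by (rule lipschitz_on_continuous_on)
  qed auto
  define e where "e p x = cis (2 * pi * of_int p * x)" for p :: int and x :: real
  have em: "e p \<in> borel_measurable M" for p
    unfolding e_def by (intro contM continuous_intros)
  have ee: "e p x * cnj (e q x) = e (p - q) x" for p q x
    by (simp add: e_def cis_cnj cis_mult algebra_simps)
  have ie: "(\<integral>x. e p x \<partial>M) = (if p = 0 then 1 else 0)" for p
    using integral_cis_int[of 1 p] by (simp add: intM e_def)
  have e1: "norm (e p x) = 1" for p x by (simp add: e_def)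
  define k where "k x = (H x - H 0) / (cis (2 * pi * x) - 1)" for x
  have ck: "cis (2 * pi * x) \<noteq> 1" if "0 < x" "x < 1" for x
    using norm_cis_diff_one_ge[of x] that by auto
  have kK: "norm (k x) \<le> K" if "x \<in> space M" for x
  proof -
    have x: "0 \<le> x" "x < 1" using that by (auto simp: spM)
    have "norm (H x - H 0) \<le> K * min x (1 - x)"
      using Hlip[of x 0] Hlip[of x 1] x by (auto simp: H1 min_def)
    also have "\<dots> \<le> K * norm (cis (2 * pi * x) - 1)"
      using norm_cis_diff_one_ge[of x] x K0 by (intro mult_left_mono) (auto simp: min_def split: if_splits)
    finally show ?thesis using K0 by (auto simp: k_def norm_divide divide_simps)
  qed
  have km: "k \<in> borel_measurable M"
  proof -
    have [measurable]: "H \<in> borel_measurable M" using Hcont by (rule contM)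
    have [measurable]: "(\<lambda>x. cis (2 * pi * x)) \<in> borel_measurable M"
      by (intro contM continuous_intros)
    show ?thesis unfolding k_def by measurable
  qed
  define b where "b p = (\<integral>x. k x * cnj (e p x) \<partial>M)" for p
  have bessel: "(\<Sum>p\<in>P. (norm (b p))\<^sup>2) \<le> (\<integral>x. (norm (k x))\<^sup>2 \<partial>M)" if "finite P" for P
    unfolding b_def using that by (intro bessel_inequality[where K = K]) (auto simp: km kK em e1 ee ie)
  have lim_b: "(\<lambda>n. b (f n)) \<longlonglongrightarrow> 0" if "inj f" for f :: "nat \<Rightarrow> int"
  proof -
    have "summable (\<lambda>n. (norm (b (f n)))\<^sup>2)"
    proof (rule bounded_imp_summable[where B = "\<integral>x. (norm (k x))\<^sup>2 \<partial>M"])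
      show "(\<Sum>n\<le>N. (norm (b (f n)))\<^sup>2) \<le> (\<integral>x. (norm (k x))\<^sup>2 \<partial>M)" for N
        using bessel[of "f ` {..N}"] that by (simp add: sum.reindex inj_on_def)
    qed auto
    then have "(\<lambda>n. (norm (b (f n)))\<^sup>2) \<longlonglongrightarrow> 0" by (rule summable_LIMSEQ_zero)
    then have "(\<lambda>n. sqrt ((norm (b (f n)))\<^sup>2)) \<longlonglongrightarrow> sqrt 0" by (rule tendsto_real_sqrt)
    then show ?thesis by (simp add: tendsto_norm_zero_iff)
  qed
  have Hm: "H \<in> borel_measurable M" using Hcont by (rule contM)
  have Hb: "norm (H x) \<le> K" if "x \<in> space M" for x
    unfolding H_def K_def using gD sg' that
    by (intro norm_infsum_le[OF has_sum_infsum has_sum_infsum]) (auto simp: spM sD)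
  have hatH: "(\<integral>x. H x * cnj (e p x) \<partial>M) = a p" for p
  proof -
    define G where "G x = g x * cis (- 2 * pi * of_int p * x)" for x
    have Gm: "integrable lborel G"
    proof (rule Bochner_Integration.integrable_bound[OF int])
      show "G \<in> borel_measurable lborel"
        unfolding G_def using borel_measurable_integrable[OF int]
        by (intro borel_measurable_times) (auto intro!: borel_measurable_continuous_onI continuous_intros)
    qed (auto simp: G_def norm_mult)
    have Gp: "G (x + of_int t) = g (x + of_int t) * cnj (e p x)" for x t
    proof -
      have "cis (- 2 * pi * of_int p * (x + of_int t)) = cis (- (2 * pi * of_int p * x)) * cis (2 * pi * of_int (- p * t))"
        by (simp add: cis_mult algebra_simps)
      also have "cis (2 * pi * of_int (- p * t)) = 1" by (simp only: cis_multiple_2pi Ints_of_int)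
      finally show ?thesis by (simp add: G_def e_def cis_cnj)
    qed
    have gm: "(\<lambda>x. g (x + of_int t)) \<in> borel_measurable M" for t
    proof (intro mM)
      have gc: "continuous_on UNIV g"
        using deriv by (meson continuous_at_imp_continuous_on has_vector_derivative_continuous)
      have "continuous_on UNIV (\<lambda>x. g (x + of_int t))"
        by (rule continuous_on_compose2[OF gc]) (auto intro: continuous_intros)
      then show "(\<lambda>x. g (x + of_int t)) \<in> borel_measurable borel"
        by (rule borel_measurable_continuous_onI)
    qed
    have iN: "integrable M (\<lambda>x. g (x + of_int t) * cnj (e p x))" for t
      by (rule integrable_const_bound[where B = "D t"])
         (use gm em gD in \<open>auto intro!: AE_I2 borel_measurable_times simp: norm_mult e1 spM\<close>)
    have "(\<integral>x. H x * cnj (e p x) \<partial>M) = (\<integral>x. (\<Sum>\<^sub>\<infinity>t. g (x + of_int t) * cnj (e p x)) \<partial>M)"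
      unfolding H_def by (intro Bochner_Integration.integral_cong refl infsum_cmult_left[symmetric]) (auto simp: spM intro!: sg')
    also have "\<dots> = (\<Sum>\<^sub>\<infinity>t. \<integral>x. g (x + of_int t) * cnj (e p x) \<partial>M)"
    proof (rule integral_infsum)
      show "(\<lambda>t. \<integral>x. norm (g (x + of_int t) * cnj (e p x)) \<partial>M) summable_on UNIV"
      proof (rule summable_on_comparison_test[OF sD])
        fix t
        have "(\<integral>x. norm (g (x + of_int t) * cnj (e p x)) \<partial>M) \<le> (\<integral>x. D t \<partial>M)"
          using integrable_norm[OF iN[of t]] gD by (intro integral_mono) (auto simp: norm_mult e1 spM)
        then show "(\<integral>x. norm (g (x + of_int t) * cnj (e p x)) \<partial>M) \<le> D t" by (simp add: prob_space)
      qed auto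
    qed (use iN sg in \<open>auto simp: norm_mult e1 spM\<close>)
    also have "\<dots> = (\<Sum>\<^sub>\<infinity>t. \<integral>x. indicator {0..<1} x *\<^sub>R G (x + of_int t) \<partial>lborel)"
      by (simp add: intM Gp)
    also have "\<dots> = (\<integral>x. G x \<partial>lborel)"
      using integral_periodize[OF Gm] by (rule infsumI)
    finally show ?thesis using a[of p] by (simp add: G_def)
  qed
  have diff: "b (p - 1) - b p = a p - (if p = 0 then H 0 else 0)" for p
  proof -
    have int_k: "integrable M (\<lambda>x. k x * cnj (e p x))" for p
      by (rule integrable_const_bound[where B = K]) (use em km kK in \<open>auto intro!: AE_I2 borel_measurable_times simp: norm_mult e1\<close>)
    have int_H: "integrable M (\<lambda>x. H x * cnj (e p x))" for p
      by (rule integrable_const_bound[where B = K]) (use em Hm Hb in \<open>auto intro!: AE_I2 borel_measurable_times simp: norm_mult e1\<close>)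
    have int_e: "integrable M (\<lambda>x. cnj (e p x))" for p
      by (rule integrable_const_bound[where B = 1]) (use em in \<open>auto intro!: AE_I2 simp: e1\<close>)
    have "b (p - 1) - b p = (\<integral>x. k x * cnj (e (p - 1) x) - k x * cnj (e p x) \<partial>M)"
      unfolding b_def using int_k by (simp add: Bochner_Integration.integral_diff)
    also have "\<dots> = (\<integral>x. H x * cnj (e p x) - H 0 * cnj (e p x) \<partial>M)"
    proof (rule Bochner_Integration.integral_cong[OF refl])
      fix x assume x: "x \<in> space M"
      have "cnj (e (p - 1) x) = cnj (e p x) * cis (2 * pi * x)"
        by (simp add: e_def cis_cnj cis_mult algebra_simps)
      then have "k x * cnj (e (p - 1) x) - k x * cnj (e p x) = (k x * (cis (2 * pi * x) - 1)) * cnj (e p x)"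
        by (simp add: algebra_simps)
      also have "k x * (cis (2 * pi * x) - 1) = H x - H 0"
        using ck[of x] x by (cases "x = 0") (auto simp: k_def spM)
      finally show "k x * cnj (e (p - 1) x) - k x * cnj (e p x) = H x * cnj (e p x) - H 0 * cnj (e p x)"
        by (simp add: algebra_simps)
    qed
    also have "\<dots> = a p - H 0 * (\<integral>x. cnj (e p x) \<partial>M)"
      using int_H int_e by (subst Bochner_Integration.integral_diff) (auto simp: hatH)
    also have "(\<integral>x. cnj (e p x) \<partial>M) = (if p = 0 then 1 else 0)"
      using ie[of p] by (simp add: integral_cnj)
    finally show ?thesis by simp
  qed
  have part: "(\<Sum>p\<in>{- int N..int N}. a p) = H 0 + b (- 1 - int N) - b (int N)" for N
  proof (induction N)
    case 0
    then show ?case using diff[of 0] by (simp add: algebra_simps)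
  next
    case (Suc N)
    have "{- int (Suc N)..int (Suc N)} = insert (- int (Suc N)) (insert (int (Suc N)) {- int N..int N})"
      by auto
    then have "(\<Sum>p\<in>{- int (Suc N)..int (Suc N)}. a p) = a (- int (Suc N)) + (a (int (Suc N)) + (\<Sum>p\<in>{- int N..int N}. a p))"
      by (simp add: sum.insert)
    then show ?case
      using Suc diff[of "int (Suc N)"] diff[of "- int (Suc N)"] by (simp add: algebra_simps)
  qed
  have "(\<lambda>N. H 0 + b (- 1 - int N) - b (int N)) \<longlonglongrightarrow> H 0 + 0 - 0"
    by (intro tendsto_intros lim_b) (auto simp: inj_on_def)
  then have l1: "(\<lambda>N. \<Sum>p\<in>{- int N..int N}. a p) \<longlonglongrightarrow> H 0" by (simp add: part)
  have "(a has_sum (\<Sum>\<^sub>\<infinity>p. a p)) UNIV" using sa by (simp add: abs_summable_summable)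
  moreover have "filterlim (\<lambda>N. {- int N..int N}) (finite_subsets_at_top UNIV) sequentially"
  proof (subst filterlim_finite_subsets_at_top, intro allI impI, elim conjE)
    fix X :: "int set" assume X: "finite X"
    have "\<forall>\<^sub>F N in sequentially. \<forall>x\<in>X. \<bar>x\<bar> \<le> int N"
    proof (rule eventually_ball_finite[OF X], rule ballI)
      fix x assume "x \<in> X"
      show "\<forall>\<^sub>F N in sequentially. \<bar>x\<bar> \<le> int N"
        using eventually_ge_at_top[of "nat \<bar>x\<bar>"] by eventually_elim auto
    qed
    then show "\<forall>\<^sub>F N in sequentially. finite {- int N..int N} \<and> X \<subseteq> {- int N..int N} \<and> {- int N..int N} \<subseteq> UNIV"
      by eventually_elim (auto, fastforce+)
  qed
  ultimately have "(\<lambda>N. \<Sum>p\<in>{- int N..int N}. a p) \<longlonglongrightarrow> (\<Sum>\<^sub>\<infinity>p. a p)"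
    unfolding has_sum_def by (rule filterlim_compose)
  then have "H 0 = (\<Sum>\<^sub>\<infinity>p. a p)" using l1 LIMSEQ_unique by blast
  then show "(\<Sum>\<^sub>\<infinity>t::int. g (of_int t)) = (\<Sum>\<^sub>\<infinity>p. a p)" by (simp add: H_def)
qed


text \<open>
  The factor \<open>1 + (x + \<alpha>)\<^sup>2\<close> leaves room for the linear factor produced by differentiating the Gaussian.
\<close>

lemma gaussian_decay:
  fixes s \<alpha> :: real
  assumes s: "0 < s"
  obtains C where "\<And>x. (1 + (x + \<alpha>)\<^sup>2) * exp (- s / 2 * (x + \<alpha>)\<^sup>2) \<le> C / (1 + x\<^sup>2)" "0 \<le> C"
proof
  define C where "C = (2 + 2 * \<alpha>\<^sup>2) * (1 + 4 / s + 8 / s\<^sup>2)"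
  show "0 \<le> C" unfolding C_def using s by (intro mult_nonneg_nonneg add_nonneg_nonneg) auto
  show "(1 + (x + \<alpha>)\<^sup>2) * exp (- s / 2 * (x + \<alpha>)\<^sup>2) \<le> C / (1 + x\<^sup>2)" for x
  proof -
    define y where "y = (x + \<alpha>)\<^sup>2"
    define q where "q = s / 2 * y"
    have y0: "0 \<le> y" by (simp add: y_def)
    have q0: "0 \<le> q" using s y0 by (simp add: q_def)
    have e: "1 + q + q\<^sup>2 / 2 \<le> exp q" using q0 by (rule exp_lower_Taylor_quadratic)
    have qq: "0 \<le> q\<^sup>2" by simp
    have yq: "y = 2 / s * q" using s by (simp add: q_def)
    have "(1 + y)\<^sup>2 = 1 + 4 / s * q + 4 / s\<^sup>2 * q\<^sup>2"
      unfolding yq by (simp add: power2_eq_square algebra_simps)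
    also have "\<dots> \<le> 1 * exp q + 4 / s * exp q + 4 / s\<^sup>2 * (2 * exp q)"
    proof (intro add_mono mult_left_mono)
      show "1 \<le> 1 * exp q" using q0 by simp
      show "q \<le> exp q" using e q0 qq by linarith
      show "q\<^sup>2 \<le> 2 * exp q" using e q0 by linarith
    qed (use s in auto)
    also have "\<dots> = (1 + 4 / s + 8 / s\<^sup>2) * exp q" by (simp add: algebra_simps)
    finally have 1: "(1 + y)\<^sup>2 \<le> (1 + 4 / s + 8 / s\<^sup>2) * exp q" .
    have "x\<^sup>2 \<le> 2 * y + 2 * \<alpha>\<^sup>2"
      unfolding y_def using zero_le_power2[of "x + 2 * \<alpha>"] by (simp add: power2_eq_square algebra_simps)
    then have "1 + x\<^sup>2 \<le> (2 + 2 * \<alpha>\<^sup>2) * (1 + y)"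
    proof -
      assume "x\<^sup>2 \<le> 2 * y + 2 * \<alpha>\<^sup>2"
      moreover have "(2 + 2 * \<alpha>\<^sup>2) * (1 + y) = 2 + 2 * y + 2 * \<alpha>\<^sup>2 + 2 * (\<alpha>\<^sup>2 * y)"
        by (simp add: algebra_simps)
      moreover have "0 \<le> \<alpha>\<^sup>2 * y" using y0 by simp
      ultimately show ?thesis by linarith
    qed
    then have "(1 + y) * (1 + x\<^sup>2) \<le> (1 + y) * ((2 + 2 * \<alpha>\<^sup>2) * (1 + y))"
      using y0 by (intro mult_left_mono) auto
    also have "\<dots> = (2 + 2 * \<alpha>\<^sup>2) * (1 + y)\<^sup>2" by (simp add: power2_eq_square algebra_simps)
    also have "\<dots> \<le> (2 + 2 * \<alpha>\<^sup>2) * ((1 + 4 / s + 8 / s\<^sup>2) * exp q)"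
      using 1 by (intro mult_left_mono) auto
    also have "\<dots> = C * exp q" by (simp add: C_def)
    finally have "(1 + y) * (1 + x\<^sup>2) * exp (- q) \<le> C * exp q * exp (- q)"
      by (intro mult_right_mono) auto
    also have "\<dots> = C" by (simp add: exp_minus)
    finally have "((1 + y) * exp (- q)) * (1 + x\<^sup>2) \<le> C" by (simp add: mult_ac)
    moreover have "0 < 1 + x\<^sup>2" by (rule add_pos_nonneg) auto
    ultimately have "(1 + y) * exp (- q) \<le> C / (1 + x\<^sup>2)" by (simp add: pos_le_divide_eq)
    then show ?thesis by (simp add: q_def y_def)
  qed
qed

lemma gaussian_summable_int:
  fixes s \<alpha> :: real
  assumes s: "0 < s"
  shows "(\<lambda>t::int. exp (- s / 2 * (of_int t + \<alpha>)\<^sup>2)) summable_on UNIV"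
proof -
  obtain C where C: "\<And>x. (1 + (x + \<alpha>)\<^sup>2) * exp (- s / 2 * (x + \<alpha>)\<^sup>2) \<le> C / (1 + x\<^sup>2)"
    using gaussian_decay[OF s] by blast
  have "(\<lambda>t::int. C * (1 / (1 + (of_int t)\<^sup>2))) summable_on UNIV"
    by (intro summable_on_cmult_right summable_on_int_inverse_square)
  then show ?thesis
  proof (rule summable_on_comparison_test)
    fix t :: int
    have "exp (- s / 2 * (of_int t + \<alpha>)\<^sup>2) \<le> (1 + (of_int t + \<alpha>)\<^sup>2) * exp (- s / 2 * (of_int t + \<alpha>)\<^sup>2)"
      by (simp add: algebra_simps)
    also have "\<dots> \<le> C * (1 / (1 + (of_int t)\<^sup>2))" using C[of "of_int t"] by simp
    finally show "exp (- s / 2 * (of_int t + \<alpha>)\<^sup>2) \<le> C * (1 / (1 + (of_int t)\<^sup>2))" .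
  qed auto
qed

text \<open>
  A rescaling of the characteristic function of the standard normal distribution.
\<close>

lemma gaussian_fourier_transform:
  fixes s c :: real
  assumes s: "0 < s"
  shows "integrable lborel (\<lambda>x. exp (- s / 2 * x\<^sup>2) *\<^sub>R cis (c * x))" (is ?int)
    and "(\<integral>x. exp (- s / 2 * x\<^sup>2) *\<^sub>R cis (c * x) \<partial>lborel) = of_real (sqrt (2 * pi / s) * exp (- c\<^sup>2 / (2 * s)))" (is ?eq)
proof -
  define t where "t = c / sqrt s"
  define f where "f x = std_normal_density x *\<^sub>R cis (t * x)" for x
  have cm: "(\<lambda>x. cis (t * x)) \<in> borel_measurable borel"
    by (intro borel_measurable_continuous_onI continuous_intros)
  have fint: "integrable lborel f"
  proof (rule Bochner_Integration.integrable_bound[OF integrable_normal_density[of 1 0]])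
    show "f \<in> borel_measurable lborel" unfolding f_def using cm by measurable
  qed (auto simp: f_def normal_density_nonneg)
  have "(\<integral>x. f x \<partial>lborel) = char std_normal_distribution t"
    unfolding char_def f_def using cm
    by (subst integral_density) (auto simp: normal_density_nonneg cis_conv_exp mult_ac)
  then have fI: "(\<integral>x. f x \<partial>lborel) = of_real (exp (- t\<^sup>2 / 2))"
    by (simp add: char_std_normal_distribution)
  have fs: "f (0 + sqrt s * x) = (1 / sqrt (2 * pi)) *\<^sub>R (exp (- s / 2 * x\<^sup>2) *\<^sub>R cis (c * x))" for x
    using s by (simp add: f_def t_def std_normal_density_def power_mult_distrib)
  have ints: "integrable lborel (\<lambda>x. f (0 + sqrt s * x))"
    using s fint by (intro lborel_integrable_real_affine) auto
  then have "integrable lborel (\<lambda>x. sqrt (2 * pi) *\<^sub>R f (0 + sqrt s * x))" by (rule integrable_scaleR_right)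
  then show ?int unfolding fs by simp
  have "of_real (exp (- t\<^sup>2 / 2)) = sqrt s *\<^sub>R (\<integral>x. f (0 + sqrt s * x) \<partial>lborel)"
    unfolding fI[symmetric] using s by (subst lborel_integral_real_affine[where c = "sqrt s" and t = 0]) auto
  also have "\<dots> = (sqrt s / sqrt (2 * pi)) *\<^sub>R (\<integral>x. exp (- s / 2 * x\<^sup>2) *\<^sub>R cis (c * x) \<partial>lborel)"
    unfolding fs integral_scaleR_right by simp
  finally have "(sqrt (2 * pi) / sqrt s) *\<^sub>R of_real (exp (- t\<^sup>2 / 2)) = (\<integral>x. exp (- s / 2 * x\<^sup>2) *\<^sub>R cis (c * x) \<partial>lborel)"
    using s by simp
  then show ?eq
    using s by (simp add: t_def power_divide real_sqrt_divide scaleR_conv_of_real mult.commute)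
qed

text \<open>
  The phase \<open>\<kappa>\<close> is what summing out the other coordinates of a quadratic form leaves behind for the
  last one; on the dual side it displaces the Gaussian.
\<close>

theorem gaussian_poisson_summation:
  fixes s \<alpha> \<kappa> :: real
  assumes s: "0 < s"
  shows "(\<Sum>\<^sub>\<infinity>t::int. exp (- s / 2 * (of_int t + \<alpha>)\<^sup>2) *\<^sub>R cis (2 * pi * \<kappa> * (of_int t + \<alpha>))) =
    sqrt (2 * pi / s) *\<^sub>R (\<Sum>\<^sub>\<infinity>p::int. exp (- 2 * pi\<^sup>2 / s * (of_int p - \<kappa>)\<^sup>2) *\<^sub>R cis (2 * pi * of_int p * \<alpha>))"
proof -
  define E where "E x = exp (- s / 2 * (x + \<alpha>)\<^sup>2)" for x
  define g where "g x = E x *\<^sub>R cis (2 * pi * \<kappa> * (x + \<alpha>))" for x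
  define g' where "g' x = Complex (- s * (x + \<alpha>)) (2 * pi * \<kappa>) * g x" for x
  obtain C where C: "\<And>x. (1 + (x + \<alpha>)\<^sup>2) * E x \<le> C / (1 + x\<^sup>2)" and C0: "0 \<le> C"
    unfolding E_def using gaussian_decay[OF s] by blast
  define B where "B = 1 + s + 2 * pi * \<bar>\<kappa>\<bar>"
  have B1: "1 \<le> B" unfolding B_def using s by simp
  have E0: "0 \<le> E x" for x by (simp add: E_def)
  define a where "a p = (sqrt (2 * pi / s) * exp (- 2 * pi\<^sup>2 / s * (of_int p - \<kappa>)\<^sup>2)) *\<^sub>R cis (2 * pi * of_int p * \<alpha>)" for p :: int
  have bound: "B * ((1 + (x + \<alpha>)\<^sup>2) * E x) \<le> B * C / (1 + x\<^sup>2)" for x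
    using mult_left_mono[OF C, of B x] B1 by simp
  have ng: "norm (g x) = E x" for x by (simp add: g_def E0)
  have E1: "E x \<le> (1 + (x + \<alpha>)\<^sup>2) * E x" for x
    using E0[of x] by (simp add: algebra_simps)
  have E2: "(1 + (x + \<alpha>)\<^sup>2) * E x \<le> B * ((1 + (x + \<alpha>)\<^sup>2) * E x)" for x
    using mult_right_mono[OF B1, of "(1 + (x + \<alpha>)\<^sup>2) * E x"] E0[of x] by (simp add: add_nonneg_nonneg)
  have expand: "g x * cis (- 2 * pi * of_int p * x) =
      cis (2 * pi * of_int p * \<alpha>) * (exp (- s / 2 * (\<alpha> + 1 * x)\<^sup>2) *\<^sub>R cis ((2 * pi * (\<kappa> - of_int p)) * (\<alpha> + 1 * x)))" for x p
  proof -
    have "cis (2 * pi * \<kappa> * (x + \<alpha>)) * cis (- 2 * pi * of_int p * x) =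
      cis (2 * pi * of_int p * \<alpha>) * cis ((2 * pi * (\<kappa> - of_int p)) * (\<alpha> + 1 * x))"
      by (simp add: cis_mult) (simp add: algebra_simps)
    then show ?thesis by (simp add: g_def E_def add.commute)
  qed
  have int: "integrable lborel g"
  proof -
    have "integrable lborel (\<lambda>x. exp (- s / 2 * (\<alpha> + 1 * x)\<^sup>2) *\<^sub>R cis ((2 * pi * \<kappa>) * (\<alpha> + 1 * x)))"
      by (rule lborel_integrable_real_affine[OF gaussian_fourier_transform(1)[OF s]]) simp
    then show ?thesis by (simp add: g_def[abs_def] E_def add.commute)
  qed
  have coef: "(\<integral>x. g x * cis (- 2 * pi * of_int p * x) \<partial>lborel) = a p" for p
  proof -
    have "(\<integral>x. g x * cis (- 2 * pi * of_int p * x) \<partial>lborel) =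
      cis (2 * pi * of_int p * \<alpha>) * (\<integral>x. exp (- s / 2 * (\<alpha> + 1 * x)\<^sup>2) *\<^sub>R cis ((2 * pi * (\<kappa> - of_int p)) * (\<alpha> + 1 * x)) \<partial>lborel)"
      unfolding expand by (rule integral_mult_right_zero)
    also have "(\<integral>x. exp (- s / 2 * (\<alpha> + 1 * x)\<^sup>2) *\<^sub>R cis ((2 * pi * (\<kappa> - of_int p)) * (\<alpha> + 1 * x)) \<partial>lborel) =
       (\<integral>x. exp (- s / 2 * x\<^sup>2) *\<^sub>R cis ((2 * pi * (\<kappa> - of_int p)) * x) \<partial>lborel)"
      by (subst (2) lborel_integral_real_affine[where c = 1 and t = \<alpha>]) auto
    also have "\<dots> = of_real (sqrt (2 * pi / s) * exp (- (2 * pi * (\<kappa> - of_int p))\<^sup>2 / (2 * s)))"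
      by (rule gaussian_fourier_transform(2)[OF s])
    also have "- (2 * pi * (\<kappa> - of_int p))\<^sup>2 / (2 * s) = - 2 * pi\<^sup>2 / s * (of_int p - \<kappa>)\<^sup>2"
      using s by (simp add: power2_eq_square field_simps)
    finally show ?thesis by (simp add: a_def scaleR_conv_of_real mult_ac)
  qed
  have sa: "(\<lambda>p. norm (a p)) summable_on UNIV"
  proof -
    have "(\<lambda>p::int. sqrt (2 * pi / s) * exp (- (4 * pi\<^sup>2 / s) / 2 * (of_int p + - \<kappa>)\<^sup>2)) summable_on UNIV"
      using s by (intro summable_on_cmult_right gaussian_summable_int) auto
    then show ?thesis using s by (simp add: a_def)
  qed
  have "(\<Sum>\<^sub>\<infinity>t::int. g (of_int t)) = (\<Sum>\<^sub>\<infinity>p. a p)"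
  proof (rule poisson_summation[where g' = g' and C = "B * C", OF _ _ _ int coef sa])
    fix x :: real
    have "(E has_real_derivative - s * (x + \<alpha>) * E x) (at x)"
      unfolding E_def by (auto intro!: derivative_eq_intros)
    then have "(g has_vector_derivative (E x *\<^sub>R ((2 * pi * \<kappa>) *\<^sub>R (\<i> * cis (2 * pi * \<kappa> * (x + \<alpha>)))) + (- s * (x + \<alpha>) * E x) *\<^sub>R cis (2 * pi * \<kappa> * (x + \<alpha>)))) (at x)"
      unfolding g_def
      by (intro has_vector_derivative_scaleR) (auto intro!: derivative_eq_intros simp: has_vector_derivative_def)
    then show "(g has_vector_derivative g' x) (at x)"
      by (rule has_vector_derivative_eq_rhs) (simp add: g'_def g_def complex_eq_iff algebra_simps)
    show "norm (g x) \<le> B * C / (1 + x\<^sup>2)" unfolding ng using E1 E2 bound order_trans by metis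
    have "norm (Complex (- s * (x + \<alpha>)) (2 * pi * \<kappa>)) \<le> s * \<bar>x + \<alpha>\<bar> + 2 * pi * \<bar>\<kappa>\<bar>"
      using cmod_le[of "Complex (- s * (x + \<alpha>)) (2 * pi * \<kappa>)"] s by (simp add: abs_mult)
    also have "\<bar>x + \<alpha>\<bar> \<le> 1 + (x + \<alpha>)\<^sup>2"
    proof -
      have "2 * \<bar>x + \<alpha>\<bar> \<le> 1 + (x + \<alpha>)\<^sup>2"
        using zero_le_power2[of "\<bar>x + \<alpha>\<bar> - 1"] by (simp add: power2_diff)
      then show ?thesis by (rule order_trans[rotated]) simp
    qed
    finally have "norm (Complex (- s * (x + \<alpha>)) (2 * pi * \<kappa>)) \<le> s * (1 + (x + \<alpha>)\<^sup>2) + 2 * pi * \<bar>\<kappa>\<bar>" using s by simp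
    also have "\<dots> \<le> s * (1 + (x + \<alpha>)\<^sup>2) + 2 * pi * \<bar>\<kappa>\<bar> * (1 + (x + \<alpha>)\<^sup>2)"
      by (simp add: algebra_simps)
    also have "\<dots> \<le> B * (1 + (x + \<alpha>)\<^sup>2)" by (simp add: B_def algebra_simps)
    finally have "norm (g' x) \<le> B * (1 + (x + \<alpha>)\<^sup>2) * E x"
      unfolding g'_def norm_mult ng using E0 by (rule mult_right_mono)
    also have "\<dots> \<le> B * C / (1 + x\<^sup>2)" using bound by (simp add: mult.assoc)
    finally show "norm (g' x) \<le> B * C / (1 + x\<^sup>2)" .
  qed
  also have "\<dots> = sqrt (2 * pi / s) *\<^sub>R (\<Sum>\<^sub>\<infinity>p::int. exp (- 2 * pi\<^sup>2 / s * (of_int p - \<kappa>)\<^sup>2) *\<^sub>R cis (2 * pi * of_int p * \<alpha>))"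
    by (simp add: a_def infsum_scaleR_right flip: scaleR_scaleR)
  finally show ?thesis by (simp add: g_def E_def)
qed

section \<open>Quadratic forms and their Green functions\<close>

definition real_forms :: "'a set \<Rightarrow> ('a \<Rightarrow> real) set" where
  "real_forms A = {w. \<forall>x. x \<notin> A \<longrightarrow> w x = 0}"

definition int_forms :: "'a set \<Rightarrow> ('a \<Rightarrow> real) set" where
  "int_forms A = {w \<in> real_forms A. \<forall>x. w x \<in> \<int>}"

text \<open>
  Elements of a product measure space over \<open>A\<close> are \<open>undefined\<close> off \<open>A\<close>; this makes them forms.
\<close>

definition extend_zero :: "'a set \<Rightarrow> ('a \<Rightarrow> real) \<Rightarrow> 'a \<Rightarrow> real" where
  "extend_zero A w x = (if x \<in> A then w x else 0)"

definition delta :: "'a \<Rightarrow> 'a \<Rightarrow> real" where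
  "delta i x = (if x = i then 1 else 0)"

lemma real_forms_add: "f \<in> real_forms A \<Longrightarrow> g \<in> real_forms A \<Longrightarrow> (\<lambda>x. f x + g x) \<in> real_forms A"
  and real_forms_scale: "f \<in> real_forms A \<Longrightarrow> (\<lambda>x. c * f x) \<in> real_forms A"
  and real_forms_zero: "(\<lambda>x. 0) \<in> real_forms A"
  and real_forms_delta: "i \<in> A \<Longrightarrow> delta i \<in> real_forms A"
  and real_forms_mono: "A \<subseteq> A' \<Longrightarrow> f \<in> real_forms A \<Longrightarrow> f \<in> real_forms A'"
  and extend_zero_real_forms: "extend_zero A w \<in> real_forms A"
  and int_forms_real_forms: "f \<in> int_forms A \<Longrightarrow> f \<in> real_forms A"
  and int_forms_zero: "(\<lambda>x. 0) \<in> int_forms A"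
  by (auto simp: real_forms_def int_forms_def delta_def extend_zero_def)

lemma bij_betw_int_forms_insert:
  assumes "i \<notin> A"
  shows "bij_betw (\<lambda>(t::int, \<phi>) x. \<phi> x + of_int t * delta i x) (UNIV \<times> int_forms A) (int_forms (insert i A))"
proof (rule bij_betw_byWitness[where f' = "\<lambda>\<psi>. (\<lfloor>\<psi> i\<rfloor>, extend_zero A \<psi>)"])
  show "\<forall>a\<in>UNIV \<times> int_forms A. (\<lambda>\<psi>. (\<lfloor>\<psi> i\<rfloor>, extend_zero A \<psi>)) ((\<lambda>(t, \<phi>) x. \<phi> x + of_int t * delta i x) a) = a"
    using assms by (auto simp: int_forms_def real_forms_def extend_zero_def delta_def)
  show "\<forall>\<psi>\<in>int_forms (insert i A). (\<lambda>(t, \<phi>) x. \<phi> x + of_int t * delta i x) (\<lfloor>\<psi> i\<rfloor>, extend_zero A \<psi>) = \<psi>"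
  proof
    fix \<psi> :: "'a \<Rightarrow> real" assume p: "\<psi> \<in> int_forms (insert i A)"
    then have "of_int \<lfloor>\<psi> i\<rfloor> = \<psi> i" by (auto simp: int_forms_def elim!: Ints_cases)
    with p assms show "(\<lambda>(t, \<phi>) x. \<phi> x + of_int t * delta i x) (\<lfloor>\<psi> i\<rfloor>, extend_zero A \<psi>) = \<psi>"
      by (auto simp: int_forms_def real_forms_def extend_zero_def delta_def fun_eq_iff)
  qed
qed (use assms in \<open>auto simp: int_forms_def real_forms_def extend_zero_def delta_def\<close>)

lemma int_forms_empty: "int_forms {} = {\<lambda>x. 0}"
  by (auto simp: int_forms_def real_forms_def)

lemma form_inner_insert:
  "finite A \<Longrightarrow> i \<notin> A \<Longrightarrow> form_inner (insert i A) f g = f i * g i + form_inner A f g"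
  by (simp add: form_inner_def)

lemma form_inner_add_right: "form_inner A f (\<lambda>x. g x + h x) = form_inner A f g + form_inner A f h"
  and form_inner_scale_right: "form_inner A f (\<lambda>x. c * g x) = c * form_inner A f g"
  and form_inner_commute: "form_inner A f g = form_inner A g f"
  by (simp_all add: form_inner_def distrib_left sum.distrib sum_distrib_left mult_ac)

lemma form_inner_delta: "finite A \<Longrightarrow> form_inner A f (delta i) = (if i \<in> A then f i else 0)"
  by (simp add: form_inner_def delta_def if_distrib[of "\<lambda>x. _ * x"] sum.delta cong: if_cong)

lemma form_inner_cong: "(\<And>x. x \<in> A \<Longrightarrow> f x = f' x) \<Longrightarrow> (\<And>x. x \<in> A \<Longrightarrow> g x = g' x) \<Longrightarrow> form_inner A f g = form_inner A f' g'"
  by (simp add: form_inner_def)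

lemma infsum_complex_of_real:
  fixes f :: "'b \<Rightarrow> real"
  assumes "f summable_on A"
  shows "(\<Sum>\<^sub>\<infinity>x\<in>A. complex_of_real (f x)) = of_real (\<Sum>\<^sub>\<infinity>x\<in>A. f x)"
  using has_sum_of_real[OF has_sum_infsum[OF assms]] by (rule infsumI)

text \<open>
  In the dual series a shift is only a change of phase, so the triangle inequality compares it with the
  unshifted series, all of whose terms are positive.
\<close>

lemma shifted_theta_le:
  fixes s \<alpha> :: real
  assumes s: "0 < s"
  shows "(\<Sum>\<^sub>\<infinity>t::int. exp (- s / 2 * (of_int t + \<alpha>)\<^sup>2)) \<le> (\<Sum>\<^sub>\<infinity>t::int. exp (- s / 2 * (of_int t)\<^sup>2))"
proof -
  define w where "w p = exp (- 2 * pi\<^sup>2 / s * (real_of_int p)\<^sup>2)" for p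
  have P: "of_real (\<Sum>\<^sub>\<infinity>t::int. exp (- s / 2 * (of_int t + \<alpha>)\<^sup>2)) =
      sqrt (2 * pi / s) *\<^sub>R (\<Sum>\<^sub>\<infinity>p::int. w p *\<^sub>R cis (2 * pi * of_int p * \<alpha>))" for \<alpha>
    using gaussian_poisson_summation[OF s, where \<kappa> = 0 and \<alpha> = \<alpha>] infsum_complex_of_real[OF gaussian_summable_int[OF s, of \<alpha>]]
    by (simp add: w_def scaleR_conv_of_real)
  have w0: "0 \<le> w p" for p by (simp add: w_def)
  have sw: "w summable_on UNIV"
    using gaussian_summable_int[of "4 * pi\<^sup>2 / s" 0] s by (simp add: w_def[abs_def])
  have "(\<Sum>\<^sub>\<infinity>t::int. exp (- s / 2 * (of_int t + \<alpha>)\<^sup>2)) = norm (of_real (\<Sum>\<^sub>\<infinity>t::int. exp (- s / 2 * (of_int t + \<alpha>)\<^sup>2)) :: complex)"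
    by (simp add: infsum_nonneg)
  also have "\<dots> = sqrt (2 * pi / s) * norm (\<Sum>\<^sub>\<infinity>p::int. w p *\<^sub>R cis (2 * pi * of_int p * \<alpha>))"
    using s unfolding P by simp
  also have "\<dots> \<le> sqrt (2 * pi / s) * (\<Sum>\<^sub>\<infinity>p::int. norm (w p *\<^sub>R cis (2 * pi * of_int p * \<alpha>)))"
    using s sw by (intro mult_left_mono norm_infsum_bound) (auto simp: w_def[symmetric] abs_of_nonneg w0)
  also have "\<dots> = sqrt (2 * pi / s) * (\<Sum>\<^sub>\<infinity>p. w p)" by (simp add: abs_of_nonneg w0)
  also have "complex_of_real \<dots> = of_real (\<Sum>\<^sub>\<infinity>t::int. exp (- s / 2 * (of_int t)\<^sup>2))"
    using P[of 0] infsum_complex_of_real[OF sw] by (simp add: scaleR_conv_of_real)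
  then have "sqrt (2 * pi / s) * (\<Sum>\<^sub>\<infinity>p. w p) = (\<Sum>\<^sub>\<infinity>t::int. exp (- s / 2 * (of_int t)\<^sup>2))"
    by (simp only: of_real_eq_iff)
  finally show ?thesis .
qed

lemma nn_integral_gaussian:
  fixes s a :: real
  assumes s: "0 < s"
  shows "(\<integral>\<^sup>+y. ennreal (exp (- s / 2 * (y + a)\<^sup>2)) \<partial>lborel) = ennreal (sqrt (2 * pi / s))"
proof -
  have i: "integrable lborel (\<lambda>x. exp (- s / 2 * x\<^sup>2))"
    using integrable_Re[OF gaussian_fourier_transform(1)[OF s, of 0]] by simp
  have "(\<integral>x. exp (- s / 2 * x\<^sup>2) \<partial>lborel) = sqrt (2 * pi / s)"
    using arg_cong[OF gaussian_fourier_transform(2)[OF s, of 0], of Re]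
      integral_Re[OF gaussian_fourier_transform(1)[OF s, of 0]] by simp
  then have "(\<integral>\<^sup>+y. ennreal (exp (- s / 2 * y\<^sup>2)) \<partial>lborel) = ennreal (sqrt (2 * pi / s))"
    using nn_integral_eq_integral[OF i] by simp
  then show ?thesis
    by (subst (asm) nn_integral_real_affine[where c = 1 and t = a]) (auto simp: add.commute)
qed

text \<open>
  A symmetric bilinear form on all functions, which is restricted to the functions supported in various
  finite sets \<open>A\<close>.  Working with the restrictions of one form, rather than with matrices, makes the
  induction on \<open>A\<close> immediate.  The instances are the gradient energy of a graph, the standard
  form on its edges, and the Coulomb energy.
\<close>

locale quadratic_form =
  fixes B :: "('a \<Rightarrow> real) \<Rightarrow> ('a \<Rightarrow> real) \<Rightarrow> real"
  assumes sym: "B f g = B g f"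
    and add_left: "B (\<lambda>x. f x + g x) h = B f h + B g h"
    and scale_left: "B (\<lambda>x. c * f x) h = c * B f h"
begin

abbreviation energy :: "('a \<Rightarrow> real) \<Rightarrow> real" where
  "energy f \<equiv> B f f"

lemma add_right: "B h (\<lambda>x. f x + g x) = B h f + B h g"
  by (subst (1 2 3) sym) (rule add_left)

lemma scale_right: "B h (\<lambda>x. c * f x) = c * B h f"
  by (subst (1 2) sym) (rule scale_left)

lemma zero_left: "B (\<lambda>x. 0) h = 0"
  using scale_left[of 0 "\<lambda>x. 0" h] by simp

lemma zero_right: "B h (\<lambda>x. 0) = 0"
  by (subst sym) (rule zero_left)

lemma expand_delta:
  assumes "finite A" "f \<in> real_forms A"
  shows "B h f = (\<Sum>x\<in>A. f x * B h (delta x))"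
  using assms
proof (induction A arbitrary: f)
  case empty
  then have "f = (\<lambda>x. 0)" by (auto simp: real_forms_def)
  then show ?case by (simp add: zero_right)
next
  case (insert i A)
  have "f = (\<lambda>x. extend_zero A f x + f i * delta i x)"
    using insert by (auto simp: real_forms_def extend_zero_def delta_def fun_eq_iff)
  then have "B h f = B h (extend_zero A f) + f i * B h (delta i)"
    by (metis (no_types) add_right scale_right)
  also have "B h (extend_zero A f) = (\<Sum>x\<in>A. f x * B h (delta x))"
    unfolding insert.IH[OF extend_zero_real_forms] by (intro sum.cong) (auto simp: extend_zero_def)
  finally show ?case using insert by simp
qed

definition pos_def :: "'a set \<Rightarrow> bool" where
  "pos_def A \<longleftrightarrow> (\<forall>f\<in>real_forms A. f \<noteq> (\<lambda>x. 0) \<longrightarrow> 0 < B f f)"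

lemma pos_def_subset: "pos_def A \<Longrightarrow> A' \<subseteq> A \<Longrightarrow> pos_def A'"
  unfolding pos_def_def by (meson real_forms_mono)

text \<open>
  The weak form of the Poisson equation with source \<open>q\<close> in \<open>A\<close> and zero boundary values outside.
\<close>

definition is_green :: "'a set \<Rightarrow> ('a \<Rightarrow> real) \<Rightarrow> ('a \<Rightarrow> real) \<Rightarrow> bool" where
  "is_green A q u \<longleftrightarrow> u \<in> real_forms A \<and> (\<forall>\<phi>\<in>real_forms A. B u \<phi> = form_inner A q \<phi>)"

definition green :: "'a set \<Rightarrow> ('a \<Rightarrow> real) \<Rightarrow> 'a \<Rightarrow> real" where
  "green A q = (THE u. is_green A q u)"

lemma is_green_unique:
  assumes "pos_def A" "is_green A q u" "is_green A q v"
  shows "u = v"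
proof -
  define w where "w x = u x + (- 1) * v x" for x
  have w: "w \<in> real_forms A"
    unfolding w_def using assms by (intro real_forms_add real_forms_scale) (auto simp: is_green_def)
  have "B w \<phi> = B u \<phi> - B v \<phi>" for \<phi>
    unfolding w_def add_left scale_left by simp
  then have "B w w = 0"
    using assms w by (simp add: is_green_def)
  then have "w = (\<lambda>x. 0)" using assms(1) w unfolding pos_def_def by (metis less_irrefl)
  then show ?thesis by (auto simp: w_def fun_eq_iff)
qed

text \<open>
  Completing the square in the coordinate \<open>i\<close>.  The function \<open>k\<close> is the response in \<open>A\<close> to a unit
  height at \<open>i\<close>, up to sign, so \<open>e = delta i - k\<close> is \<open>B\<close>-orthogonal to everything supported in \<open>A\<close>.
  Both the form on \<open>insert i A\<close> and its Green function then split into the ones for \<open>A\<close> and a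
  one-dimensional part governed by \<open>B e e\<close>.
\<close>

lemma schur_complement:
  assumes A: "finite A" "i \<notin> A" and pd: "pos_def (insert i A)"
    and k: "is_green A (\<lambda>x. B (delta i) (delta x)) k"
  defines "e \<equiv> \<lambda>x. delta i x + (- 1) * k x"
  shows "0 < B e e"
    and "\<phi> \<in> real_forms A \<Longrightarrow> B e \<phi> = 0"
    and "\<phi> \<in> real_forms A \<Longrightarrow> energy (\<lambda>x. \<phi> x + t * delta i x) =
       energy (\<lambda>x. \<phi> x + t * k x) + B e e * t\<^sup>2"
    and "is_green A q u \<Longrightarrow> is_green (insert i A) q (\<lambda>x. u x + (q i - form_inner A q k) / B e e * e x)"
    and "is_green A q u \<Longrightarrow> form_inner (insert i A) q (\<lambda>x. u x + (q i - form_inner A q k) / B e e * e x) =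
       form_inner A q u + (q i - form_inner A q k)\<^sup>2 / B e e"
proof -
  have kA: "k \<in> real_forms A" using k by (simp add: is_green_def)
  have ki: "k i = 0" using kA A by (simp add: real_forms_def)
  have ei: "e i = 1" by (simp add: e_def ki delta_def)
  have eA: "e \<in> real_forms (insert i A)"
    unfolding e_def using kA by (intro real_forms_add real_forms_scale real_forms_delta) (auto intro: real_forms_mono)
  have "e \<noteq> (\<lambda>x. 0)" using ei by force
  then show s: "0 < B e e" using pd eA by (simp add: pos_def_def)
  show orth: "B e \<phi> = 0" if "\<phi> \<in> real_forms A" for \<phi>
  proof -
    have "B k \<phi> = B (delta i) \<phi>"
      using k that A expand_delta[OF A(1) that, of "delta i"] by (simp add: is_green_def form_inner_def mult.commute)
    then show ?thesis unfolding e_def add_left scale_left by simp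
  qed
  have dec: "(\<lambda>x. \<phi> x + t * delta i x) = (\<lambda>x. (\<phi> x + t * k x) + t * e x)" for \<phi> :: "'a \<Rightarrow> real" and t
    by (simp add: e_def fun_eq_iff algebra_simps)
  have pk: "(\<lambda>x. \<phi> x + t * k x) \<in> real_forms A" if "\<phi> \<in> real_forms A" for \<phi> t
    using that kA by (intro real_forms_add real_forms_scale)
  show "energy (\<lambda>x. \<phi> x + t * delta i x) =
       energy (\<lambda>x. \<phi> x + t * k x) + B e e * t\<^sup>2" if "\<phi> \<in> real_forms A" for \<phi> t
  proof -
    define p where "p x = \<phi> x + t * k x" for x
    have "p \<in> real_forms A" using pk[OF that] by (simp add: p_def[abs_def])
    then have o: "B e p = 0" "B p e = 0" using orth sym by metis+
    have "(\<lambda>x. \<phi> x + t * delta i x) = (\<lambda>x. p x + t * e x)" unfolding p_def by (rule dec)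
    then show ?thesis
      by (simp add: add_left add_right scale_left scale_right o p_def[symmetric, abs_def] power2_eq_square)
  qed
  assume u: "is_green A q u"
  define c where "c = (q i - form_inner A q k) / B e e"
  have uA: "u \<in> real_forms A" using u by (simp add: is_green_def)
  have "is_green (insert i A) q (\<lambda>x. u x + c * e x)"
    unfolding is_green_def
  proof (intro conjI ballI)
    show "(\<lambda>x. u x + c * e x) \<in> real_forms (insert i A)"
      using uA eA by (intro real_forms_add real_forms_scale) (auto intro: real_forms_mono)
    fix \<psi> assume psi: "\<psi> \<in> real_forms (insert i A)"
    define \<phi> where "\<phi> = extend_zero A \<psi>"
    define t where "t = \<psi> i"
    have ph: "\<phi> \<in> real_forms A" by (simp add: \<phi>_def extend_zero_real_forms)
    have psi_eq: "\<psi> = (\<lambda>x. \<phi> x + t * delta i x)"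
      using psi A by (auto simp: \<phi>_def t_def real_forms_def extend_zero_def delta_def fun_eq_iff)
    define p where "p x = \<phi> x + t * k x" for x
    have pA: "p \<in> real_forms A" using pk[OF ph] by (simp add: p_def[abs_def])
    have psi2: "\<psi> = (\<lambda>x. p x + t * e x)" unfolding psi_eq p_def by (rule dec)
    have "B (\<lambda>x. u x + c * e x) \<psi> = B u p + t * B u e + c * (B e p + t * B e e)"
      unfolding psi2 by (simp add: add_left add_right scale_left scale_right distrib_left)
    also have "\<dots> = form_inner A q p + c * t * B e e"
      using u pA orth[OF pA] orth[OF uA] sym[of u e] by (simp add: is_green_def)
    also have "\<dots> = form_inner A q \<phi> + t * form_inner A q k + t * (q i - form_inner A q k)"
      using s by (simp add: p_def[abs_def] form_inner_add_right form_inner_scale_right c_def)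
    also have "\<dots> = form_inner A q \<phi> + t * q i" by (simp add: algebra_simps)
    also have "form_inner A q \<phi> = form_inner A q \<psi>"
      by (rule form_inner_cong) (auto simp: \<phi>_def extend_zero_def)
    finally show "B (\<lambda>x. u x + c * e x) \<psi> = form_inner (insert i A) q \<psi>"
      using A by (simp add: form_inner_insert t_def)
  qed
  then show "is_green (insert i A) q (\<lambda>x. u x + (q i - form_inner A q k) / B e e * e x)"
    by (simp add: c_def)
  have "form_inner A q e = - form_inner A q k"
  proof -
    have "form_inner A q e = form_inner A q (\<lambda>x. (- 1) * k x)"
      using A by (intro form_inner_cong) (auto simp: e_def delta_def)
    then show ?thesis unfolding form_inner_scale_right by simp
  qed
  then have "form_inner (insert i A) q (\<lambda>x. u x + c * e x) = q i * c + (form_inner A q u - c * form_inner A q k)"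
    using A uA by (simp add: form_inner_insert form_inner_add_right form_inner_scale_right ei real_forms_def algebra_simps)
  also have "\<dots> = form_inner A q u + c * (q i - form_inner A q k)" by (simp add: algebra_simps)
  also have "c * (q i - form_inner A q k) = (q i - form_inner A q k)\<^sup>2 / B e e"
    by (simp add: c_def power2_eq_square)
  finally show "form_inner (insert i A) q (\<lambda>x. u x + (q i - form_inner A q k) / B e e * e x) =
       form_inner A q u + (q i - form_inner A q k)\<^sup>2 / B e e"
    by (simp add: c_def)
qed

lemma ex_is_green:
  assumes "finite A" "pos_def A"
  shows "\<exists>u. is_green A q u"
  using assms
proof (induction A arbitrary: q)
  case empty
  have "is_green {} q (\<lambda>x. 0)"
    by (auto simp: is_green_def real_forms_def form_inner_def zero_left)
  then show ?case by blast
next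
  case (insert i A)
  have pd: "pos_def A" using insert.prems by (rule pos_def_subset) auto
  obtain k where k: "is_green A (\<lambda>x. B (delta i) (delta x)) k" using insert.IH[OF pd] by blast
  obtain u where u: "is_green A q u" using insert.IH[OF pd] by blast
  show ?case using schur_complement(4)[OF insert.hyps insert.prems k u] by blast
qed

lemma green:
  assumes "finite A" "pos_def A"
  shows "is_green A q (green A q)"
  unfolding green_def using ex_is_green[OF assms] is_green_unique[OF assms(2)] by (metis theI)

lemma green_eqI:
  assumes "pos_def A" "is_green A q u"
  shows "green A q = u"
  unfolding green_def using assms is_green_unique[OF assms(1)] by blast

end

section \<open>Poisson summation for quadratic forms\<close>

context quadratic_form
begin

text \<open>
  The dual of the quadratic form \<open>B\<close> restricted to \<open>A\<close>: in matrix notation, \<open>q\<close> times the inverse of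
  \<open>B\<close> times \<open>q\<close>.
\<close>

definition coulomb :: "'a set \<Rightarrow> ('a \<Rightarrow> real) \<Rightarrow> real" where
  "coulomb A q = form_inner A q (green A q)"

text \<open>
  \<open>C\<close> is the Gaussian integral of the form, which ignores shifts.  Its scaling in \<open>\<gamma>\<close> is recorded
  because the Gaussian free field is reached later as the limit of small \<open>\<gamma>\<close>.
\<close>

definition gaussian_data :: "'a set \<Rightarrow> real \<Rightarrow> bool" where
  "gaussian_data A C \<longleftrightarrow> 0 < C \<and> (\<forall>\<gamma>>0. \<forall>a\<in>real_forms A.
     (\<integral>\<^sup>+\<phi>. ennreal (exp (- \<gamma> / 2 * energy (\<lambda>x. extend_zero A \<phi> x + a x)))
        \<partial>(\<Pi>\<^sub>M x\<in>A. lborel)) = ennreal (C / sqrt \<gamma> ^ card A))"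

text \<open>
  Poisson summation on \<open>A\<close> with constant \<open>K\<close>.  The shift \<open>a\<close> ranges over real forms, since the
  induction on \<open>A\<close> produces real shifts.
\<close>

definition poisson_data :: "real \<Rightarrow> 'a set \<Rightarrow> real \<Rightarrow> bool" where
  "poisson_data \<gamma> A K \<longleftrightarrow> 0 < K \<and>
     (\<lambda>q. exp (- 2 * pi\<^sup>2 / \<gamma> * coulomb A q)) summable_on int_forms A \<and>
     (\<forall>a\<in>real_forms A.
       (\<lambda>\<psi>. exp (- \<gamma> / 2 * energy (\<lambda>x. \<psi> x + a x))) summable_on int_forms A \<and>
       of_real (\<Sum>\<^sub>\<infinity>\<psi>\<in>int_forms A. exp (- \<gamma> / 2 * energy (\<lambda>x. \<psi> x + a x))) =
       K *\<^sub>R (\<Sum>\<^sub>\<infinity>q\<in>int_forms A. exp (- 2 * pi\<^sup>2 / \<gamma> * coulomb A q) *\<^sub>R cis (2 * pi * form_inner A q a)))"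

lemma measurable_form:
  assumes "finite A"
  shows "(\<lambda>\<phi>. energy (\<lambda>x. extend_zero A \<phi> x + a x)) \<in> borel_measurable (\<Pi>\<^sub>M x\<in>A. lborel)"
proof -
  have "energy (\<lambda>x. extend_zero A \<phi> x + a x) =
     (\<Sum>x\<in>A. \<phi> x * (\<Sum>y\<in>A. \<phi> y * B (delta x) (delta y))) + 2 * (\<Sum>x\<in>A. \<phi> x * B a (delta x)) + B a a" for \<phi>
  proof -
    define e where "e = extend_zero A \<phi>"
    have e: "B h e = (\<Sum>x\<in>A. \<phi> x * B h (delta x))" for h
      unfolding e_def expand_delta[OF assms extend_zero_real_forms] by (simp add: extend_zero_def)
    have "energy (\<lambda>x. e x + a x) = B e e + 2 * B a e + B a a"
      using sym[of e a] by (simp add: add_left add_right)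
    also have "B e e = (\<Sum>x\<in>A. \<phi> x * B (delta x) e)"
      by (subst e) (simp add: sym)
    finally show ?thesis unfolding e unfolding e_def .
  qed
  then show ?thesis by simp
qed

lemma gaussian_data_empty: "gaussian_data {} 1"
proof -
  have e: "extend_zero {} \<phi> = (\<lambda>x. 0)" for \<phi> :: "'a \<Rightarrow> real"
    by (auto simp: extend_zero_def)
  have "energy (\<lambda>x. extend_zero {} \<phi> x + a x) = 0" if "a \<in> real_forms {}" for a \<phi>
  proof -
    have "a = (\<lambda>x. 0)" using that by (auto simp: real_forms_def)
    then show ?thesis by (simp add: e zero_left)
  qed
  then show ?thesis
    by (simp add: gaussian_data_def PiM_empty nn_integral_count_space_finite)
qed

lemma split_shifted:
  assumes "i \<notin> A" "a \<in> real_forms (insert i A)"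
  shows "(\<lambda>x. (\<phi> x + t * delta i x) + a x) = (\<lambda>x. (\<phi> x + extend_zero A a x) + (t + a i) * delta i x)"
  using assms by (auto simp: fun_eq_iff real_forms_def extend_zero_def delta_def)

text \<open>
  The new coordinate \<open>i\<close> multiplies the Gaussian integral and the constant in the summation formula by
  the same one-dimensional Gaussian integral, which is why both constants can later be taken to be equal.
\<close>

lemma gaussian_poisson_data_insert:
  assumes A: "finite A" "i \<notin> A" and pd: "pos_def (insert i A)" and C: "gaussian_data A C"
  shows "\<exists>s. 0 < s \<and> gaussian_data (insert i A) (C * sqrt (2 * pi / s)) \<and>
     (\<forall>\<gamma> K. 0 < \<gamma> \<longrightarrow> poisson_data \<gamma> A K \<longrightarrow> poisson_data \<gamma> (insert i A) (K * sqrt (2 * pi / (\<gamma> * s))))"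
proof -
  have pdA: "pos_def A" using pd by (rule pos_def_subset) auto
  define k where "k = green A (\<lambda>x. B (delta i) (delta x))"
  define e where "e x = delta i x + (- 1) * k x" for x
  define s where "s = B e e"
  have k: "is_green A (\<lambda>x. B (delta i) (delta x)) k"
    unfolding k_def by (rule green[OF A(1) pdA])
  have kA: "k \<in> real_forms A" using k by (simp add: is_green_def)
  note sc = schur_complement[OF A pd k, folded e_def[abs_def], folded s_def]
  have s: "0 < s" by (rule sc(1))
  have C0: "0 < C" using C by (simp add: gaussian_data_def)
  have shift: "energy (\<lambda>x. (\<phi> x + t * delta i x) + a x) =
      energy (\<lambda>x. \<phi> x + (extend_zero A a x + (t + a i) * k x)) + s * (t + a i)\<^sup>2"
    if "\<phi> \<in> real_forms A" "a \<in> real_forms (insert i A)" for \<phi> t a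
    unfolding split_shifted[OF A(2) that(2)]
    using sc(3)[of "\<lambda>x. \<phi> x + extend_zero A a x" "t + a i"] that
    by (simp add: real_forms_add extend_zero_real_forms add.assoc)
  have bA: "(\<lambda>x. extend_zero A a x + t * k x) \<in> real_forms A" for a t
    using kA by (intro real_forms_add real_forms_scale extend_zero_real_forms)
  \<comment> \<open>For a fixed value \<open>y\<close> at \<open>i\<close> the integral over \<open>A\<close> only sees a shift.\<close>
  interpret L: product_sigma_finite "\<lambda>_::'a. lborel :: real measure" by standard
  have gd: "gaussian_data (insert i A) (C * sqrt (2 * pi / s))"
    unfolding gaussian_data_def
  proof (intro conjI allI impI ballI)
    show "0 < C * sqrt (2 * pi / s)" using s C0 by simp
    fix \<gamma> :: real and a :: "'a \<Rightarrow> real" assume g: "0 < \<gamma>" and a: "a \<in> real_forms (insert i A)"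
    define f where "f \<phi> = ennreal (exp (- \<gamma> / 2 * energy (\<lambda>x. extend_zero (insert i A) \<phi> x + a x)))" for \<phi>
    have fm: "f \<in> borel_measurable (\<Pi>\<^sub>M x\<in>insert i A. lborel)"
      unfolding f_def using measurable_form[OF finite.insertI[OF A(1)], where a = a] by measurable
    have ext: "extend_zero (insert i A) (\<phi>(i := y)) = (\<lambda>x. extend_zero A \<phi> x + y * delta i x)" for \<phi> y
      using A by (auto simp: extend_zero_def delta_def fun_eq_iff)
    have f_upd: "f (\<phi>(i := y)) = ennreal (exp (- \<gamma> / 2 * energy (\<lambda>x. extend_zero A \<phi> x + (extend_zero A a x + (y + a i) * k x))))
        * ennreal (exp (- (\<gamma> * s) / 2 * (y + a i)\<^sup>2))" for \<phi> y
      unfolding f_def ext shift[OF extend_zero_real_forms a]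
      by (simp add: algebra_simps flip: ennreal_mult exp_add)
    have "(\<integral>\<^sup>+\<phi>. f \<phi> \<partial>(\<Pi>\<^sub>M x\<in>insert i A. lborel)) = (\<integral>\<^sup>+y. (\<integral>\<^sup>+\<phi>. f (\<phi>(i := y)) \<partial>(\<Pi>\<^sub>M x\<in>A. lborel)) \<partial>lborel)"
      using A fm by (rule L.product_nn_integral_insert_rev)
    also have "\<dots> = (\<integral>\<^sup>+y. ennreal (C / sqrt \<gamma> ^ card A) * ennreal (exp (- (\<gamma> * s) / 2 * (y + a i)\<^sup>2)) \<partial>lborel)"
    proof (rule nn_integral_cong)
      fix y
      have m: "(\<lambda>\<phi>. ennreal (exp (- \<gamma> / 2 * energy (\<lambda>x. extend_zero A \<phi> x + (extend_zero A a x + (y + a i) * k x)))))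
         \<in> borel_measurable (\<Pi>\<^sub>M x\<in>A. lborel)"
        using measurable_form[OF A(1), of "\<lambda>x. extend_zero A a x + (y + a i) * k x"] by measurable
      show "(\<integral>\<^sup>+\<phi>. f (\<phi>(i := y)) \<partial>(\<Pi>\<^sub>M x\<in>A. lborel)) = ennreal (C / sqrt \<gamma> ^ card A) * ennreal (exp (- (\<gamma> * s) / 2 * (y + a i)\<^sup>2))"
        unfolding f_upd using C g bA[of a "y + a i"] m by (simp add: nn_integral_multc gaussian_data_def)
    qed
    also have "\<dots> = ennreal (C / sqrt \<gamma> ^ card A) * ennreal (sqrt (2 * pi / (\<gamma> * s)))"
      using nn_integral_gaussian[of "\<gamma> * s" "a i"] g s by (subst nn_integral_cmult) auto
    also have "\<dots> = ennreal (C * sqrt (2 * pi / s) / sqrt \<gamma> ^ card (insert i A))"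
      using A g s C0 by (simp add: real_sqrt_divide real_sqrt_mult field_simps flip: ennreal_mult)
    finally show "(\<integral>\<^sup>+\<phi>. ennreal (exp (- \<gamma> / 2 * energy (\<lambda>x. extend_zero (insert i A) \<phi> x + a x)))
        \<partial>(\<Pi>\<^sub>M x\<in>insert i A. lborel)) = ennreal (C * sqrt (2 * pi / s) / sqrt \<gamma> ^ card (insert i A))"
      by (simp add: f_def)
  qed
  have "poisson_data \<gamma> (insert i A) (K * sqrt (2 * pi / (\<gamma> * s)))" if g: "0 < \<gamma>" and P: "poisson_data \<gamma> A K" for \<gamma> K
  proof -
    define \<mu> where "\<mu> = \<gamma> * s"
    have mu: "0 < \<mu>" using g s by (simp add: \<mu>_def)
    define w where "w q = exp (- 2 * pi\<^sup>2 / \<gamma> * coulomb A q)" for q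
    define \<kappa> where "\<kappa> q = form_inner A q k" for q
    define F where "F b = (\<Sum>\<^sub>\<infinity>\<psi>\<in>int_forms A. exp (- \<gamma> / 2 * energy (\<lambda>x. \<psi> x + b x)))" for b
    have K: "0 < K" using P by (simp add: poisson_data_def)
    have w0: "0 < w q" for q by (simp add: w_def)
    have sw: "w summable_on int_forms A" using P by (simp add: poisson_data_def w_def[abs_def])
    have sF: "(\<lambda>\<psi>. exp (- \<gamma> / 2 * energy (\<lambda>x. \<psi> x + b x))) summable_on int_forms A" if "b \<in> real_forms A" for b
      using P that by (simp add: poisson_data_def)
    have F: "of_real (F b) = K *\<^sub>R (\<Sum>\<^sub>\<infinity>q\<in>int_forms A. w q *\<^sub>R cis (2 * pi * form_inner A q b))" if "b \<in> real_forms A" for b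
      using P that by (simp add: poisson_data_def F_def w_def)
    have F0: "0 \<le> F b" for b by (simp add: F_def infsum_nonneg)
    have Fle: "F b \<le> K * (\<Sum>\<^sub>\<infinity>q\<in>int_forms A. w q)" if "b \<in> real_forms A" for b
    proof -
      have "F b = norm (of_real (F b) :: complex)" using F0[of b] by simp
      also have "\<dots> = K * norm (\<Sum>\<^sub>\<infinity>q\<in>int_forms A. w q *\<^sub>R cis (2 * pi * form_inner A q b))"
        using K unfolding F[OF that] by simp
      also have "\<dots> \<le> K * (\<Sum>\<^sub>\<infinity>q\<in>int_forms A. norm (w q *\<^sub>R cis (2 * pi * form_inner A q b)))"
        using K sw w0 by (intro mult_left_mono norm_infsum_bound) (auto simp: abs_of_pos)
      finally show ?thesis using w0 by (simp add: abs_of_pos)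
    qed
    \<comment> \<open>The value at \<open>i\<close> of the dual variable is displaced by \<open>\<kappa> q\<close>.\<close>
    have coul: "coulomb (insert i A) (\<lambda>x. q x + of_int p * delta i x) = coulomb A q + (of_int p - \<kappa> q)\<^sup>2 / s"
      if q: "q \<in> int_forms A" for q and p :: int
    proof -
      define q' where "q' x = q x + of_int p * delta i x" for x
      have qq: "form_inner A q' f = form_inner A q f" for f
        using A by (intro form_inner_cong) (auto simp: q'_def delta_def)
      have "q' i = of_int p" using q A by (simp add: q'_def delta_def int_forms_def real_forms_def)
      moreover have ig: "is_green A q' (green A q)"
        using green[OF A(1) pdA, of q] by (simp add: is_green_def qq)
      ultimately show ?thesis
        using sc(5)[OF ig] green_eqI[OF pd sc(4)[OF ig]]
        by (simp add: coulomb_def qq \<kappa>_def q'_def[symmetric, abs_def])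
    qed
    let ?g = "\<lambda>q p. exp (- 2 * pi\<^sup>2 / \<mu> * (of_int p - \<kappa> q)\<^sup>2)"
    have w': "exp (- 2 * pi\<^sup>2 / \<gamma> * coulomb (insert i A) (\<lambda>x. q x + of_int p * delta i x)) =
        w q * ?g q p" if "q \<in> int_forms A" for q p
      unfolding coul[OF that] w_def \<mu>_def using g s by (simp add: exp_add[symmetric] field_simps)
    have bij: "bij_betw (\<lambda>(t::int, \<phi>) x. \<phi> x + of_int t * delta i x) (UNIV \<times> int_forms A) (int_forms (insert i A))"
      by (rule bij_betw_int_forms_insert[OF A(2)])
    have s4: "0 < 4 * pi\<^sup>2 / \<mu>" using mu by simp
    have gs: "(\<lambda>p::int. exp (- 2 * pi\<^sup>2 / \<mu> * (of_int p - c)\<^sup>2)) summable_on UNIV" for c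
      using gaussian_summable_int[OF s4, of "- c"] by simp
    have gle: "(\<Sum>\<^sub>\<infinity>p::int. exp (- 2 * pi\<^sup>2 / \<mu> * (of_int p - c)\<^sup>2)) \<le> (\<Sum>\<^sub>\<infinity>p::int. exp (- 2 * pi\<^sup>2 / \<mu> * (of_int p)\<^sup>2))" for c
      using shifted_theta_le[OF s4, of "- c"] by simp
    have sqp: "(\<lambda>(q, p::int). w q * ?g q p) summable_on (int_forms A \<times> UNIV)"
    proof (rule summable_on_SigmaI)
      show "((\<lambda>p::int. case (q, p) of (q, p) \<Rightarrow> w q * ?g q p) has_sum
         w q * (\<Sum>\<^sub>\<infinity>p::int. ?g q p)) UNIV" for q
        using has_sum_cmult_right[OF has_sum_infsum[OF gs]] by simp
      show "(\<lambda>q. w q * (\<Sum>\<^sub>\<infinity>p::int. ?g q p)) summable_on int_forms A"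
        by (rule summable_on_comparison_test[OF summable_on_cmult_left[OF sw]])
           (use w0 gle in \<open>auto intro!: mult_left_mono mult_nonneg_nonneg infsum_nonneg intro: less_imp_le\<close>)
    qed (use w0 in \<open>auto simp: less_imp_le\<close>)
    then have spq: "(\<lambda>(p::int, q). w q * ?g q p) summable_on (UNIV \<times> int_forms A)"
      by (subst (asm) summable_on_swap) (simp add: case_prod_unfold)
    have sA': "(\<lambda>q. exp (- 2 * pi\<^sup>2 / \<gamma> * coulomb (insert i A) q)) summable_on int_forms (insert i A)"
    proof (subst summable_on_reindex_bij_betw[OF bij, symmetric], subst summable_on_cong)
      show "exp (- 2 * pi\<^sup>2 / \<gamma> * coulomb (insert i A) ((\<lambda>(t::int, \<phi>) x. \<phi> x + of_int t * delta i x) z)) =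
         (\<lambda>(p, q). w q * ?g q p) z" if "z \<in> UNIV \<times> int_forms A" for z
        using that w' by auto
    qed (rule spq)
    show ?thesis
      unfolding poisson_data_def
    proof (intro conjI ballI)
      show "0 < K * sqrt (2 * pi / (\<gamma> * s))" using K g s by simp
      show "(\<lambda>q. exp (- 2 * pi\<^sup>2 / \<gamma> * coulomb (insert i A) q)) summable_on int_forms (insert i A)" by (rule sA')
      fix a assume a: "a \<in> real_forms (insert i A)"
      define \<alpha> where "\<alpha> = a i"
      define b where "b t x = extend_zero A a x + (t + \<alpha>) * k x" for t x
      have b: "b t \<in> real_forms A" for t using bA[of a "t + \<alpha>"] by (simp add: b_def[abs_def])
      define E where "E t = exp (- \<mu> / 2 * (of_int t + \<alpha>)\<^sup>2)" for t :: int
      define f where "f z = exp (- \<gamma> / 2 * energy (\<lambda>x. z x + a x))" for z :: "'a \<Rightarrow> real"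
      have sE: "E summable_on UNIV" unfolding E_def using gaussian_summable_int[OF mu] .
      have E0: "0 < E t" for t by (simp add: E_def)
      have ft: "f (\<lambda>x. \<phi> x + of_int t * delta i x) = E t * exp (- \<gamma> / 2 * energy (\<lambda>x. \<phi> x + b (of_int t) x))"
        if "\<phi> \<in> int_forms A" for t \<phi>
        unfolding f_def shift[OF int_forms_real_forms[OF that] a] E_def b_def \<alpha>_def \<mu>_def exp_add[symmetric]
        by (simp add: algebra_simps)
      have hs: "((\<lambda>\<phi>. f (\<lambda>x. \<phi> x + of_int t * delta i x)) has_sum (E t * F (b (of_int t)))) (int_forms A)" for t
        unfolding F_def using has_sum_cmult_right[OF has_sum_infsum[OF sF[OF b]], of "E t" "of_int t"]
        by (subst has_sum_cong[OF ft]) auto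
      have sEF: "(\<lambda>t::int. E t * F (b (of_int t))) summable_on UNIV"
        by (rule summable_on_comparison_test[OF summable_on_cmult_left[OF sE, of "K * (\<Sum>\<^sub>\<infinity>q\<in>int_forms A. w q)"]])
           (use E0 Fle[OF b] F0 in \<open>auto intro!: mult_left_mono mult_nonneg_nonneg intro: less_imp_le\<close>)
      have sf2: "(\<lambda>(t::int, \<phi>). f (\<lambda>x. \<phi> x + of_int t * delta i x)) summable_on (UNIV \<times> int_forms A)"
      proof (rule summable_on_SigmaI)
        show "((\<lambda>\<phi>. case (t, \<phi>) of (t, \<phi>) \<Rightarrow> f (\<lambda>x. \<phi> x + of_int t * delta i x)) has_sum (E t * F (b (of_int t)))) (int_forms A)" for t
          using hs by simp
        show "(\<lambda>t::int. E t * F (b (of_int t))) summable_on UNIV" by (rule sEF)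
      qed (auto simp: f_def)
      have fbij: "f ((\<lambda>(t::int, \<phi>) x. \<phi> x + of_int t * delta i x) z) = (\<lambda>(t, \<phi>). f (\<lambda>x. \<phi> x + of_int t * delta i x)) z" for z
        by (cases z) simp
      have sf: "f summable_on int_forms (insert i A)"
        using sf2 unfolding fbij[symmetric] by (subst (asm) summable_on_reindex_bij_betw[OF bij])
      then show "(\<lambda>\<psi>. exp (- \<gamma> / 2 * energy (\<lambda>x. \<psi> x + a x))) summable_on int_forms (insert i A)"
        by (simp add: f_def[abs_def])
      have "(\<Sum>\<^sub>\<infinity>\<psi>\<in>int_forms (insert i A). f \<psi>) = (\<Sum>\<^sub>\<infinity>z\<in>UNIV \<times> int_forms A. (\<lambda>(t::int, \<phi>). f (\<lambda>x. \<phi> x + of_int t * delta i x)) z)"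
        unfolding fbij[symmetric] by (rule infsum_reindex_bij_betw[OF bij, symmetric])
      also have "\<dots> = (\<Sum>\<^sub>\<infinity>t. \<Sum>\<^sub>\<infinity>\<phi>\<in>int_forms A. f (\<lambda>x. \<phi> x + of_int t * delta i x))"
        using infsum_Sigma_banach[OF sf2] by simp
      also have "\<dots> = (\<Sum>\<^sub>\<infinity>t. E t * F (b (of_int t)))"
        using hs by (intro infsum_cong infsumI)
      finally have f1: "(\<Sum>\<^sub>\<infinity>\<psi>\<in>int_forms (insert i A). f \<psi>) = (\<Sum>\<^sub>\<infinity>t. E t * F (b (of_int t)))" .
      define h where "h t q = (E t * w q) *\<^sub>R cis (2 * pi * form_inner A q (b (of_int t)))" for t q
      \<comment> \<open>First \<open>A\<close> is dualised, for a fixed height \<open>t\<close> at \<open>i\<close>; then \<open>t\<close>, with the phase \<open>\<kappa> q\<close>.\<close>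
      have "of_real (\<Sum>\<^sub>\<infinity>\<psi>\<in>int_forms (insert i A). f \<psi>) = (\<Sum>\<^sub>\<infinity>t. of_real (E t * F (b (of_int t))) :: complex)"
        unfolding f1 by (rule infsum_complex_of_real[OF sEF, symmetric])
      also have "\<dots> = (\<Sum>\<^sub>\<infinity>t. K *\<^sub>R (\<Sum>\<^sub>\<infinity>q\<in>int_forms A. h t q))"
      proof (rule infsum_cong)
        fix t :: int
        have "(\<Sum>\<^sub>\<infinity>q\<in>int_forms A. h t q) = E t *\<^sub>R (\<Sum>\<^sub>\<infinity>q\<in>int_forms A. w q *\<^sub>R cis (2 * pi * form_inner A q (b (of_int t))))"
          by (simp add: h_def infsum_scaleR_right flip: scaleR_scaleR)
        then show "of_real (E t * F (b (of_int t))) = K *\<^sub>R (\<Sum>\<^sub>\<infinity>q\<in>int_forms A. h t q)"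
          by (simp add: F[OF b] scaleR_conv_of_real)
      qed
      also have "\<dots> = K *\<^sub>R (\<Sum>\<^sub>\<infinity>t. \<Sum>\<^sub>\<infinity>q\<in>int_forms A. h t q)" by (rule infsum_scaleR_right)
      also have "(\<Sum>\<^sub>\<infinity>t. \<Sum>\<^sub>\<infinity>q\<in>int_forms A. h t q) = (\<Sum>\<^sub>\<infinity>q\<in>int_forms A. \<Sum>\<^sub>\<infinity>t. h t q)"
      proof (rule infsum_swap_banach, rule abs_summable_summable)
        have "(\<lambda>(t, q). E t * w q) summable_on (UNIV \<times> int_forms A)"
        proof (rule summable_on_SigmaI)
          show "((\<lambda>q. case (t, q) of (t, q) \<Rightarrow> E t * w q) has_sum (E t * (\<Sum>\<^sub>\<infinity>q\<in>int_forms A. w q))) (int_forms A)" for t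
            using has_sum_cmult_right[OF has_sum_infsum[OF sw]] by simp
          show "(\<lambda>t. E t * (\<Sum>\<^sub>\<infinity>q\<in>int_forms A. w q)) summable_on UNIV" by (rule summable_on_cmult_left[OF sE])
        qed (use E0 w0 in \<open>auto simp: less_imp_le\<close>)
        then show "(\<lambda>z. norm (case z of (t, q) \<Rightarrow> h t q)) summable_on (UNIV \<times> int_forms A)"
          using E0 w0 by (simp add: h_def case_prod_unfold abs_of_pos)
      qed
      also have "\<dots> = (\<Sum>\<^sub>\<infinity>q\<in>int_forms A. sqrt (2 * pi / \<mu>) *\<^sub>R (\<Sum>\<^sub>\<infinity>p::int. (w q * ?g q p) *\<^sub>R cis (2 * pi * (form_inner A q a + of_int p * \<alpha>))))"
      proof (rule infsum_cong)
        fix q assume "q \<in> int_forms A"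
        define ca where "ca = w q *\<^sub>R cis (2 * pi * form_inner A q a)"
        have fb: "form_inner A q (b t) = form_inner A q a + (t + \<alpha>) * \<kappa> q" for t
        proof -
          have "form_inner A q (extend_zero A a) = form_inner A q a"
            by (rule form_inner_cong) (auto simp: extend_zero_def)
          then show ?thesis by (simp add: b_def[abs_def] form_inner_add_right form_inner_scale_right \<kappa>_def)
        qed
        have h1: "h t q = ca * (E t *\<^sub>R cis (2 * pi * \<kappa> q * (of_int t + \<alpha>)))" for t
          by (simp add: h_def fb ca_def cis_mult distrib_left mult_ac)
        have "(\<Sum>\<^sub>\<infinity>t. h t q) = ca * (\<Sum>\<^sub>\<infinity>t. E t *\<^sub>R cis (2 * pi * \<kappa> q * (of_int t + \<alpha>)))"
          unfolding h1 by (rule infsum_cmult_right')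
        also have "\<dots> = ca * (sqrt (2 * pi / \<mu>) *\<^sub>R (\<Sum>\<^sub>\<infinity>p::int. ?g q p *\<^sub>R cis (2 * pi * of_int p * \<alpha>)))"
          unfolding E_def gaussian_poisson_summation[OF mu] ..
        also have "\<dots> = sqrt (2 * pi / \<mu>) *\<^sub>R (\<Sum>\<^sub>\<infinity>p::int. ca * ?g q p *\<^sub>R cis (2 * pi * of_int p * \<alpha>))"
          by (simp only: infsum_cmult_right') (simp only: mult_scaleR_right)
        also have "(\<lambda>p::int. ca * ?g q p *\<^sub>R cis (2 * pi * of_int p * \<alpha>)) =
           (\<lambda>p. (w q * ?g q p) *\<^sub>R cis (2 * pi * (form_inner A q a + of_int p * \<alpha>)))"
          by (rule ext) (simp add: ca_def cis_mult distrib_left mult_ac add.commute)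
        finally show "(\<Sum>\<^sub>\<infinity>t. h t q) = sqrt (2 * pi / \<mu>) *\<^sub>R (\<Sum>\<^sub>\<infinity>p::int. (w q * ?g q p) *\<^sub>R cis (2 * pi * (form_inner A q a + of_int p * \<alpha>)))" .
      qed
      also have "\<dots> = sqrt (2 * pi / \<mu>) *\<^sub>R (\<Sum>\<^sub>\<infinity>q\<in>int_forms A. \<Sum>\<^sub>\<infinity>p::int. (w q * ?g q p) *\<^sub>R cis (2 * pi * (form_inner A q a + of_int p * \<alpha>)))"
        by (rule infsum_scaleR_right)
      also have "(\<Sum>\<^sub>\<infinity>q\<in>int_forms A. \<Sum>\<^sub>\<infinity>p::int. (w q * ?g q p) *\<^sub>R cis (2 * pi * (form_inner A q a + of_int p * \<alpha>)))
         = (\<Sum>\<^sub>\<infinity>q\<in>int_forms (insert i A). exp (- 2 * pi\<^sup>2 / \<gamma> * coulomb (insert i A) q) *\<^sub>R cis (2 * pi * form_inner (insert i A) q a))"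
      proof -
        define j where "j p q = (w q * ?g q p) *\<^sub>R cis (2 * pi * (form_inner A q a + of_int p * \<alpha>))" for p :: int and q
        have sj: "(\<lambda>(p, q). j p q) summable_on (UNIV \<times> int_forms A)"
          by (rule abs_summable_summable) (use spq w0 in \<open>simp add: j_def case_prod_unfold abs_of_pos\<close>)
        have "(\<Sum>\<^sub>\<infinity>q\<in>int_forms A. \<Sum>\<^sub>\<infinity>p. j p q) = (\<Sum>\<^sub>\<infinity>p. \<Sum>\<^sub>\<infinity>q\<in>int_forms A. j p q)"
          by (rule infsum_swap_banach[OF sj, symmetric])
        also have "\<dots> = (\<Sum>\<^sub>\<infinity>z\<in>UNIV \<times> int_forms A. (\<lambda>(p, q). j p q) z)"
          using infsum_Sigma_banach[OF sj] by simp
        also have "\<dots> = (\<Sum>\<^sub>\<infinity>z\<in>UNIV \<times> int_forms A. (\<lambda>q. exp (- 2 * pi\<^sup>2 / \<gamma> * coulomb (insert i A) q) *\<^sub>R cis (2 * pi * form_inner (insert i A) q a))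
           ((\<lambda>(t::int, \<phi>) x. \<phi> x + of_int t * delta i x) z))"
        proof (rule infsum_cong)
          fix z :: "int \<times> ('a \<Rightarrow> real)" assume z: "z \<in> UNIV \<times> int_forms A"
          obtain p q where zpq: "z = (p, q)" by (cases z)
          then have q: "q \<in> int_forms A" using z by simp
          have "form_inner A (\<lambda>x. q x + of_int p * delta i x) a = form_inner A q a"
            using A by (intro form_inner_cong) (auto simp: delta_def)
          moreover have "q i = 0" using q A by (simp add: int_forms_def real_forms_def)
          ultimately have "form_inner (insert i A) (\<lambda>x. q x + of_int p * delta i x) a = form_inner A q a + of_int p * \<alpha>"
            using A by (simp add: form_inner_insert \<alpha>_def delta_def)
          then show "(\<lambda>(p, q). j p q) z = (\<lambda>q. exp (- 2 * pi\<^sup>2 / \<gamma> * coulomb (insert i A) q) *\<^sub>R cis (2 * pi * form_inner (insert i A) q a))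
           ((\<lambda>(t::int, \<phi>) x. \<phi> x + of_int t * delta i x) z)"
            unfolding zpq prod.case w'[OF q] by (simp add: j_def)
        qed
        also have "\<dots> = (\<Sum>\<^sub>\<infinity>q\<in>int_forms (insert i A). exp (- 2 * pi\<^sup>2 / \<gamma> * coulomb (insert i A) q) *\<^sub>R cis (2 * pi * form_inner (insert i A) q a))"
          by (rule infsum_reindex_bij_betw[OF bij])
        finally show ?thesis by (simp add: j_def)
      qed
      finally show "of_real (\<Sum>\<^sub>\<infinity>\<psi>\<in>int_forms (insert i A). exp (- \<gamma> / 2 * energy (\<lambda>x. \<psi> x + a x))) =
       (K * sqrt (2 * pi / (\<gamma> * s))) *\<^sub>R (\<Sum>\<^sub>\<infinity>q\<in>int_forms (insert i A). exp (- 2 * pi\<^sup>2 / \<gamma> * coulomb (insert i A) q) *\<^sub>R cis (2 * pi * form_inner (insert i A) q a))"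
        by (simp add: f_def \<mu>_def)
    qed
  qed
  with gd s show ?thesis by blast
qed

lemma poisson_data_empty: "poisson_data \<gamma> {} 1"
proof -
  have "real_forms {} = {\<lambda>x::'a. 0}"
    by (auto simp: real_forms_def)
  then show ?thesis
    by (simp add: poisson_data_def int_forms_empty coulomb_def form_inner_def zero_left)
qed

theorem gaussian_poisson_data:
  assumes "finite A" "pos_def A"
  obtains C where "gaussian_data A C" "\<And>\<gamma>. 0 < \<gamma> \<Longrightarrow> poisson_data \<gamma> A (C / sqrt \<gamma> ^ card A)"
proof -
  have "\<exists>C. gaussian_data A C \<and> (\<forall>\<gamma>>0. poisson_data \<gamma> A (C / sqrt \<gamma> ^ card A))"
    using assms
  proof (induction A)
    case empty
    then show ?case using gaussian_data_empty poisson_data_empty by auto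
  next
    case (insert i A)
    have "pos_def A" using insert.prems by (rule pos_def_subset) auto
    then obtain C where C: "gaussian_data A C" and P: "\<And>\<gamma>. 0 < \<gamma> \<Longrightarrow> poisson_data \<gamma> A (C / sqrt \<gamma> ^ card A)"
      using insert.IH by blast
    obtain s where s: "0 < s" "gaussian_data (insert i A) (C * sqrt (2 * pi / s))"
      "\<And>\<gamma> K. 0 < \<gamma> \<Longrightarrow> poisson_data \<gamma> A K \<Longrightarrow> poisson_data \<gamma> (insert i A) (K * sqrt (2 * pi / (\<gamma> * s)))"
      using gaussian_poisson_data_insert[OF insert.hyps insert.prems C] by blast
    have "C / sqrt \<gamma> ^ card A * sqrt (2 * pi / (\<gamma> * s)) = C * sqrt (2 * pi / s) / sqrt \<gamma> ^ card (insert i A)" if "0 < \<gamma>" for \<gamma>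
      using insert.hyps that s(1) by (simp add: real_sqrt_divide real_sqrt_mult field_simps)
    then have "poisson_data \<gamma> (insert i A) (C * sqrt (2 * pi / s) / sqrt \<gamma> ^ card (insert i A))" if "0 < \<gamma>" for \<gamma>
      using s(3)[OF that P[OF that]] that by simp
    with s(2) show ?case by blast
  qed
  then show ?thesis using that by blast
qed

end

text \<open>
  The Gaussian sum over the heights of one vertex tied to a vertex of height \<open>0\<close> by a single edge.
\<close>

definition theta :: "real \<Rightarrow> real" where
  "theta \<gamma> = (\<Sum>\<^sub>\<infinity>t::int. exp (- \<gamma> / 2 * (of_int t)\<^sup>2))"

section \<open>Integer-valued Gaussian sums\<close>

context quadratic_form
begin

definition discrete_gaussian :: "real \<Rightarrow> 'a set \<Rightarrow> real" where
  "discrete_gaussian \<gamma> A = (\<Sum>\<^sub>\<infinity>\<psi>\<in>int_forms A. exp (- \<gamma> / 2 * B \<psi> \<psi>))"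

text \<open>
  Poisson summation writes the shifted sum as a series with positive weights in which the shift enters
  only through phases.
\<close>

lemma
  assumes A: "finite A" "pos_def A" and g: "0 < \<gamma>" and a: "a \<in> real_forms A"
  shows summable_shifted: "(\<lambda>\<psi>. exp (- \<gamma> / 2 * energy (\<lambda>x. \<psi> x + a x))) summable_on int_forms A"
    and shifted_le: "(\<Sum>\<^sub>\<infinity>\<psi>\<in>int_forms A. exp (- \<gamma> / 2 * energy (\<lambda>x. \<psi> x + a x))) \<le> discrete_gaussian \<gamma> A"
proof -
  obtain C where C: "poisson_data \<gamma> A (C / sqrt \<gamma> ^ card A)"
    using gaussian_poisson_data[OF A] g by metis
  define K where "K = C / sqrt \<gamma> ^ card A"
  define w where "w q = exp (- 2 * pi\<^sup>2 / \<gamma> * coulomb A q)" for q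
  define F where "F b = (\<Sum>\<^sub>\<infinity>\<psi>\<in>int_forms A. exp (- \<gamma> / 2 * energy (\<lambda>x. \<psi> x + b x)))" for b
  have K: "0 < K" using C by (simp add: poisson_data_def K_def)
  have w0: "0 \<le> w q" for q by (simp add: w_def)
  have sw: "w summable_on int_forms A" using C by (simp add: poisson_data_def w_def[abs_def])
  have F: "of_real (F b) = K *\<^sub>R (\<Sum>\<^sub>\<infinity>q\<in>int_forms A. w q *\<^sub>R cis (2 * pi * form_inner A q b))" if "b \<in> real_forms A" for b
    using C that by (simp add: poisson_data_def F_def w_def K_def)
  show "(\<lambda>\<psi>. exp (- \<gamma> / 2 * energy (\<lambda>x. \<psi> x + a x))) summable_on int_forms A"
    using C a by (simp add: poisson_data_def)
  have "F a = norm (of_real (F a) :: complex)" by (simp add: F_def infsum_nonneg)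
  also have "\<dots> = K * norm (\<Sum>\<^sub>\<infinity>q\<in>int_forms A. w q *\<^sub>R cis (2 * pi * form_inner A q a))"
    using K unfolding F[OF a] by simp
  also have "\<dots> \<le> K * (\<Sum>\<^sub>\<infinity>q\<in>int_forms A. norm (w q *\<^sub>R cis (2 * pi * form_inner A q a)))"
    using K sw by (intro mult_left_mono norm_infsum_bound) (auto simp: abs_of_nonneg w0)
  also have "\<dots> = K * (\<Sum>\<^sub>\<infinity>q\<in>int_forms A. w q)" by (simp add: abs_of_nonneg w0)
  also have "complex_of_real \<dots> = of_real (F (\<lambda>x. 0))"
    using F[OF real_forms_zero] infsum_complex_of_real[OF sw] by (simp add: form_inner_def scaleR_conv_of_real)
  then have "K * (\<Sum>\<^sub>\<infinity>q\<in>int_forms A. w q) = F (\<lambda>x. 0)" by (simp only: of_real_eq_iff)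
  also have "\<dots> = discrete_gaussian \<gamma> A" by (simp add: F_def discrete_gaussian_def)
  finally show "(\<Sum>\<^sub>\<infinity>\<psi>\<in>int_forms A. exp (- \<gamma> / 2 * energy (\<lambda>x. \<psi> x + a x))) \<le> discrete_gaussian \<gamma> A"
    by (simp add: F_def)
qed

lemma summable_discrete_gaussian:
  assumes "finite A" "pos_def A" "0 < \<gamma>"
  shows "(\<lambda>\<psi>. exp (- \<gamma> / 2 * B \<psi> \<psi>)) summable_on int_forms A"
  using summable_shifted[OF assms real_forms_zero] by simp

lemma one_le_sum_exp:
  fixes R :: "('a \<Rightarrow> real) \<Rightarrow> real"
  assumes "(\<lambda>\<psi>. exp (- R \<psi>)) summable_on int_forms A" "R (\<lambda>x. 0) = 0"
  shows "1 \<le> (\<Sum>\<^sub>\<infinity>\<psi>\<in>int_forms A. exp (- R \<psi>))"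
  using finite_sum_le_infsum[OF assms(1), of "{\<lambda>x. 0}"] assms(2) by (simp add: int_forms_zero)

lemma discrete_gaussian_ge_1:
  assumes "finite A" "pos_def A" "0 < \<gamma>"
  shows "1 \<le> discrete_gaussian \<gamma> A"
  using one_le_sum_exp[of "\<lambda>\<psi>. \<gamma> / 2 * B \<psi> \<psi>" A] summable_discrete_gaussian[OF assms]
  by (simp add: discrete_gaussian_def zero_left)

text \<open>
  Replacing \<open>h\<close> by its harmonic extension \<open>r = h - u\<close> separates the energy of \<open>r\<close> from that of a
  sum with the shift \<open>u\<close>, which is supported in \<open>A\<close>.  So nonzero boundary values can only decrease the
  sum over the heights inside.
\<close>

lemma boundary_le:
  assumes A: "finite A" "pos_def A" and g: "0 < \<gamma>" and psd: "\<And>f. 0 \<le> B f f"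
  shows "(\<Sum>\<^sub>\<infinity>\<psi>\<in>int_forms A. exp (- \<gamma> / 2 * energy (\<lambda>x. \<psi> x + h x))) \<le> discrete_gaussian \<gamma> A"
proof -
  define u where "u = green A (\<lambda>x. B h (delta x))"
  have u: "is_green A (\<lambda>x. B h (delta x)) u" unfolding u_def by (rule green[OF A])
  have uA: "u \<in> real_forms A" using u by (simp add: is_green_def)
  define r where "r x = h x + (- 1) * u x" for x
  have orth: "B r \<phi> = 0" if "\<phi> \<in> real_forms A" for \<phi>
  proof -
    have "B u \<phi> = B h \<phi>"
      using u that expand_delta[OF A(1) that, of h] by (simp add: is_green_def form_inner_def mult.commute)
    then show ?thesis unfolding r_def add_left scale_left by simp
  qed
  have dec: "energy (\<lambda>x. \<psi> x + h x) = energy (\<lambda>x. \<psi> x + u x) + B r r" if "\<psi> \<in> int_forms A" for \<psi>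
  proof -
    define p where "p x = \<psi> x + u x" for x
    have "p \<in> real_forms A" unfolding p_def using int_forms_real_forms[OF that] uA by (rule real_forms_add)
    then have o: "B r p = 0" "B p r = 0" using orth sym by metis+
    have "(\<lambda>x. \<psi> x + h x) = (\<lambda>x. p x + r x)" by (simp add: p_def r_def)
    then show ?thesis by (simp add: add_left add_right o p_def[symmetric, abs_def])
  qed
  have eq: "exp (- \<gamma> / 2 * energy (\<lambda>x. \<psi> x + h x)) =
     exp (- \<gamma> / 2 * B r r) * exp (- \<gamma> / 2 * energy (\<lambda>x. \<psi> x + u x))" if "\<psi> \<in> int_forms A" for \<psi>
    unfolding dec[OF that] by (simp add: algebra_simps flip: exp_add)
  have "(\<Sum>\<^sub>\<infinity>\<psi>\<in>int_forms A. exp (- \<gamma> / 2 * energy (\<lambda>x. \<psi> x + h x))) =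
     (\<Sum>\<^sub>\<infinity>\<psi>\<in>int_forms A. exp (- \<gamma> / 2 * B r r) * exp (- \<gamma> / 2 * energy (\<lambda>x. \<psi> x + u x)))"
    by (rule infsum_cong) (rule eq)
  also have "\<dots> = exp (- \<gamma> / 2 * B r r) * (\<Sum>\<^sub>\<infinity>\<psi>\<in>int_forms A. exp (- \<gamma> / 2 * energy (\<lambda>x. \<psi> x + u x)))"
    by (rule infsum_cmult_right')
  also have "\<dots> \<le> 1 * discrete_gaussian \<gamma> A"
    using g psd[of r] by (intro mult_mono shifted_le A uA) (auto intro: infsum_nonneg)
  finally show "(\<Sum>\<^sub>\<infinity>\<psi>\<in>int_forms A. exp (- \<gamma> / 2 * energy (\<lambda>x. \<psi> x + h x))) \<le> discrete_gaussian \<gamma> A"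
    by simp
qed

lemma bij_betw_int_forms_Un:
  assumes "A1 \<inter> A2 = {}"
  shows "bij_betw (\<lambda>(\<phi>1, \<phi>2) x. \<phi>1 x + \<phi>2 x) (int_forms A1 \<times> int_forms A2) (int_forms (A1 \<union> A2))"
proof (rule bij_betw_byWitness[where f' = "\<lambda>\<psi>. (extend_zero A1 \<psi>, extend_zero A2 \<psi>)"])
  show "\<forall>a\<in>int_forms A1 \<times> int_forms A2. (\<lambda>\<psi>. (extend_zero A1 \<psi>, extend_zero A2 \<psi>)) ((\<lambda>(\<phi>1, \<phi>2) x. \<phi>1 x + \<phi>2 x) a) = a"
    using assms by (auto simp: int_forms_def real_forms_def extend_zero_def fun_eq_iff)
  show "\<forall>\<psi>\<in>int_forms (A1 \<union> A2). (\<lambda>(\<phi>1, \<phi>2) x. \<phi>1 x + \<phi>2 x) (extend_zero A1 \<psi>, extend_zero A2 \<psi>) = \<psi>"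
    using assms by (auto simp: int_forms_def real_forms_def extend_zero_def fun_eq_iff)
qed (auto simp: int_forms_def real_forms_def extend_zero_def)

lemma int_forms_uminus: "\<phi> \<in> int_forms A \<Longrightarrow> (\<lambda>x. - \<phi> x) \<in> int_forms A"
  by (auto simp: int_forms_def real_forms_def)

text \<open>
  Flipping the sign of the form on \<open>A1\<close> reverses the interaction with \<open>A2\<close> and nothing else.  The
  average over the flip of the interaction factor is a hyperbolic cosine, hence at least \<open>1\<close>.
\<close>

lemma sum_exp_superadditive:
  assumes dis: "A1 \<inter> A2 = {}" and s: "(\<lambda>\<psi>. exp (- c * B \<psi> \<psi>)) summable_on int_forms (A1 \<union> A2)"
  shows "(\<Sum>\<^sub>\<infinity>\<psi>\<in>int_forms A1. exp (- c * B \<psi> \<psi>)) * (\<Sum>\<^sub>\<infinity>\<psi>\<in>int_forms A2. exp (- c * B \<psi> \<psi>))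
     \<le> (\<Sum>\<^sub>\<infinity>\<psi>\<in>int_forms (A1 \<union> A2). exp (- c * B \<psi> \<psi>))"
proof -
  define S where "S = int_forms A1 \<times> int_forms A2"
  define f where "f \<psi> = exp (- c * B \<psi> \<psi>)" for \<psi>
  define pl where "pl = (\<lambda>(\<phi>1, \<phi>2) (x::'a). \<phi>1 x + \<phi>2 x :: real)"
  have bij: "bij_betw pl S (int_forms (A1 \<union> A2))"
    unfolding pl_def S_def by (rule bij_betw_int_forms_Un[OF dis])
  define ng where "ng = (\<lambda>(\<phi>1 :: 'a \<Rightarrow> real, \<phi>2 :: 'a \<Rightarrow> real). (\<lambda>x. - \<phi>1 x, \<phi>2))"
  have ng: "bij_betw ng S S"
    by (rule bij_betw_byWitness[where f' = ng]) (auto simp: ng_def S_def int_forms_uminus)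
  have sp: "(\<lambda>z. f (pl z)) summable_on S"
    using s summable_on_reindex_bij_betw[OF bij, of f] by (simp add: f_def[abs_def])
  have sn: "(\<lambda>z. f (pl (ng z))) summable_on S"
    using sp summable_on_reindex_bij_betw[OF ng, of "\<lambda>z. f (pl z)"] by simp
  define g where "g = (\<lambda>(\<phi>1, \<phi>2). f \<phi>1 * f \<phi>2)"
  have key: "2 * g z \<le> f (pl z) + f (pl (ng z))" for z
  proof -
    obtain \<phi>1 \<phi>2 where z: "z = (\<phi>1, \<phi>2)" by (cases z)
    define b where "b = 2 * c * B \<phi>1 \<phi>2"
    have "f (pl z) = f \<phi>1 * f \<phi>2 * exp (- b)"
      unfolding f_def z pl_def b_def
      by (simp add: add_left add_right sym[of \<phi>2 \<phi>1] algebra_simps flip: exp_add)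
    moreover have "f (pl (ng z)) = f \<phi>1 * f \<phi>2 * exp b"
    proof -
      have "pl (ng z) = (\<lambda>x. (- 1) * \<phi>1 x + \<phi>2 x)" by (simp add: pl_def ng_def z)
      then have q: "energy (pl (ng z)) = B \<phi>1 \<phi>1 + B \<phi>2 \<phi>2 - 2 * B \<phi>1 \<phi>2"
        using add_left[of "\<lambda>x. (- 1) * \<phi>1 x" \<phi>2] add_right[of _ "\<lambda>x. (- 1) * \<phi>1 x" \<phi>2]
          scale_left[of "- 1" \<phi>1] scale_right[of _ "- 1" \<phi>1] sym[of \<phi>2 \<phi>1] by (simp del: mult_minus1)
      show ?thesis
        unfolding f_def b_def q by (simp add: algebra_simps flip: exp_add)
    qed
    moreover have "2 \<le> exp b + exp (- b)"
      using exp_ge_add_one_self[of b] exp_ge_add_one_self[of "- b"] by linarith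
    then have "f \<phi>1 * f \<phi>2 * 2 \<le> f \<phi>1 * f \<phi>2 * (exp b + exp (- b))"
      by (intro mult_left_mono) (auto simp: f_def)
    ultimately show ?thesis by (simp add: g_def z algebra_simps)
  qed
  have s2: "(\<lambda>z. f (pl z) + f (pl (ng z))) summable_on S" by (intro summable_on_add sp sn)
  have s2g: "(\<lambda>z. 2 * g z) summable_on S"
    by (rule summable_on_comparison_test[OF s2]) (use key in \<open>auto simp: g_def f_def\<close>)
  then have sg: "g summable_on S" using summable_on_cmult_right[OF s2g, of "1/2"] by simp
  have "2 * (\<Sum>\<^sub>\<infinity>z\<in>S. g z) = (\<Sum>\<^sub>\<infinity>z\<in>S. 2 * g z)" by (rule infsum_cmult_right'[symmetric])
  also have "\<dots> \<le> (\<Sum>\<^sub>\<infinity>z\<in>S. f (pl z) + f (pl (ng z)))" using s2g s2 key by (intro infsum_mono)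
  also have "\<dots> = (\<Sum>\<^sub>\<infinity>z\<in>S. f (pl z)) + (\<Sum>\<^sub>\<infinity>z\<in>S. f (pl (ng z)))" by (rule infsum_add[OF sp sn])
  also have "(\<Sum>\<^sub>\<infinity>z\<in>S. f (pl (ng z))) = (\<Sum>\<^sub>\<infinity>z\<in>S. f (pl z))" by (rule infsum_reindex_bij_betw[OF ng])
  also have "(\<Sum>\<^sub>\<infinity>z\<in>S. f (pl z)) = (\<Sum>\<^sub>\<infinity>\<psi>\<in>int_forms (A1 \<union> A2). f \<psi>)" by (rule infsum_reindex_bij_betw[OF bij])
  finally have "(\<Sum>\<^sub>\<infinity>z\<in>S. g z) \<le> (\<Sum>\<^sub>\<infinity>\<psi>\<in>int_forms (A1 \<union> A2). f \<psi>)" by simp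
  moreover have "(\<Sum>\<^sub>\<infinity>z\<in>S. g z) = (\<Sum>\<^sub>\<infinity>\<phi>1\<in>int_forms A1. \<Sum>\<^sub>\<infinity>\<phi>2\<in>int_forms A2. f \<phi>1 * f \<phi>2)"
    using infsum_Sigma_banach[OF sg[unfolded S_def]] by (simp add: S_def g_def)
  moreover have "\<dots> = (\<Sum>\<^sub>\<infinity>\<phi>1\<in>int_forms A1. f \<phi>1) * (\<Sum>\<^sub>\<infinity>\<phi>2\<in>int_forms A2. f \<phi>2)"
    by (simp add: infsum_cmult_right' infsum_cmult_left')
  ultimately show ?thesis by (simp add: f_def)
qed

lemma coulomb_pos:
  assumes A: "finite A" "pos_def A" and q: "q \<in> real_forms A" "q \<noteq> (\<lambda>x. 0)"
  shows "0 < coulomb A q"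
proof -
  define u where "u = green A q"
  have u: "is_green A q u" unfolding u_def by (rule green[OF A])
  have "u \<noteq> (\<lambda>x. 0)"
  proof
    assume "u = (\<lambda>x. 0)"
    then have f: "form_inner A q \<phi> = 0" if "\<phi> \<in> real_forms A" for \<phi>
      using u that zero_left[of \<phi>] unfolding is_green_def by metis
    have z: "q x = 0" if "x \<in> A" for x
      using f[OF real_forms_delta[OF that]] form_inner_delta[OF A(1), of q x] that by simp
    have "q x = 0" for x using z[of x] q(1) by (cases "x \<in> A") (auto simp: real_forms_def)
    then show False using q(2) by blast
  qed
  then have "0 < B u u" using A(2) u unfolding pos_def_def is_green_def by blast
  also have "B u u = form_inner A q u" using u by (simp add: is_green_def)
  finally show ?thesis by (simp add: coulomb_def u_def)
qed

lemma coulomb_zero: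
  assumes A: "finite A" "pos_def A"
  shows "coulomb A (\<lambda>x. 0) = 0"
  by (simp add: coulomb_def form_inner_def)

lemma summable_coulomb:
  assumes A: "finite A" "pos_def A" and c: "0 < c"
  shows "(\<lambda>q. exp (- c * coulomb A q)) summable_on int_forms A"
proof -
  obtain C where "poisson_data (2 * pi\<^sup>2 / c) A C"
    using gaussian_poisson_data[OF A] c by (metis divide_pos_pos mult_pos_pos pi_gt_zero zero_less_numeral zero_less_power)
  then show ?thesis using c by (simp add: poisson_data_def)
qed

text \<open>
  Only finitely many charges have energy below \<open>1\<close>, since the weights are summable; so the energies of
  the nonzero charges are bounded below by some \<open>\<rho> > 0\<close>, and their total weight decays like
  \<open>exp (- c * \<rho>)\<close>.
\<close>

lemma coulomb_sum_tendsto_1: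
  assumes A: "finite A" "pos_def A"
  shows "((\<lambda>c. \<Sum>\<^sub>\<infinity>q\<in>int_forms A. exp (- c * coulomb A q)) \<longlongrightarrow> 1) at_top"
proof -
  define R where "R = coulomb A"
  define S where "S c = (\<Sum>\<^sub>\<infinity>q\<in>int_forms A. exp (- c * R q))" for c
  have s: "(\<lambda>q. exp (- c * R q)) summable_on int_forms A" if "0 < c" for c
    using summable_coulomb[OF A that] by (simp add: R_def)
  have Rpos: "0 < R q" if "q \<in> int_forms A" "q \<noteq> (\<lambda>x. 0)" for q
    using coulomb_pos[OF A int_forms_real_forms[OF that(1)] that(2)] by (simp add: R_def)
  have R0: "R (\<lambda>x. 0) = 0" by (simp add: R_def coulomb_zero[OF A])
  define T where "T = {q \<in> int_forms A. R q < 1}"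
  have finT: "finite T"
  proof (rule ccontr)
    assume inf: "infinite T"
    define n where "n = nat \<lceil>S 1 / exp (- 1)\<rceil> + 1"
    obtain F where F: "F \<subseteq> T" "finite F" "card F = n"
      using infinite_arbitrarily_large[OF inf] by blast
    have "real n * exp (- 1) = (\<Sum>q\<in>F. exp (- 1))" using F by simp
    also have "\<dots> \<le> (\<Sum>q\<in>F. exp (- 1 * R q))" using F by (intro sum_mono) (auto simp: T_def)
    also have "\<dots> \<le> S 1"
      unfolding S_def using F s[of 1] by (intro finite_sum_le_infsum) (auto simp: T_def)
    finally have "real n \<le> S 1 / exp (- 1)" by (simp add: field_simps)
    moreover have "S 1 / exp (- 1) < real n"
      unfolding n_def by linarith
    ultimately show False by linarith
  qed
  define \<rho> where "\<rho> = Min (insert 1 (R ` (T - {\<lambda>x. 0})))"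
  have rho: "0 < \<rho>" unfolding \<rho>_def using finT Rpos by (subst Min_gr_iff) (auto simp: T_def)
  have Rge: "\<rho> \<le> R q" if "q \<in> int_forms A" "q \<noteq> (\<lambda>x. 0)" for q
  proof (cases "q \<in> T")
    case True
    then show ?thesis unfolding \<rho>_def using that finT by (intro Min_le) auto
  next
    case False
    then have "1 \<le> R q" using that by (simp add: T_def)
    moreover have "\<rho> \<le> 1" unfolding \<rho>_def using finT by (intro Min_le) auto
    ultimately show ?thesis by simp
  qed
  define U where "U = int_forms A - {\<lambda>x. 0}"
  have ins: "int_forms A = insert (\<lambda>x. 0) U" by (auto simp: U_def int_forms_zero)
  have sU: "(\<lambda>q. exp (- c * R q)) summable_on U" if "0 < c" for c
    by (rule summable_on_subset[OF s[OF that]]) (auto simp: U_def)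
  have Sc: "S c = 1 + (\<Sum>\<^sub>\<infinity>q\<in>U. exp (- c * R q))" if "0 < c" for c
    unfolding S_def ins using sU[OF that] by (subst infsum_insert) (auto simp: U_def R0)
  have upper: "S c \<le> 1 + S 1 * exp (- (c - 1) * \<rho>)" if "1 < c" for c
  proof -
    have "(\<Sum>\<^sub>\<infinity>q\<in>U. exp (- c * R q)) \<le> (\<Sum>\<^sub>\<infinity>q\<in>U. exp (- 1 * R q) * exp (- (c - 1) * \<rho>))"
    proof (rule infsum_mono)
      show "(\<lambda>q. exp (- c * R q)) summable_on U" using sU that by simp
      show "(\<lambda>q. exp (- 1 * R q) * exp (- (c - 1) * \<rho>)) summable_on U" using sU[of 1] by (intro summable_on_cmult_left) simp
      fix q assume "q \<in> U"
      then have "(c - 1) * \<rho> \<le> (c - 1) * R q" using Rge that by (intro mult_left_mono) (auto simp: U_def)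
      then show "exp (- c * R q) \<le> exp (- 1 * R q) * exp (- (c - 1) * \<rho>)"
        by (simp add: algebra_simps flip: exp_add)
    qed
    also have "\<dots> = (\<Sum>\<^sub>\<infinity>q\<in>U. exp (- 1 * R q)) * exp (- (c - 1) * \<rho>)" by (rule infsum_cmult_left')
    also have "\<dots> \<le> S 1 * exp (- (c - 1) * \<rho>)"
      using Sc[of 1] by (intro mult_right_mono) auto
    finally show ?thesis using Sc[of c] that by simp
  qed
  have lower: "1 \<le> S c" if "0 < c" for c
    using Sc[OF that] by (simp add: infsum_nonneg)
  have "(S \<longlongrightarrow> 1) at_top"
  proof (rule tendsto_sandwich)
    show "\<forall>\<^sub>F c in at_top. 1 \<le> S c" using eventually_gt_at_top[of 0] by eventually_elim (rule lower)
    show "\<forall>\<^sub>F c in at_top. S c \<le> 1 + S 1 * exp (- (c - 1) * \<rho>)"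
      using eventually_gt_at_top[of 1] by eventually_elim (rule upper)
    have "((\<lambda>c. exp (- (c - 1) * \<rho>)) \<longlongrightarrow> 0) at_top"
      using rho by real_asymp
    then have "((\<lambda>c. 1 + S 1 * exp (- (c - 1) * \<rho>)) \<longlongrightarrow> 1 + S 1 * 0) at_top"
      by (intro tendsto_intros)
    then show "((\<lambda>c. 1 + S 1 * exp (- (c - 1) * \<rho>)) \<longlongrightarrow> 1) at_top" by simp
  qed (rule tendsto_const)
  then show ?thesis by (simp add: S_def[abs_def] R_def)
qed

text \<open>
  The last claim says that the Gaussian integral is the limit of its Riemann sums; on the dual side only
  the charge \<open>0\<close> survives.
\<close>

theorem gaussian_const:
  assumes A: "finite A" "pos_def A"
  obtains C where "0 < C"
    "\<And>\<gamma>. 0 < \<gamma> \<Longrightarrow> (LINT \<phi>|(\<Pi>\<^sub>M x\<in>A. lborel). exp (- \<gamma> / 2 * energy (extend_zero A \<phi>))) = C / sqrt \<gamma> ^ card A"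
    "\<And>\<gamma>. 0 < \<gamma> \<Longrightarrow> discrete_gaussian \<gamma> A = C / sqrt \<gamma> ^ card A * (\<Sum>\<^sub>\<infinity>q\<in>int_forms A. exp (- (2 * pi\<^sup>2 / \<gamma>) * coulomb A q))"
    "((\<lambda>\<gamma>. sqrt \<gamma> ^ card A * discrete_gaussian \<gamma> A) \<longlongrightarrow> C) (at_right 0)"
proof -
  obtain C where G: "gaussian_data A C" and P: "\<And>\<gamma>. 0 < \<gamma> \<Longrightarrow> poisson_data \<gamma> A (C / sqrt \<gamma> ^ card A)"
    using gaussian_poisson_data[OF A] by metis
  have C: "0 < C" using G by (simp add: gaussian_data_def)
  have 1: "(LINT \<phi>|(\<Pi>\<^sub>M x\<in>A. lborel). exp (- \<gamma> / 2 * energy (extend_zero A \<phi>))) = C / sqrt \<gamma> ^ card A" if "0 < \<gamma>" for \<gamma>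
  proof -
    have "(\<integral>\<^sup>+\<phi>. ennreal (exp (- \<gamma> / 2 * energy (extend_zero A \<phi>))) \<partial>(\<Pi>\<^sub>M x\<in>A. lborel)) = ennreal (C / sqrt \<gamma> ^ card A)"
      using G that real_forms_zero[of A] unfolding gaussian_data_def by (metis (no_types, lifting) add.right_neutral ext nn_integral_cong)
    moreover have "(\<lambda>\<phi>. exp (- \<gamma> / 2 * energy (extend_zero A \<phi>))) \<in> borel_measurable (\<Pi>\<^sub>M x\<in>A. lborel)"
      using measurable_form[OF A(1), where a = "\<lambda>x. 0"] by simp
    ultimately show ?thesis
      using C that by (subst integral_eq_nn_integral) auto
  qed
  have 2: "discrete_gaussian \<gamma> A = C / sqrt \<gamma> ^ card A * (\<Sum>\<^sub>\<infinity>q\<in>int_forms A. exp (- (2 * pi\<^sup>2 / \<gamma>) * coulomb A q))" if g: "0 < \<gamma>" for \<gamma>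
  proof -
    have "(2 * pi\<^sup>2 / \<gamma>) > 0" using g by simp
    note s = summable_coulomb[OF A this]
    have "complex_of_real (discrete_gaussian \<gamma> A) = (C / sqrt \<gamma> ^ card A) *\<^sub>R (\<Sum>\<^sub>\<infinity>q\<in>int_forms A. of_real (exp (- (2 * pi\<^sup>2 / \<gamma>) * coulomb A q)))"
      using P[OF g] real_forms_zero[of A]
      by (auto simp: poisson_data_def discrete_gaussian_def form_inner_def scaleR_conv_of_real)
    also have "\<dots> = of_real (C / sqrt \<gamma> ^ card A * (\<Sum>\<^sub>\<infinity>q\<in>int_forms A. exp (- (2 * pi\<^sup>2 / \<gamma>) * coulomb A q)))"
      unfolding infsum_complex_of_real[OF s] by (simp add: scaleR_conv_of_real)
    finally show ?thesis by (simp only: of_real_eq_iff)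
  qed
  have "filterlim (\<lambda>\<gamma>. 2 * pi\<^sup>2 / \<gamma>) at_top (at_right 0)"
    by real_asymp
  then have "((\<lambda>\<gamma>. C * (\<Sum>\<^sub>\<infinity>q\<in>int_forms A. exp (- (2 * pi\<^sup>2 / \<gamma>) * coulomb A q))) \<longlongrightarrow> C * 1) (at_right 0)"
    by (intro tendsto_mult tendsto_const filterlim_compose[OF coulomb_sum_tendsto_1[OF A]])
  moreover have "\<forall>\<^sub>F \<gamma> in at_right 0. C * (\<Sum>\<^sub>\<infinity>q\<in>int_forms A. exp (- (2 * pi\<^sup>2 / \<gamma>) * coulomb A q)) = sqrt \<gamma> ^ card A * discrete_gaussian \<gamma> A"
    using eventually_at_right_less[of 0] by eventually_elim (simp add: 2)
  ultimately have 3: "((\<lambda>\<gamma>. sqrt \<gamma> ^ card A * discrete_gaussian \<gamma> A) \<longlongrightarrow> C) (at_right 0)"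
    using Lim_transform_eventually by force
  show ?thesis using that[OF C 1 2 3] by blast
qed

end

section \<open>Height functions on graphs\<close>

definition dirichlet_form :: "('v \<times> 'v) set \<Rightarrow> ('v \<Rightarrow> real) \<Rightarrow> ('v \<Rightarrow> real) \<Rightarrow> real" where
  "dirichlet_form E f g = form_inner E (grad f) (grad g)"

interpretation dirichlet: quadratic_form "dirichlet_form E" for E :: "('v \<times> 'v) set"
proof
  fix f g h :: "'v \<Rightarrow> real" and c :: real
  show "dirichlet_form E f g = dirichlet_form E g f"
    by (simp add: dirichlet_form_def form_inner_commute)
  show "dirichlet_form E (\<lambda>x. f x + g x) h = dirichlet_form E f h + dirichlet_form E g h"
    by (simp add: dirichlet_form_def form_inner_def grad_def sum.distrib[symmetric] algebra_simps)
  show "dirichlet_form E (\<lambda>x. c * f x) h = c * dirichlet_form E f h"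
    by (simp add: dirichlet_form_def form_inner_def grad_def sum_distrib_left algebra_simps)
qed

lemma dirichlet_form_self: "dirichlet_form E f f = (\<Sum>e\<in>E. (grad f e)\<^sup>2)"
  by (simp add: dirichlet_form_def form_inner_def power2_eq_square)

lemma dirichlet_form_nonneg: "0 \<le> dirichlet_form E f f"
  by (simp add: dirichlet_form_self sum_nonneg)

lemma dirichlet_form_mono: "finite E' \<Longrightarrow> E \<subseteq> E' \<Longrightarrow> dirichlet_form E f f \<le> dirichlet_form E' f f"
  unfolding dirichlet_form_self by (rule sum_mono2) auto

lemma dirichlet_form_eq_0_iff: "finite E \<Longrightarrow> dirichlet_form E f f = 0 \<longleftrightarrow> (\<forall>e\<in>E. grad f e = 0)"
  by (simp add: dirichlet_form_self sum_nonneg_eq_0_iff)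

lemma dirichlet_pos_defI:
  assumes "finite E" "\<And>f. f \<in> real_forms A \<Longrightarrow> (\<forall>e\<in>E. grad f e = 0) \<Longrightarrow> f = (\<lambda>x. 0)"
  shows "dirichlet.pos_def E A"
  unfolding dirichlet.pos_def_def
  using assms dirichlet_form_nonneg[of E] dirichlet_form_eq_0_iff[OF assms(1)] by (metis less_eq_real_def)

text \<open>Edges that do not touch \<open>A\<close> are invisible to functions supported in \<open>A\<close>.\<close>

lemma dirichlet_form_touching:
  assumes "finite E'" "E \<subseteq> E'" "\<forall>(x, y)\<in>E' - E. x \<notin> A \<and> y \<notin> A" "f \<in> real_forms A"
  shows "dirichlet_form E' f f = dirichlet_form E f f"
  unfolding dirichlet_form_self
proof (rule sum.mono_neutral_right[OF assms(1,2)], rule ballI)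
  fix e assume "e \<in> E' - E"
  then have "fst e \<notin> A \<and> snd e \<notin> A" using bspec[OF assms(3), of e] by (simp add: case_prod_unfold)
  then show "(grad f e)\<^sup>2 = 0" using assms(4) by (simp add: grad_def real_forms_def)
qed

lemma discrete_gaussian_touching:
  assumes "finite E'" "E \<subseteq> E'" "\<forall>(x, y)\<in>E' - E. x \<notin> A \<and> y \<notin> A"
  shows "dirichlet.discrete_gaussian E' \<gamma> A = dirichlet.discrete_gaussian E \<gamma> A"
  unfolding dirichlet.discrete_gaussian_def
  by (intro infsum_cong) (simp only: dirichlet_form_touching[OF assms int_forms_real_forms])

lemma pos_def_touching:
  assumes "finite E'" "E \<subseteq> E'" "\<forall>(x, y)\<in>E' - E. x \<notin> A \<and> y \<notin> A"
  shows "dirichlet.pos_def E' A \<longleftrightarrow> dirichlet.pos_def E A"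
  unfolding dirichlet.pos_def_def using dirichlet_form_touching[OF assms] by metis

lemma pos_def_mono:
  assumes "finite E'" "E \<subseteq> E'" "dirichlet.pos_def E A"
  shows "dirichlet.pos_def E' A"
  using assms dirichlet_form_mono[OF assms(1,2)] unfolding dirichlet.pos_def_def by (meson less_le_trans)

lemma discrete_gaussian_antimono:
  assumes "finite A" "finite E'" "E \<subseteq> E'" "dirichlet.pos_def E A" "0 < \<gamma>"
  shows "dirichlet.discrete_gaussian E' \<gamma> A \<le> dirichlet.discrete_gaussian E \<gamma> A"
  unfolding dirichlet.discrete_gaussian_def
  using assms dirichlet_form_mono[OF assms(2,3)]
  by (intro infsum_mono dirichlet.summable_discrete_gaussian pos_def_mono[OF assms(2-4)]) auto

lemma discrete_gaussian_mono_set: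
  assumes "finite A'" "dirichlet.pos_def E A'" "0 < \<gamma>" "A \<subseteq> A'"
  shows "dirichlet.discrete_gaussian E \<gamma> A \<le> dirichlet.discrete_gaussian E \<gamma> A'"
  unfolding dirichlet.discrete_gaussian_def
proof (rule infsum_mono_neutral)
  show "(\<lambda>\<psi>. exp (- \<gamma> / 2 * dirichlet_form E \<psi> \<psi>)) summable_on int_forms A"
    using assms by (intro dirichlet.summable_discrete_gaussian) (auto intro: finite_subset dirichlet.pos_def_subset)
  show "(\<lambda>\<psi>. exp (- \<gamma> / 2 * dirichlet_form E \<psi> \<psi>)) summable_on int_forms A'"
    using assms by (intro dirichlet.summable_discrete_gaussian)
qed (use assms(4) in \<open>auto simp: int_forms_def real_forms_def\<close>)

lemma discrete_gaussian_superadditive: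
  assumes "finite (A1 \<union> A2)" "A1 \<inter> A2 = {}" "dirichlet.pos_def E (A1 \<union> A2)" "0 < \<gamma>"
  shows "dirichlet.discrete_gaussian E \<gamma> A1 * dirichlet.discrete_gaussian E \<gamma> A2
    \<le> dirichlet.discrete_gaussian E \<gamma> (A1 \<union> A2)"
  using dirichlet.sum_exp_superadditive[OF assms(2), of "\<gamma> / 2" E] dirichlet.summable_discrete_gaussian[OF assms(1,3,4)]
  by (simp add: dirichlet.discrete_gaussian_def)

lemma one_le_theta: "0 < \<gamma> \<Longrightarrow> 1 \<le> theta \<gamma>"
  unfolding theta_def
  using finite_sum_le_infsum[of "\<lambda>t::int. exp (- \<gamma> / 2 * (of_int t)\<^sup>2)" UNIV "{0}"] gaussian_summable_int[of \<gamma> 0] by simp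

text \<open>
  Keep the height \<open>t\<close> at \<open>v\<close> fixed and set aside the edge \<open>e\<close> to \<open>w\<close>, where the height is \<open>0\<close>; it
  contributes the Gaussian weight of \<open>t\<close>.  For the remaining edges \<open>t\<close> is a boundary value, which
  \<open>boundary_le\<close> removes.  The edge may be put back at the end because it does not touch \<open>A\<close>.
\<close>

lemma discrete_gaussian_insert_le:
  fixes E :: "('v \<times> 'v) set"
  assumes A: "finite A" "v \<notin> A" and E: "finite E" and pd: "dirichlet.pos_def E (insert v A)" and g: "0 < \<gamma>"
    and w: "w \<notin> insert v A" and e: "(v, w) \<in> E \<or> (w, v) \<in> E"
  shows "dirichlet.discrete_gaussian E \<gamma> (insert v A) \<le> theta \<gamma> * dirichlet.discrete_gaussian E \<gamma> A"
proof -
  obtain e where e: "e \<in> E" "e = (v, w) \<or> e = (w, v)" using e by blast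
  define E' where "E' = E - {e}"
  have E': "finite E'" "E' \<subseteq> E" using E by (auto simp: E'_def)
  have touch: "\<forall>(x, y)\<in>E - E'. x \<notin> A \<and> y \<notin> A"
    using e A w by (auto simp: E'_def)
  have pdA: "dirichlet.pos_def E A" using pd by (rule dirichlet.pos_def_subset) auto
  then have pd': "dirichlet.pos_def E' A" using pos_def_touching[OF E E'(2) touch] by simp
  define f where "f \<psi> = exp (- \<gamma> / 2 * dirichlet_form E \<psi> \<psi>)" for \<psi> :: "'v \<Rightarrow> real"
  define h where "h t = (\<lambda>x. of_int t * delta v x :: real)" for t :: int
  have split: "f (\<lambda>x. \<phi> x + of_int t * delta v x) =
      exp (- \<gamma> / 2 * (of_int t)\<^sup>2) * exp (- \<gamma> / 2 * dirichlet_form E' (\<lambda>x. \<phi> x + h t x) (\<lambda>x. \<phi> x + h t x))"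
    if "\<phi> \<in> int_forms A" for t \<phi>
  proof -
    have "\<phi> v = 0" "\<phi> w = 0" using that A w by (auto simp: int_forms_def real_forms_def)
    then have "(grad (\<lambda>x. \<phi> x + h t x) e)\<^sup>2 = (of_int t)\<^sup>2"
      using e(2) w by (auto simp: grad_def h_def delta_def)
    then have "dirichlet_form E (\<lambda>x. \<phi> x + h t x) (\<lambda>x. \<phi> x + h t x) =
        (of_int t)\<^sup>2 + dirichlet_form E' (\<lambda>x. \<phi> x + h t x) (\<lambda>x. \<phi> x + h t x)"
      unfolding dirichlet_form_self E'_def using E e(1) by (simp add: sum.remove)
    then show ?thesis unfolding f_def h_def by (simp add: algebra_simps flip: exp_add)
  qed
  have sf: "f summable_on int_forms (insert v A)"
    unfolding f_def using A pd g by (intro dirichlet.summable_discrete_gaussian) auto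
  note bij = bij_betw_int_forms_insert[OF A(2)]
  have fb: "f ((\<lambda>(t::int, \<phi>) x. \<phi> x + of_int t * delta v x) z) = (\<lambda>(t, \<phi>). f (\<lambda>x. \<phi> x + of_int t * delta v x)) z" for z
    by (cases z) simp
  have sf2: "(\<lambda>(t, \<phi>). f (\<lambda>x. \<phi> x + of_int t * delta v x)) summable_on (UNIV \<times> int_forms A)"
    using sf unfolding summable_on_reindex_bij_betw[OF bij, symmetric] fb .
  have le: "(\<Sum>\<^sub>\<infinity>\<phi>\<in>int_forms A. f (\<lambda>x. \<phi> x + of_int t * delta v x)) \<le>
      exp (- \<gamma> / 2 * (of_int t)\<^sup>2) * dirichlet.discrete_gaussian E \<gamma> A" for t
  proof -
    have "(\<Sum>\<^sub>\<infinity>\<phi>\<in>int_forms A. f (\<lambda>x. \<phi> x + of_int t * delta v x)) =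
      (\<Sum>\<^sub>\<infinity>\<phi>\<in>int_forms A. exp (- \<gamma> / 2 * (of_int t)\<^sup>2) * exp (- \<gamma> / 2 * dirichlet_form E' (\<lambda>x. \<phi> x + h t x) (\<lambda>x. \<phi> x + h t x)))"
      by (rule infsum_cong) (rule split)
    also have "\<dots> = exp (- \<gamma> / 2 * (of_int t)\<^sup>2) * (\<Sum>\<^sub>\<infinity>\<phi>\<in>int_forms A. exp (- \<gamma> / 2 * dirichlet_form E' (\<lambda>x. \<phi> x + h t x) (\<lambda>x. \<phi> x + h t x)))"
      by (rule infsum_cmult_right')
    also have "\<dots> \<le> exp (- \<gamma> / 2 * (of_int t)\<^sup>2) * dirichlet.discrete_gaussian E' \<gamma> A"
      using dirichlet.boundary_le[OF A(1) pd' g dirichlet_form_nonneg] by (intro mult_left_mono) auto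
    also have "dirichlet.discrete_gaussian E' \<gamma> A = dirichlet.discrete_gaussian E \<gamma> A"
      using discrete_gaussian_touching[OF E E'(2) touch] by simp
    finally show ?thesis .
  qed
  have st: "(\<lambda>t::int. exp (- \<gamma> / 2 * (of_int t)\<^sup>2)) summable_on UNIV"
    using gaussian_summable_int[OF g, of 0] by simp
  have "dirichlet.discrete_gaussian E \<gamma> (insert v A) = (\<Sum>\<^sub>\<infinity>z\<in>UNIV \<times> int_forms A. (\<lambda>(t, \<phi>). f (\<lambda>x. \<phi> x + of_int t * delta v x)) z)"
    unfolding dirichlet.discrete_gaussian_def f_def[symmetric] infsum_reindex_bij_betw[OF bij, symmetric] fb ..
  also have "\<dots> = (\<Sum>\<^sub>\<infinity>t. \<Sum>\<^sub>\<infinity>\<phi>\<in>int_forms A. f (\<lambda>x. \<phi> x + of_int t * delta v x))"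
    using infsum_Sigma_banach[OF sf2] by simp
  also have "\<dots> \<le> (\<Sum>\<^sub>\<infinity>t::int. exp (- \<gamma> / 2 * (of_int t)\<^sup>2) * dirichlet.discrete_gaussian E \<gamma> A)"
    using le summable_on_Sigma_banach[OF sf2] summable_on_cmult_left[OF st] by (intro infsum_mono)
  also have "\<dots> = theta \<gamma> * dirichlet.discrete_gaussian E \<gamma> A"
    unfolding theta_def by (rule infsum_cmult_left')
  finally show ?thesis .
qed

text \<open>
  The vertices of \<open>B - A\<close> are summed out in the order of decreasing \<open>rank\<close>: at the highest one
  left, a neighbour of higher rank outside \<open>A\<close> already has height \<open>0\<close>.
\<close>

lemma discrete_gaussian_peel:
  fixes rank :: "'v \<Rightarrow> int"
  assumes "finite B" "A \<subseteq> B" "finite E" "dirichlet.pos_def E B" "0 < \<gamma>"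
    and "\<And>v. v \<in> B - A \<Longrightarrow> \<exists>w. w \<notin> A \<and> rank v < rank w \<and> ((v, w) \<in> E \<or> (w, v) \<in> E)"
  shows "dirichlet.discrete_gaussian E \<gamma> B \<le> theta \<gamma> ^ card (B - A) * dirichlet.discrete_gaussian E \<gamma> A"
  using assms
proof (induction "card (B - A)" arbitrary: B)
  case 0
  then have "B = A" by auto
  then show ?case by simp
next
  case (Suc n)
  have ne: "B - A \<noteq> {}" "finite (B - A)" using Suc.hyps(2) Suc.prems(1) by (metis card.empty nat.distinct(1), simp)
  obtain v where v: "v \<in> B - A" "rank v = Max (rank ` (B - A))"
  proof -
    have "Max (rank ` (B - A)) \<in> rank ` (B - A)" using ne by (intro Max_in) auto
    then show ?thesis using that by (metis (no_types, lifting) imageE)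
  qed
  have vmax: "rank x \<le> rank v" if "x \<in> B - A" for x
    unfolding v(2) using ne that by (intro Max_ge) auto
  obtain w where w: "w \<notin> A" "rank v < rank w" "(v, w) \<in> E \<or> (w, v) \<in> E"
    using Suc.prems(6)[OF v(1)] by blast
  have wB: "w \<notin> B" using vmax[of w] w by auto
  have B: "insert v (B - {v}) = B" using v by auto
  have c: "card ((B - {v}) - A) = n"
  proof -
    have "(B - {v}) - A = (B - A) - {v}" by auto
    then show ?thesis using Suc.hyps(2) v(1) ne by simp
  qed
  have "dirichlet.discrete_gaussian E \<gamma> (insert v (B - {v})) \<le> theta \<gamma> * dirichlet.discrete_gaussian E \<gamma> (B - {v})"
    using Suc.prems w wB v by (intro discrete_gaussian_insert_le[where w = w]) (auto simp: B insert_absorb)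
  also have "dirichlet.discrete_gaussian E \<gamma> (B - {v}) \<le> theta \<gamma> ^ card ((B - {v}) - A) * dirichlet.discrete_gaussian E \<gamma> A"
  proof (rule Suc.hyps(1))
    show "dirichlet.pos_def E (B - {v})" using Suc.prems(4) by (rule dirichlet.pos_def_subset) auto
  qed (use Suc.prems v c in auto)
  finally show ?case
    using one_le_theta[OF Suc.prems(5)] v(1) by (simp add: c insert_absorb mult_left_mono mult.assoc flip: Suc.hyps(2))
qed

text \<open>
  Subtracting from a height function its value at the new marked vertex does not change the gradient.
\<close>

lemma discrete_gaussian_marked_vertex:
  fixes E :: "('v \<times> 'v) set"
  assumes E: "E \<subseteq> V \<times> V" and v: "v \<in> V" "w \<in> V"
  shows "dirichlet.discrete_gaussian E \<gamma> (V - {v}) = dirichlet.discrete_gaussian E \<gamma> (V - {w})"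
proof -
  define S where "S u \<psi> x = (if x \<in> V then \<psi> x - \<psi> u else 0)" for u and \<psi> :: "'v \<Rightarrow> real" and x
  have bij: "bij_betw (S w) (int_forms (V - {v})) (int_forms (V - {w}))"
    by (rule bij_betw_byWitness[where f' = "S v"])
       (use v in \<open>auto simp: S_def int_forms_def real_forms_def fun_eq_iff\<close>)
  have eq: "dirichlet_form E (S w \<psi>) (S w \<psi>) = dirichlet_form E \<psi> \<psi>" for \<psi>
    unfolding dirichlet_form_self by (rule sum.cong) (use E in \<open>auto simp: grad_def S_def\<close>)
  show ?thesis
    unfolding dirichlet.discrete_gaussian_def infsum_reindex_bij_betw[OF bij, symmetric] eq ..
qed

lemma theta_asymptotics:
  obtains K where "0 < K" "((\<lambda>\<gamma>. sqrt \<gamma> * theta \<gamma>) \<longlongrightarrow> K) (at_right 0)"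
proof -
  define B where "B f g = f () * (g () :: real)" for f g
  interpret quadratic_form B by standard (auto simp: B_def algebra_simps)
  have pd: "pos_def {()}" by (auto simp: pos_def_def B_def fun_eq_iff zero_less_mult_iff not_less_iff_gr_or_eq)
  have bij: "bij_betw (\<lambda>t::int. \<lambda>_::unit. real_of_int t) UNIV (int_forms {()})"
  proof (rule bij_betw_byWitness[where f' = "\<lambda>f. \<lfloor>f ()\<rfloor>"])
    show "\<forall>a'\<in>int_forms {()}. (\<lambda>_. real_of_int \<lfloor>a' ()\<rfloor>) = a'"
      by (auto simp: int_forms_def fun_eq_iff elim!: Ints_cases)
  qed (auto simp: int_forms_def real_forms_def)
  have dg: "discrete_gaussian \<gamma> {()} = theta \<gamma>" for \<gamma>
    unfolding discrete_gaussian_def theta_def infsum_reindex_bij_betw[OF bij, symmetric]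
    by (simp add: B_def power2_eq_square)
  show ?thesis
  proof (rule gaussian_const[OF _ pd])
    fix C assume "0 < C" and "((\<lambda>\<gamma>. sqrt \<gamma> ^ card {()} * discrete_gaussian \<gamma> {()}) \<longlongrightarrow> C) (at_right 0)"
    then show ?thesis using that[of C] by (simp add: dg)
  qed simp
qed

section \<open>Partition functions of a finite graph\<close>

lemma as_form_eq_extend_zero: "as_form V v0 = extend_zero (V - {v0})"
  by (auto simp: as_form_def extend_zero_def fun_eq_iff)

lemma zero_forms_eq: "zero_forms V v0 = real_forms (V - {v0})"
  by (auto simp: zero_forms_def real_forms_def)

lemma int_zero_forms_eq: "int_zero_forms V v0 = int_forms (V - {v0})"
  by (auto simp: int_zero_forms_def zero_forms_eq int_forms_def)

lemma int_one_forms_eq: "int_one_forms E = int_forms E"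
  by (auto simp: int_one_forms_def int_forms_def real_forms_def)

lemma Z_IV_eq: "Z_IV V E v0 \<gamma> = dirichlet.discrete_gaussian E \<gamma> (V - {v0})"
  by (simp add: Z_IV_def dirichlet.discrete_gaussian_def int_zero_forms_eq dirichlet_form_def)

lemma Z_GFF_eq: "Z_GFF V E v0 \<gamma> = (LINT \<phi>|(\<Pi>\<^sub>M x\<in>V - {v0}. lborel).
    exp (- \<gamma> / 2 * dirichlet_form E (extend_zero (V - {v0}) \<phi>) (extend_zero (V - {v0}) \<phi>)))"
  by (simp add: Z_GFF_def lebesgue_forms_def as_form_eq_extend_zero dirichlet_form_def)

text \<open>
  The polarised version of \<open>form_inner_neg_laplacian\<close>; the form on the left has to vanish at the marked
  vertex, where the Laplacian is set to \<open>0\<close>.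
\<close>

lemma form_inner_neg_laplacian_right:
  assumes V: "finite V" and E: "E \<subseteq> V \<times> V" "E \<inter> E\<inverse> = {}" and f: "f \<in> real_forms (V - {v0})"
  shows "form_inner V f (neg_laplacian V E v0 w) = dirichlet_form E f w"
proof -
  have fst_sum: "(\<Sum>x\<in>V. \<Sum>y\<in>{y \<in> V. (x, y) \<in> E}. F x y) = (\<Sum>(x, y)\<in>E. F x y)"
    for F :: "'a \<Rightarrow> 'a \<Rightarrow> real"
    using V E(1) by (subst sum.Sigma) (auto intro!: sum.cong)
  have snd_sum: "(\<Sum>x\<in>V. \<Sum>y\<in>{y \<in> V. (y, x) \<in> E}. F x y) = (\<Sum>(x, y)\<in>E. F y x)"
    for F :: "'a \<Rightarrow> 'a \<Rightarrow> real"
    using V E(1) by (subst sum.Sigma)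
      (auto intro!: sum.reindex_bij_witness[where i = "\<lambda>(x, y). (y, x)" and j = "\<lambda>(x, y). (y, x)"])
  have "f x * neg_laplacian V E v0 w x =
      (\<Sum>y\<in>{y \<in> V. (x, y) \<in> E}. f x * (w x - w y)) + (\<Sum>y\<in>{y \<in> V. (y, x) \<in> E}. f x * (w x - w y))"
    if "x \<in> V" for x
  proof -
    have "{y \<in> V. (x, y) \<in> E \<or> (y, x) \<in> E} = {y \<in> V. (x, y) \<in> E} \<union> {y \<in> V. (y, x) \<in> E}"
      by auto
    moreover have "{y \<in> V. (x, y) \<in> E} \<inter> {y \<in> V. (y, x) \<in> E} = {}"
      using E(2) by auto
    ultimately have "(\<Sum>y\<in>{y \<in> V. (x, y) \<in> E \<or> (y, x) \<in> E}. f x * (w x - w y)) =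
      (\<Sum>y\<in>{y \<in> V. (x, y) \<in> E}. f x * (w x - w y)) + (\<Sum>y\<in>{y \<in> V. (y, x) \<in> E}. f x * (w x - w y))"
      using V by (simp add: sum.union_disjoint)
    moreover have "f x * neg_laplacian V E v0 w x =
      (\<Sum>y\<in>{y \<in> V. (x, y) \<in> E \<or> (y, x) \<in> E}. f x * (w x - w y))"
      using f that by (cases "x = v0") (auto simp: neg_laplacian_def real_forms_def sum_distrib_left)
    ultimately show ?thesis by simp
  qed
  then have "form_inner V f (neg_laplacian V E v0 w) =
      (\<Sum>(x, y)\<in>E. f x * (w x - w y)) + (\<Sum>(x, y)\<in>E. f y * (w y - w x))"
    by (simp add: form_inner_def sum.distrib fst_sum snd_sum)
  also have "\<dots> = dirichlet_form E f w"
    by (auto simp: dirichlet_form_def form_inner_def grad_def sum.distrib[symmetric] algebra_simps intro!: sum.cong)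
  finally show ?thesis .
qed

lemma form_inner_remove: "finite V \<Longrightarrow> f \<in> real_forms (V - {v0}) \<Longrightarrow> form_inner V f g = form_inner (V - {v0}) f g"
  unfolding form_inner_def by (rule sum.mono_neutral_right) (auto simp: real_forms_def)

lemma inv_neg_laplacian_eq_green:
  assumes V: "finite V" and E: "E \<subseteq> V \<times> V" "E \<inter> E\<inverse> = {}" and pd: "dirichlet.pos_def E (V - {v0})"
    and q: "q \<in> real_forms (V - {v0})"
  shows "inv_neg_laplacian V E v0 q = dirichlet.green E (V - {v0}) q"
proof -
  let ?A = "V - {v0}" and ?L = "neg_laplacian V E v0"
  have L: "dirichlet.is_green E ?A (?L u) u" if "u \<in> real_forms ?A" for u
  proof -
    have "dirichlet_form E u \<phi> = form_inner ?A (?L u) \<phi>" if "\<phi> \<in> real_forms ?A" for \<phi>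
      using form_inner_neg_laplacian_right[OF V E that, of u] form_inner_remove[OF V that, of "?L u"]
      by (simp add: dirichlet.sym form_inner_commute)
    then show ?thesis using that by (simp add: dirichlet.is_green_def)
  qed
  have inj: "inj_on ?L (real_forms ?A)"
    using L dirichlet.is_green_unique[OF pd] by (metis inj_onI)
  define u where "u = dirichlet.green E ?A q"
  have u: "dirichlet.is_green E ?A q u" unfolding u_def using V pd by (intro dirichlet.green) auto
  then have uA: "u \<in> real_forms ?A" by (simp add: dirichlet.is_green_def)
  have "?L u x = q x" for x
  proof (cases "x \<in> ?A")
    case True
    then have d: "delta x \<in> real_forms ?A" by (rule real_forms_delta)
    have "form_inner ?A (?L u) (delta x) = form_inner ?A q (delta x)"
      using u L[OF uA] d by (simp add: dirichlet.is_green_def)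
    then show ?thesis using True V by (simp add: form_inner_delta)
  next
    case False
    then show ?thesis using q by (simp add: neg_laplacian_def[of V E v0 u x] real_forms_def del: Diff_iff)
  qed
  then have "?L u = q" by blast
  then show ?thesis
    unfolding inv_neg_laplacian_def zero_forms_eq u_def[symmetric] using inv_into_f_eq[OF inj uA] by simp
qed

lemma Z_Coul_eq:
  assumes V: "finite V" and E: "E \<subseteq> V \<times> V" "E \<inter> E\<inverse> = {}" and pd: "dirichlet.pos_def E (V - {v0})"
  shows "Z_Coul V E v0 \<beta> = (\<Sum>\<^sub>\<infinity>q\<in>int_forms (V - {v0}). exp (- (2 * pi\<^sup>2 * \<beta>) * dirichlet.coulomb E (V - {v0}) q))"
  unfolding Z_Coul_def int_zero_forms_eq
proof (rule infsum_cong)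
  fix q assume "q \<in> int_forms (V - {v0})"
  then have "q \<in> real_forms (V - {v0})" by (rule int_forms_real_forms)
  then show "exp (- ((2 * pi)\<^sup>2 * \<beta>) / 2 * form_inner V q (inv_neg_laplacian V E v0 q)) =
      exp (- (2 * pi\<^sup>2 * \<beta>) * dirichlet.coulomb E (V - {v0}) q)"
    using V by (simp add: inv_neg_laplacian_eq_green[OF V E pd] dirichlet.coulomb_def form_inner_remove power_mult_distrib)
qed

text \<open>
  The finite-volume identity behind the first equality of the theorem.  The limit at \<open>\<gamma> = 0\<close> is what
  later transfers inequalities from integer-valued to real-valued heights.
\<close>

lemma partition_functions:
  assumes V: "finite V" and E: "E \<subseteq> V \<times> V" "E \<inter> E\<inverse> = {}" and pd: "dirichlet.pos_def E (V - {v0})"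
  obtains C where "0 < C" "\<And>\<gamma>. 0 < \<gamma> \<Longrightarrow> Z_GFF V E v0 \<gamma> = C / sqrt \<gamma> ^ card (V - {v0})"
    "\<And>\<beta>. 0 < \<beta> \<Longrightarrow> Z_IV V E v0 (inverse \<beta>) = Z_GFF V E v0 (inverse \<beta>) * Z_Coul V E v0 \<beta>"
    "((\<lambda>\<gamma>. sqrt \<gamma> ^ card (V - {v0}) * Z_IV V E v0 \<gamma>) \<longlongrightarrow> C) (at_right 0)"
proof -
  have fin: "finite (V - {v0})" using V by simp
  obtain C where C: "0 < C"
    "\<And>\<gamma>. 0 < \<gamma> \<Longrightarrow> Z_GFF V E v0 \<gamma> = C / sqrt \<gamma> ^ card (V - {v0})"
    "\<And>\<gamma>. 0 < \<gamma> \<Longrightarrow> Z_IV V E v0 \<gamma> = C / sqrt \<gamma> ^ card (V - {v0}) * (\<Sum>\<^sub>\<infinity>q\<in>int_forms (V - {v0}). exp (- (2 * pi\<^sup>2 / \<gamma>) * dirichlet.coulomb E (V - {v0}) q))"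
    "((\<lambda>\<gamma>. sqrt \<gamma> ^ card (V - {v0}) * Z_IV V E v0 \<gamma>) \<longlongrightarrow> C) (at_right 0)"
    unfolding Z_GFF_eq Z_IV_eq using dirichlet.gaussian_const[OF fin pd] by blast
  moreover have "Z_IV V E v0 (inverse \<beta>) = Z_GFF V E v0 (inverse \<beta>) * Z_Coul V E v0 \<beta>" if "0 < \<beta>" for \<beta>
    using C(2,3)[of "inverse \<beta>"] that by (simp add: Z_Coul_eq[OF V E pd] divide_inverse)
  ultimately show ?thesis using that by blast
qed

declare split_paired_All [simp del] split_paired_Ex [simp del]

section \<open>The square lattice\<close>

type_synonym site = "int \<times> int"

text \<open>
  On forms supported in \<open>A\<close> these edges carry the whole energy on the infinite lattice, so that
  \<open>dirichlet_sum\<close> has zero boundary conditions.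
\<close>

definition lattice_edges :: "site set \<Rightarrow> (site \<times> site) set" where
  "lattice_edges A = {(x, y). (x \<in> A \<or> y \<in> A) \<and>
     (fst y = fst x + 1 \<and> snd y = snd x \<or> fst y = fst x \<and> snd y = snd x + 1)}"

lemma finite_lattice_edges:
  assumes "finite A"
  shows "finite (lattice_edges A)"
proof (rule finite_subset)
  let ?S = "\<lambda>x::site. {(x, (fst x + 1, snd x)), (x, (fst x, snd x + 1)), ((fst x - 1, snd x), x), ((fst x, snd x - 1), x)}"
  show "lattice_edges A \<subseteq> (\<Union>x\<in>A. ?S x)"
    by (auto simp: lattice_edges_def prod_eq_iff)
  show "finite (\<Union>x\<in>A. ?S x)" using assms by auto
qed

lemma lattice_edges_mono: "A \<subseteq> A' \<Longrightarrow> lattice_edges A \<subseteq> lattice_edges A'"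
  by (auto simp: lattice_edges_def)

lemma lattice_edges_touching: "\<forall>(x, y)\<in>lattice_edges A' - lattice_edges A. x \<notin> A \<and> y \<notin> A"
  by (auto simp: lattice_edges_def)

definition dirichlet_sum :: "real \<Rightarrow> site set \<Rightarrow> real" where
  "dirichlet_sum \<gamma> A = dirichlet.discrete_gaussian (lattice_edges A) \<gamma> A"

lemma pos_def_lattice_edges:
  assumes A: "finite A"
  shows "dirichlet.pos_def (lattice_edges A) A"
proof (rule dirichlet_pos_defI[OF finite_lattice_edges[OF A]])
  fix f :: "site \<Rightarrow> real" assume f: "f \<in> real_forms A" and g: "\<forall>e\<in>lattice_edges A. grad f e = 0"
  have "\<forall>x. f x = 0"
  proof (rule ccontr)
    assume "\<not> (\<forall>x. f x = 0)"
    define S where "S = {x \<in> A. f x \<noteq> 0}"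
    have S: "finite S" "S \<noteq> {}"
      using A f \<open>\<not> (\<forall>x. f x = 0)\<close> by (auto simp: S_def real_forms_def)
    have "Max (fst ` S) \<in> fst ` S" using S by (intro Max_in) auto
    then obtain x where x: "x \<in> S" "fst x = Max (fst ` S)" by (metis imageE)
    define y where "y = (fst x + 1, snd x)"
    have "(x, y) \<in> lattice_edges A" using x(1) by (auto simp: lattice_edges_def y_def S_def)
    then have "grad f (x, y) = 0" using g by blast
    then have "f y = f x" by (simp add: grad_def)
    then have "f y \<noteq> 0" using x(1) by (simp add: S_def)
    then have "y \<in> S" using f unfolding S_def real_forms_def by blast
    then have "fst y \<le> fst x" unfolding x(2) using S by (intro Max_ge) auto
    then show False by (simp add: y_def)
  qed
  then show "f = (\<lambda>x. 0)" by auto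
qed

lemma dirichlet_sum_eq:
  assumes "finite A'" "A \<subseteq> A'"
  shows "dirichlet.discrete_gaussian (lattice_edges A') \<gamma> A = dirichlet_sum \<gamma> A"
  unfolding dirichlet_sum_def
  by (rule discrete_gaussian_touching[OF finite_lattice_edges[OF assms(1)] lattice_edges_mono[OF assms(2)] lattice_edges_touching])

lemma dirichlet_sum_superadditive:
  assumes "finite A" "finite A'" "A \<inter> A' = {}" "0 < \<gamma>"
  shows "dirichlet_sum \<gamma> A * dirichlet_sum \<gamma> A' \<le> dirichlet_sum \<gamma> (A \<union> A')"
  using discrete_gaussian_superadditive[of A A' "lattice_edges (A \<union> A')" \<gamma>] assms
    dirichlet_sum_eq[of "A \<union> A'" A \<gamma>] dirichlet_sum_eq[of "A \<union> A'" A' \<gamma>] dirichlet_sum_eq[of "A \<union> A'" "A \<union> A'" \<gamma>]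
    pos_def_lattice_edges[of "A \<union> A'"] by auto

lemma dirichlet_sum_ge_1: "finite A \<Longrightarrow> 0 < \<gamma> \<Longrightarrow> 1 \<le> dirichlet_sum \<gamma> A"
  unfolding dirichlet_sum_def by (intro dirichlet.discrete_gaussian_ge_1 pos_def_lattice_edges)

lemma dirichlet_sum_mono:
  assumes "finite A'" "A \<subseteq> A'" "0 < \<gamma>"
  shows "dirichlet_sum \<gamma> A \<le> dirichlet_sum \<gamma> A'"
  using discrete_gaussian_mono_set[OF assms(1) pos_def_lattice_edges[OF assms(1)] assms(3,2)]
  unfolding dirichlet_sum_eq[OF assms(1,2)] dirichlet_sum_def .

text \<open>
  Every vertex is summed out against its right neighbour, starting from the right.
\<close>

lemma dirichlet_sum_le:
  assumes A: "finite A" and g: "0 < \<gamma>"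
  shows "dirichlet_sum \<gamma> A \<le> theta \<gamma> ^ card A"
proof -
  have "dirichlet_sum \<gamma> A \<le> theta \<gamma> ^ card (A - {}) * dirichlet.discrete_gaussian (lattice_edges A) \<gamma> {}"
    unfolding dirichlet_sum_def
  proof (rule discrete_gaussian_peel[where rank = fst])
    fix v assume "v \<in> A - {}"
    then show "\<exists>w. w \<notin> {} \<and> fst v < fst w \<and> ((v, w) \<in> lattice_edges A \<or> (w, v) \<in> lattice_edges A)"
      by (intro exI[of _ "(fst v + 1, snd v)"]) (auto simp: lattice_edges_def)
  qed (use A g in \<open>auto simp: finite_lattice_edges pos_def_lattice_edges\<close>)
  also have "dirichlet.discrete_gaussian (lattice_edges A) \<gamma> {} = 1"
    by (simp add: dirichlet.discrete_gaussian_def int_forms_empty dirichlet.zero_left)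
  finally show ?thesis by simp
qed

definition translate :: "site \<Rightarrow> site \<Rightarrow> site" where
  "translate t x = (fst x + fst t, snd x + snd t)"

lemma bij_translate: "bij (translate t)"
  by (rule bij_betw_byWitness[where f' = "translate (- fst t, - snd t)"]) (auto simp: translate_def)

lemma dirichlet_sum_translate:
  "dirichlet_sum \<gamma> (translate t ` A) = dirichlet_sum \<gamma> A"
proof -
  define u where "u = (- fst t, - snd t)"
  have tu: "translate t (translate u x) = x" "translate u (translate t x) = x" for x
    by (auto simp: translate_def u_def)
  have bij: "bij_betw (\<lambda>\<psi> x. \<psi> (translate t x)) (int_forms (translate t ` A)) (int_forms A)"
  proof (rule bij_betw_byWitness[where f' = "\<lambda>\<psi> x. \<psi> (translate u x)"])
    show "(\<lambda>\<psi> x. \<psi> (translate t x)) ` int_forms (translate t ` A) \<subseteq> int_forms A"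
    proof (rule image_subsetI)
      fix \<psi> assume p: "\<psi> \<in> int_forms (translate t ` A)"
      have "translate t x \<notin> translate t ` A" if "x \<notin> A" for x
        using that tu(2) by (metis imageE)
      then show "(\<lambda>x. \<psi> (translate t x)) \<in> int_forms A"
        using p unfolding int_forms_def real_forms_def by blast
    qed
    show "(\<lambda>\<psi> x. \<psi> (translate u x)) ` int_forms A \<subseteq> int_forms (translate t ` A)"
    proof (rule image_subsetI)
      fix \<psi> assume p: "\<psi> \<in> int_forms A"
      have "translate u x \<notin> A" if "x \<notin> translate t ` A" for x
        using that tu(1)[of x] by (metis imageI)
      then show "(\<lambda>x. \<psi> (translate u x)) \<in> int_forms (translate t ` A)"
        using p unfolding int_forms_def real_forms_def by blast
    qed
  qed (auto simp: tu)
  have eb: "bij_betw (map_prod (translate t) (translate t)) (lattice_edges A) (lattice_edges (translate t ` A))"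
  proof (rule bij_betw_byWitness[where f' = "map_prod (translate u) (translate u)"])
    show "map_prod (translate t) (translate t) ` lattice_edges A \<subseteq> lattice_edges (translate t ` A)"
      by (auto simp: lattice_edges_def translate_def image_iff) (metis fst_conv snd_conv)+
    show "map_prod (translate u) (translate u) ` lattice_edges (translate t ` A) \<subseteq> lattice_edges A"
      by (auto simp: lattice_edges_def translate_def u_def)
  qed (auto simp: tu)
  have "dirichlet_form (lattice_edges A) (\<lambda>x. \<psi> (translate t x)) (\<lambda>x. \<psi> (translate t x)) =
      dirichlet_form (lattice_edges (translate t ` A)) \<psi> \<psi>" for \<psi>
    unfolding dirichlet_form_self sum.reindex_bij_betw[OF eb, symmetric] by (simp add: grad_def)
  then show ?thesis
    unfolding dirichlet_sum_def dirichlet.discrete_gaussian_def infsum_reindex_bij_betw[OF bij, symmetric] by simp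
qed

lemma finite_lattice_box: "finite (lattice_box n)"
  by (simp add: lattice_box_def)

lemma card_lattice_box: "card (lattice_box n) = (2 * n + 1)\<^sup>2"
  by (simp add: lattice_box_def card_cartesian_product power2_eq_square) (simp add: nat_add_distrib nat_mult_distrib)

lemma box_edges_eq: "box_edges n = lattice_edges (lattice_box n) \<inter> lattice_box n \<times> lattice_box n"
  by (auto simp: box_edges_def lattice_edges_def)

lemma finite_box_edges: "finite (box_edges n)"
  by (simp add: box_edges_eq finite_lattice_box)

lemma box_edges_subset: "box_edges n \<subseteq> lattice_box n \<times> lattice_box n" "box_edges n \<inter> (box_edges n)\<inverse> = {}"
  by (auto simp: box_edges_def)

lemma lattice_edges_box_subset: "lattice_edges (lattice_box n) \<subseteq> box_edges (Suc n)"
  by (auto simp: box_edges_def lattice_edges_def lattice_box_def)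

lemma box_connected:
  fixes f :: "site \<Rightarrow> real"
  assumes g: "\<forall>e\<in>box_edges n. grad f e = 0" and x: "x \<in> lattice_box n"
  shows "f x = f (- int n, - int n)"
proof -
  have h: "f (a + 1, b) = f (a, b)" if "- int n \<le> a" "a < int n" "- int n \<le> b" "b \<le> int n" for a b
  proof -
    have "((a, b), (a + 1, b)) \<in> box_edges n" using that by (auto simp: box_edges_def lattice_box_def)
    then have "grad f ((a, b), (a + 1, b)) = 0" using g by blast
    then show ?thesis by (simp add: grad_def)
  qed
  have v: "f (a, b + 1) = f (a, b)" if "- int n \<le> a" "a \<le> int n" "- int n \<le> b" "b < int n" for a b
  proof -
    have "((a, b), (a, b + 1)) \<in> box_edges n" using that by (auto simp: box_edges_def lattice_box_def)
    then have "grad f ((a, b), (a, b + 1)) = 0" using g by blast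
    then show ?thesis by (simp add: grad_def)
  qed
  have 1: "a \<le> int n \<longrightarrow> f (a, b) = f (- int n, b)" if "- int n \<le> a" "- int n \<le> b" "b \<le> int n" for a b
    using that(1) by (induction a rule: int_ge_induct) (use h that in auto)
  have 2: "b \<le> int n \<longrightarrow> f (- int n, b) = f (- int n, - int n)" if "- int n \<le> b" for b
    using that by (induction b rule: int_ge_induct) (use v in auto)
  obtain a b where "x = (a, b)" by (cases x)
  then show ?thesis using 1[of a b] 2[of b] x by (auto simp: lattice_box_def)
qed

lemma pos_def_box:
  assumes v: "v \<in> lattice_box n"
  shows "dirichlet.pos_def (box_edges n) (lattice_box n - {v})"
proof (rule dirichlet_pos_defI[OF finite_box_edges])
  fix f assume f: "f \<in> real_forms (lattice_box n - {v})" and g: "\<forall>e\<in>box_edges n. grad f e = 0"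
  have "f v = 0" using f by (simp add: real_forms_def)
  have "f x = 0" for x
  proof (cases "x \<in> lattice_box n")
    case True
    then show ?thesis using box_connected[OF g True] box_connected[OF g v] \<open>f v = 0\<close> by simp
  next
    case False
    then show ?thesis using f by (simp add: real_forms_def)
  qed
  then show "f = (\<lambda>x. 0)" by auto
qed

text \<open>
  The marked vertex is moved to the upper right corner \<open>c\<close>.  Any other vertex of the outermost ring has
  a neighbour in the ring with a larger coordinate sum: the right one on the horizontal sides, the upper
  one on the vertical sides.  Peeling the ring in this order leaves zero boundary conditions on the next
  smaller box.
\<close>

lemma free_le_dirichlet:
  assumes v: "v \<in> lattice_box (Suc n)" and g: "0 < \<gamma>"
  shows "dirichlet.discrete_gaussian (box_edges (Suc n)) \<gamma> (lattice_box (Suc n) - {v})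
    \<le> theta \<gamma> ^ (8 * n + 7) * dirichlet_sum \<gamma> (lattice_box n)"
proof -
  define c :: site where "c = (int n + 1, int n + 1)"
  have c: "c \<in> lattice_box (Suc n)" by (auto simp: c_def lattice_box_def)
  have sub: "lattice_box n \<subseteq> lattice_box (Suc n) - {c}" by (auto simp: c_def lattice_box_def)
  have "dirichlet.discrete_gaussian (box_edges (Suc n)) \<gamma> (lattice_box (Suc n) - {v}) =
      dirichlet.discrete_gaussian (box_edges (Suc n)) \<gamma> (lattice_box (Suc n) - {c})"
    by (rule discrete_gaussian_marked_vertex[OF box_edges_subset(1) v c])
  also have "\<dots> \<le> theta \<gamma> ^ card (lattice_box (Suc n) - {c} - lattice_box n) * dirichlet.discrete_gaussian (box_edges (Suc n)) \<gamma> (lattice_box n)"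
  proof (rule discrete_gaussian_peel[where rank = "\<lambda>x. fst x + snd x"])
    fix x assume x: "x \<in> lattice_box (Suc n) - {c} - lattice_box n"
    define y where "y = (if snd x = int n + 1 \<or> snd x = - int n - 1 then (if fst x < int n + 1 then (fst x + 1, snd x) else (fst x, snd x + 1)) else (fst x, snd x + 1))"
    show "\<exists>w. w \<notin> lattice_box n \<and> fst x + snd x < fst w + snd w \<and> ((x, w) \<in> box_edges (Suc n) \<or> (w, x) \<in> box_edges (Suc n))"
      using x by (intro exI[of _ y], cases x) (auto simp: y_def lattice_box_def box_edges_def c_def)
  qed (use sub g in \<open>auto simp: finite_lattice_box finite_box_edges pos_def_box[OF c]\<close>)
  also have "card (lattice_box (Suc n) - {c} - lattice_box n) = 8 * n + 7"
  proof -
    have "card (lattice_box (Suc n) - {c} - lattice_box n) = card (lattice_box (Suc n)) - 1 - card (lattice_box n)"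
      using sub c finite_lattice_box by (simp add: card_Diff_subset)
    then show ?thesis by (simp add: card_lattice_box power2_eq_square algebra_simps)
  qed
  also have "dirichlet.discrete_gaussian (box_edges (Suc n)) \<gamma> (lattice_box n) = dirichlet_sum \<gamma> (lattice_box n)"
    unfolding dirichlet_sum_def
    by (rule discrete_gaussian_touching[OF finite_box_edges lattice_edges_box_subset]) (auto simp: box_edges_def lattice_edges_def)
  finally show ?thesis .
qed

text \<open>
  Here only one vertex has to be summed out, against a vertex outside the box, and then the edges leaving
  the box can be dropped.
\<close>

lemma dirichlet_le_free:
  assumes v: "v \<in> lattice_box n" and g: "0 < \<gamma>"
  shows "dirichlet_sum \<gamma> (lattice_box n) \<le> theta \<gamma> * dirichlet.discrete_gaussian (box_edges n) \<gamma> (lattice_box n - {v})"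
proof -
  define c :: site where "c = (int n, int n)"
  define A where "A = lattice_box n - {c}"
  have c: "c \<in> lattice_box n" by (auto simp: c_def lattice_box_def)
  have ins: "insert c A = lattice_box n" using c by (auto simp: A_def)
  have "dirichlet_sum \<gamma> (insert c A) \<le> theta \<gamma> * dirichlet.discrete_gaussian (lattice_edges (insert c A)) \<gamma> A"
    unfolding dirichlet_sum_def
  proof (rule discrete_gaussian_insert_le[where w = "(int n + 1, int n)"])
    show "(int n + 1, int n) \<notin> insert c A" unfolding ins by (auto simp: lattice_box_def)
    show "(c, int n + 1, int n) \<in> lattice_edges (insert c A) \<or> ((int n + 1, int n), c) \<in> lattice_edges (insert c A)"
      by (auto simp: lattice_edges_def c_def)
  qed (use g in \<open>auto simp: A_def finite_lattice_box finite_lattice_edges pos_def_lattice_edges\<close>)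
  also have "dirichlet.discrete_gaussian (lattice_edges (insert c A)) \<gamma> A \<le> dirichlet.discrete_gaussian (box_edges n) \<gamma> A"
    unfolding ins
    using pos_def_box[OF c] g finite_lattice_box
    by (intro discrete_gaussian_antimono finite_lattice_edges) (auto simp: A_def box_edges_eq)
  also have "\<dots> = dirichlet.discrete_gaussian (box_edges n) \<gamma> (lattice_box n - {v})"
    unfolding A_def by (rule discrete_gaussian_marked_vertex[OF box_edges_subset(1) c v])
  finally show ?thesis using one_le_theta[OF g] by (simp add: ins mult_left_mono)
qed

section \<open>Existence of the limits\<close>

lemma superadditive_UNION:
  fixes g :: "'a set \<Rightarrow> real"
  assumes sup: "\<And>A A'. finite A \<Longrightarrow> finite A' \<Longrightarrow> A \<inter> A' = {} \<Longrightarrow> g A + g A' \<le> g (A \<union> A')"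
    and g0: "g {} = 0" and P: "finite P" and fin: "\<And>p. p \<in> P \<Longrightarrow> finite (T p)"
    and dis: "\<And>p q. p \<in> P \<Longrightarrow> q \<in> P \<Longrightarrow> p \<noteq> q \<Longrightarrow> T p \<inter> T q = {}"
  shows "(\<Sum>p\<in>P. g (T p)) \<le> g (\<Union>p\<in>P. T p)"
  using P fin dis
proof (induction P)
  case (insert p P)
  have "T p \<inter> (\<Union>p\<in>P. T p) = {}"
  proof -
    have "T p \<inter> T q = {}" if "q \<in> P" for q using insert.prems(2)[of p q] insert.hyps(2) that by auto
    then show ?thesis by blast
  qed
  then have "g (T p) + g (\<Union>p\<in>P. T p) \<le> g (T p \<union> (\<Union>p\<in>P. T p))"
    using insert.hyps insert.prems by (intro sup) auto
  moreover have "(\<Sum>p\<in>P. g (T p)) \<le> g (\<Union>p\<in>P. T p)"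
    using insert.prems by (intro insert.IH) auto
  ultimately show ?case using insert.hyps by simp
qed (simp add: g0)

lemma translated_box_eq:
  fixes i :: int and m N :: nat
  shows "translate (- int N + int m + (2 * int m + 1) * i, - int N + int m + (2 * int m + 1) * j) ` lattice_box m =
     {- int N + (2 * int m + 1) * i..- int N + (2 * int m + 1) * i + 2 * int m} \<times> {- int N + (2 * int m + 1) * j..- int N + (2 * int m + 1) * j + 2 * int m}"
proof (intro equalityI subsetI)
  fix x :: site
  define u where "u = (- int N + int m + (2 * int m + 1) * i, - int N + int m + (2 * int m + 1) * j)"
  assume x: "x \<in> {- int N + (2 * int m + 1) * i..- int N + (2 * int m + 1) * i + 2 * int m} \<times> {- int N + (2 * int m + 1) * j..- int N + (2 * int m + 1) * j + 2 * int m}"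
  have "x = translate u (fst x - fst u, snd x - snd u)" by (simp add: translate_def)
  moreover have "(fst x - fst u, snd x - snd u) \<in> lattice_box m"
    using x by (auto simp: lattice_box_def u_def)
  ultimately show "x \<in> translate (- int N + int m + (2 * int m + 1) * i, - int N + int m + (2 * int m + 1) * j) ` lattice_box m"
    unfolding u_def by (rule image_eqI)
qed (auto simp: translate_def lattice_box_def)

text \<open>
  The larger box contains \<open>k\<^sup>2\<close> disjoint translates of the smaller one, where \<open>k\<close> is the quotient of
  the side lengths.
\<close>

lemma superadditive_box:
  fixes g :: "site set \<Rightarrow> real"
  assumes sup: "\<And>A A'. finite A \<Longrightarrow> finite A' \<Longrightarrow> A \<inter> A' = {} \<Longrightarrow> g A + g A' \<le> g (A \<union> A')"
    and g0: "g {} = 0" and trans: "\<And>A t. finite A \<Longrightarrow> g (translate t ` A) = g A"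
    and nonneg: "\<And>A. finite A \<Longrightarrow> 0 \<le> g A" and N: "m \<le> N"
  shows "g (lattice_box m) / (2 * real m + 1)\<^sup>2 * ((2 * real N - 2 * real m) / (2 * real N + 1))\<^sup>2 \<le> g (lattice_box N) / (2 * real N + 1)\<^sup>2"
proof -
  define M where "M = 2 * int m + 1"
  define k where "k = (2 * int N + 1) div M"
  define P where "P = {0..<k} \<times> {0..<k}"
  define t where "t p = (- int N + int m + M * fst p, - int N + int m + M * snd p)" for p
  define T where "T p = translate (t p) ` lattice_box m" for p
  have M: "0 < M" by (simp add: M_def)
  have T: "T p = {- int N + M * fst p..- int N + M * fst p + 2 * int m} \<times> {- int N + M * snd p..- int N + M * snd p + 2 * int m}" for p
    unfolding T_def t_def M_def by (rule translated_box_eq)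
  have finT: "finite (T p)" for p by (simp add: T)
  have dis: "T p \<inter> T q = {}" if "p \<noteq> q" for p q
  proof (rule ccontr)
    assume "T p \<inter> T q \<noteq> {}"
    then obtain x where x: "x \<in> T p" "x \<in> T q" by blast
    have idx: "(fst y + int N) div M = fst p \<and> (snd y + int N) div M = snd p" if "y \<in> T p" for y p
    proof
      have "fst y + int N = M * fst p + (fst y + int N - M * fst p)" "0 \<le> fst y + int N - M * fst p" "fst y + int N - M * fst p < M"
        using that by (auto simp: T M_def)
      then show "(fst y + int N) div M = fst p" by (metis M div_mult_self4 div_pos_pos_trivial add.right_neutral less_irrefl add.commute)
      have "snd y + int N = M * snd p + (snd y + int N - M * snd p)" "0 \<le> snd y + int N - M * snd p" "snd y + int N - M * snd p < M"
        using that by (auto simp: T M_def)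
      then show "(snd y + int N) div M = snd p" by (metis M div_mult_self4 div_pos_pos_trivial add.right_neutral less_irrefl add.commute)
    qed
    show False using idx[OF x(1)] idx[OF x(2)] that by (auto simp: prod_eq_iff)
  qed
  have kM: "k * M \<le> 2 * int N + 1" "2 * int N + 1 < (k + 1) * M"
  proof -
    have "2 * int N + 1 = k * M + (2 * int N + 1) mod M" by (simp add: k_def)
    moreover have "0 \<le> (2 * int N + 1) mod M" "(2 * int N + 1) mod M < M" using M by auto
    ultimately show "k * M \<le> 2 * int N + 1" "2 * int N + 1 < (k + 1) * M" by (auto simp: algebra_simps)
  qed
  have k0: "0 \<le> k" using M by (simp add: k_def pos_imp_zdiv_nonneg_iff)
  have sub: "(\<Union>p\<in>P. T p) \<subseteq> lattice_box N"
  proof (rule UN_least)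
    fix p assume p: "p \<in> P"
    have b: "0 \<le> M * i" "M * i + 2 * int m \<le> 2 * int N" if "0 \<le> i" "i < k" for i
    proof -
      show "0 \<le> M * i" using M that by simp
      have "M * (i + 1) \<le> M * k" using M that by (intro mult_left_mono) auto
      then show "M * i + 2 * int m \<le> 2 * int N" using kM(1) by (simp add: M_def algebra_simps)
    qed
    show "T p \<subseteq> lattice_box N"
      using p b[of "fst p"] b[of "snd p"] by (auto simp: T P_def lattice_box_def)
  qed
  have gT: "g (T p) = g (lattice_box m)" for p unfolding T_def by (rule trans[OF finite_lattice_box])
  have finP: "finite P" by (simp add: P_def)
  have finU: "finite (\<Union>p\<in>P. T p)" using finP finT by blast
  have "(k * k) * g (lattice_box m) = (\<Sum>p\<in>P. g (T p))"
    using k0 by (simp add: gT P_def card_cartesian_product)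
  also have "\<dots> \<le> g (\<Union>p\<in>P. T p)"
    by (rule superadditive_UNION[OF sup g0 finP finT dis])
  also have "\<dots> \<le> g (\<Union>p\<in>P. T p) + g (lattice_box N - (\<Union>p\<in>P. T p))"
    using nonneg finite_lattice_box by simp
  also have "\<dots> \<le> g ((\<Union>p\<in>P. T p) \<union> (lattice_box N - (\<Union>p\<in>P. T p)))"
    using finU finite_lattice_box by (intro sup) auto
  also have "(\<Union>p\<in>P. T p) \<union> (lattice_box N - (\<Union>p\<in>P. T p)) = lattice_box N" using sub by auto
  finally have main: "(real_of_int k)\<^sup>2 * g (lattice_box m) \<le> g (lattice_box N)" by (simp add: power2_eq_square)
  define M' where "M' = 2 * real m + 1"
  define N' where "N' = 2 * real N + 1"
  have MM: "M' = real_of_int M" by (simp add: M'_def M_def)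
  have pos: "0 < M'" "0 < N'" by (simp_all add: M'_def N'_def)
  have "2 * real N - 2 * real m \<le> real_of_int k * M'"
  proof -
    have "2 * int N - 2 * int m \<le> k * M" using kM(2) by (simp add: M_def algebra_simps)
    then have "real_of_int (2 * int N - 2 * int m) \<le> real_of_int (k * M)" by (simp only: of_int_le_iff)
    then show ?thesis by (simp add: MM)
  qed
  then have "(2 * real N - 2 * real m)\<^sup>2 \<le> (real_of_int k * M')\<^sup>2"
    using N by (intro power_mono) auto
  then have "g (lattice_box m) * (2 * real N - 2 * real m)\<^sup>2 \<le> g (lattice_box m) * (real_of_int k * M')\<^sup>2"
    using nonneg[OF finite_lattice_box] by (intro mult_left_mono) auto
  also have "\<dots> \<le> g (lattice_box N) * M'\<^sup>2"
    using mult_right_mono[OF main, of "M'\<^sup>2"] by (simp add: power_mult_distrib mult_ac)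
  finally show ?thesis
    using pos unfolding M'_def[symmetric] N'_def[symmetric] by (simp add: power_divide divide_simps)
qed

text \<open>
  Fekete's argument for \<open>g\<close>, the logarithm of a partition function with zero boundary conditions.
  Subtracting the value at a single vertex, once per vertex, makes \<open>g\<close> nonnegative, so that the part of
  a large box which is not covered by translates of a small one can be ignored.  The quantity \<open>f\<close>, with
  free boundary conditions, differs from \<open>g\<close> only by the order of the boundary.
\<close>

lemma box_limit:
  fixes g :: "site set \<Rightarrow> real" and f :: "nat \<Rightarrow> real" and K :: real
  assumes sup: "\<And>A A'. finite A \<Longrightarrow> finite A' \<Longrightarrow> A \<inter> A' = {} \<Longrightarrow> g A + g A' \<le> g (A \<union> A')"
    and g0: "g {} = 0" and trans: "\<And>A t. finite A \<Longrightarrow> g (translate t ` A) = g A"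
    and upper: "\<And>A. finite A \<Longrightarrow> g A \<le> K * real (card A)"
    and f1: "\<And>n. f (Suc n) \<le> g (lattice_box n) + (8 * real n + 7) * K"
    and f2: "\<And>n. g (lattice_box n) \<le> K + f n"
  obtains l where "(\<lambda>n. g (lattice_box n) / real (card (lattice_box n))) \<longlonglongrightarrow> l"
    "(\<lambda>n. f n / real (card (lattice_box n))) \<longlonglongrightarrow> l"
proof -
  define c where "c = g {(0, 0)}"
  have sing: "g {x} = c" for x
    using trans[of "{(0, 0)}" x] by (simp add: translate_def c_def)
  define h where "h A = g A - c * real (card A)" for A
  have hsup: "h A + h A' \<le> h (A \<union> A')" if "finite A" "finite A'" "A \<inter> A' = {}" for A A'
    using sup[OF that] that by (simp add: h_def card_Un_disjoint algebra_simps)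
  have h0: "h {} = 0" by (simp add: h_def g0)
  have htrans: "h (translate t ` A) = h A" if "finite A" for A t
    using trans[OF that] card_image[OF inj_on_subset[OF bij_is_inj[OF bij_translate]], of A t] by (simp add: h_def)
  have hnonneg: "0 \<le> h A" if "finite A" for A
    using that
  proof induction
    case (insert x A)
    have "h {x} + h A \<le> h ({x} \<union> A)" using insert by (intro hsup) auto
    then show ?case using insert by (simp add: h_def sing)
  qed (simp add: h0)
  define V where "V n = (2 * real n + 1)\<^sup>2" for n
  have Vpos: "0 < V n" for n by (simp add: V_def)
  have card: "real (card (lattice_box n)) = V n" for n by (simp add: card_lattice_box V_def)
  define a where "a n = h (lattice_box n) / V n" for n
  have ale: "a n \<le> K - c" for n
  proof -
    have "h (lattice_box n) \<le> (K - c) * V n"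
      using upper[OF finite_lattice_box, of n] by (simp add: h_def card algebra_simps)
    then show ?thesis using Vpos[of n] by (simp add: a_def pos_divide_le_eq)
  qed
  have bdd: "bdd_above (range a)" using ale by (auto intro!: bdd_aboveI2)
  define s where "s = (SUP n. a n)"
  have as: "a n \<le> s" for n unfolding s_def by (rule cSUP_upper[OF _ bdd]) simp
  have sb: "a m * ((2 * real N - 2 * real m) / (2 * real N + 1))\<^sup>2 \<le> a N" if "m \<le> N" for m N
    unfolding a_def V_def
    by (rule superadditive_box[where g = h, OF _ h0 _ _ that]) (erule hsup htrans hnonneg; assumption)+
  have alim: "a \<longlonglongrightarrow> s"
  proof (rule order_tendstoI)
    fix y assume "s < y"
    then show "\<forall>\<^sub>F n in sequentially. a n < y" using as by (intro always_eventually allI) (metis le_less_trans)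
  next
    fix y assume "y < s"
    then obtain m where m: "y < a m" unfolding s_def using less_cSUP_iff[OF _ bdd] by auto
    have "(\<lambda>N. ((2 * real N - 2 * real m) / (2 * real N + 1))\<^sup>2) \<longlonglongrightarrow> 1" by real_asymp
    then have "(\<lambda>N. a m * ((2 * real N - 2 * real m) / (2 * real N + 1))\<^sup>2) \<longlonglongrightarrow> a m * 1"
      by (intro tendsto_intros)
    then have "\<forall>\<^sub>F N in sequentially. y < a m * ((2 * real N - 2 * real m) / (2 * real N + 1))\<^sup>2"
      using m by (simp add: order_tendsto_iff)
    then show "\<forall>\<^sub>F N in sequentially. y < a N"
      using eventually_ge_at_top[of m]
    proof eventually_elim
      case (elim N)
      then show ?case
        using sb[OF elim(2)] by simp
    qed
  qed
  define l where "l = s + c"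
  have gl: "g (lattice_box n) / V n = a n + c" for n
    using Vpos[of n] by (simp add: a_def h_def card diff_divide_distrib)
  have glim: "(\<lambda>n. g (lattice_box n) / V n) \<longlonglongrightarrow> l"
    unfolding gl l_def by (intro tendsto_intros alim)
  have "(\<lambda>n. f (Suc n) / V (Suc n)) \<longlonglongrightarrow> l"
  proof (rule tendsto_sandwich)
    show "\<forall>\<^sub>F n in sequentially. g (lattice_box (Suc n)) / V (Suc n) - K / V (Suc n) \<le> f (Suc n) / V (Suc n)"
    proof (intro always_eventually allI)
      fix n
      have "(g (lattice_box (Suc n)) - K) / V (Suc n) \<le> f (Suc n) / V (Suc n)"
        using f2[of "Suc n"] Vpos[of "Suc n"] by (intro divide_right_mono) auto
      then show "g (lattice_box (Suc n)) / V (Suc n) - K / V (Suc n) \<le> f (Suc n) / V (Suc n)"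
        by (simp add: diff_divide_distrib)
    qed
    show "\<forall>\<^sub>F n in sequentially. f (Suc n) / V (Suc n) \<le> (g (lattice_box n) / V n) * (V n / V (Suc n)) + (8 * real n + 7) * K / V (Suc n)"
    proof (intro always_eventually allI)
      fix n
      have "f (Suc n) / V (Suc n) \<le> (g (lattice_box n) + (8 * real n + 7) * K) / V (Suc n)"
        using f1[of n] Vpos[of "Suc n"] by (intro divide_right_mono) auto
      then show "f (Suc n) / V (Suc n) \<le> (g (lattice_box n) / V n) * (V n / V (Suc n)) + (8 * real n + 7) * K / V (Suc n)"
        using Vpos[of n] by (simp add: add_divide_distrib)
    qed
    have k1: "(\<lambda>n. K / V (Suc n)) \<longlonglongrightarrow> 0" unfolding V_def by real_asymp
    show "(\<lambda>n. g (lattice_box (Suc n)) / V (Suc n) - K / V (Suc n)) \<longlonglongrightarrow> l"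
      using tendsto_diff[OF LIMSEQ_Suc[OF glim] k1] by simp
    have k2: "(\<lambda>n. V n / V (Suc n)) \<longlonglongrightarrow> 1" unfolding V_def by real_asymp
    have k3: "(\<lambda>n. (8 * real n + 7) * K / V (Suc n)) \<longlonglongrightarrow> 0" unfolding V_def by real_asymp
    show "(\<lambda>n. (g (lattice_box n) / V n) * (V n / V (Suc n)) + (8 * real n + 7) * K / V (Suc n)) \<longlonglongrightarrow> l"
      using tendsto_add[OF tendsto_mult[OF glim k2] k3] by simp
  qed
  then have "(\<lambda>n. f n / V n) \<longlonglongrightarrow> l" by (rule LIMSEQ_imp_Suc)
  then show ?thesis using that glim by (simp add: card)
qed

lemma IV_box_limit:
  assumes v: "\<And>n. v0 n \<in> lattice_box n" and g: "0 < \<gamma>"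
  obtains l where "(\<lambda>n. ln (dirichlet_sum \<gamma> (lattice_box n)) / real (card (lattice_box n))) \<longlonglongrightarrow> l"
    "box_free_energy Z_IV v0 \<gamma> \<longlonglongrightarrow> l"
proof -
  define f where "f n = ln (Z_IV (lattice_box n) (box_edges n) (v0 n) \<gamma>)" for n
  define G where "G A = ln (dirichlet_sum \<gamma> A)" for A
  have th: "0 < theta \<gamma>" using one_le_theta[OF g] by simp
  have D: "0 < dirichlet_sum \<gamma> A" if "finite A" for A using dirichlet_sum_ge_1[OF that g] by simp
  have F: "0 < Z_IV (lattice_box n) (box_edges n) (v0 n) \<gamma>" for n
    unfolding Z_IV_eq using dirichlet.discrete_gaussian_ge_1[OF _ pos_def_box[OF v] g, of n] finite_lattice_box by (simp add: less_le_trans[OF zero_less_one])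
  show ?thesis
  proof (rule box_limit[where g = G and f = f and K = "ln (theta \<gamma>)"])
    show "G A + G A' \<le> G (A \<union> A')" if "finite A" "finite A'" "A \<inter> A' = {}" for A A'
      using dirichlet_sum_superadditive[OF that g] D that unfolding G_def by (subst ln_mult_pos[symmetric]) (auto intro!: ln_mono)
    show "G {} = 0" by (simp add: G_def dirichlet_sum_def dirichlet.discrete_gaussian_def int_forms_empty dirichlet.zero_left)
    show "G (translate t ` A) = G A" for A t by (simp add: G_def dirichlet_sum_translate)
    show "G A \<le> ln (theta \<gamma>) * real (card A)" if "finite A" for A
    proof -
      have "G A \<le> ln (theta \<gamma> ^ card A)" unfolding G_def using dirichlet_sum_le[OF that g] D[OF that] by (intro ln_mono) auto
      then show ?thesis using th by (simp add: ln_realpow mult.commute)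
    qed
    show "f (Suc n) \<le> G (lattice_box n) + (8 * real n + 7) * ln (theta \<gamma>)" for n
    proof -
      have "f (Suc n) \<le> ln (theta \<gamma> ^ (8 * n + 7) * dirichlet_sum \<gamma> (lattice_box n))"
        unfolding f_def using free_le_dirichlet[OF v g] F[of "Suc n"] by (intro ln_mono) (auto simp: Z_IV_eq)
      also have "\<dots> = (8 * real n + 7) * ln (theta \<gamma>) + G (lattice_box n)"
        using th D[OF finite_lattice_box] by (simp add: ln_mult_pos ln_realpow G_def)
      finally show ?thesis by simp
    qed
    show "G (lattice_box n) \<le> ln (theta \<gamma>) + f n" for n
      using dirichlet_le_free[OF v g, of n] D[OF finite_lattice_box] F[of n] th unfolding G_def f_def Z_IV_eq
      by (subst ln_mult_pos[symmetric]) (auto intro!: ln_mono)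
    fix l assume "(\<lambda>n. G (lattice_box n) / real (card (lattice_box n))) \<longlonglongrightarrow> l" "(\<lambda>n. f n / real (card (lattice_box n))) \<longlonglongrightarrow> l"
    then show ?thesis using that unfolding G_def f_def box_free_energy_def[abs_def] by blast
  qed
qed

lemmas box_partition_functions = partition_functions[OF finite_lattice_box box_edges_subset pos_def_box]

text \<open>
  Each of the inequalities for integer-valued heights is homogeneous: after multiplication by
  \<open>sqrt \<gamma>\<close> for every vertex both sides converge as \<open>\<gamma>\<close> tends to \<open>0\<close>, and the limits are Gaussian
  integrals.  So the hypotheses of \<open>box_limit\<close> hold for the Gaussian free field as well.
\<close>

lemma GFF_box_limit:
  assumes v: "\<And>n. v0 n \<in> lattice_box n"
  obtains l where "\<And>\<gamma>. 0 < \<gamma> \<Longrightarrow> box_free_energy Z_GFF v0 \<gamma> \<longlonglongrightarrow> l - ln \<gamma> / 2"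
proof -
  let ?Z = "\<lambda>n. Z_IV (lattice_box n) (box_edges n) (v0 n)"
  define N where "N n = card (lattice_box n - {v0 n})" for n
  have N: "N n = (2 * n + 1)\<^sup>2 - 1" for n
    using v[of n] finite_lattice_box by (simp add: N_def card_lattice_box)
  have "\<exists>C. 0 < C \<and> (\<forall>\<gamma>>0. Z_GFF (lattice_box n) (box_edges n) (v0 n) \<gamma> = C / sqrt \<gamma> ^ N n) \<and>
     ((\<lambda>\<gamma>. sqrt \<gamma> ^ N n * ?Z n \<gamma>) \<longlongrightarrow> C) (at_right 0)" for n
    unfolding N_def by (rule box_partition_functions[OF v[of n]]) blast
  then obtain F where F: "\<And>n. 0 < F n" "\<And>n \<gamma>. 0 < \<gamma> \<Longrightarrow> Z_GFF (lattice_box n) (box_edges n) (v0 n) \<gamma> = F n / sqrt \<gamma> ^ N n"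
     "\<And>n. ((\<lambda>\<gamma>. sqrt \<gamma> ^ N n * ?Z n \<gamma>) \<longlongrightarrow> F n) (at_right 0)"
    by metis
  have "\<exists>C. finite A \<longrightarrow> 0 < C \<and> ((\<lambda>\<gamma>. sqrt \<gamma> ^ card A * dirichlet_sum \<gamma> A) \<longlongrightarrow> C) (at_right 0)" for A
  proof (cases "finite A")
    case True
    show ?thesis
      unfolding dirichlet_sum_def
      by (rule dirichlet.gaussian_const[OF True pos_def_lattice_edges[OF True]]) blast
  qed simp
  then obtain D where D: "\<And>A. finite A \<Longrightarrow> 0 < D A" "\<And>A. finite A \<Longrightarrow> ((\<lambda>\<gamma>. sqrt \<gamma> ^ card A * dirichlet_sum \<gamma> A) \<longlongrightarrow> D A) (at_right 0)"
    by metis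
  obtain K where K: "0 < K" "((\<lambda>\<gamma>. sqrt \<gamma> * theta \<gamma>) \<longlongrightarrow> K) (at_right 0)" using theta_asymptotics by blast
  have le: "x \<le> y" if "(a \<longlongrightarrow> x) (at_right 0)" "(b \<longlongrightarrow> y) (at_right 0)" "\<And>\<gamma>. 0 < \<gamma> \<Longrightarrow> a \<gamma> \<le> b \<gamma>" for a b :: "real \<Rightarrow> real" and x y
  proof (rule tendsto_le[OF _ that(2,1)])
    show "\<forall>\<^sub>F \<gamma> in at_right 0. a \<gamma> \<le> b \<gamma>"
      using eventually_at_right_less[of 0] by eventually_elim (rule that(3))
  qed simp
  show ?thesis
  proof (rule box_limit[where g = "\<lambda>A. ln (D A)" and f = "\<lambda>n. ln (F n)" and K = "ln K"])
    show "ln (D A) + ln (D A') \<le> ln (D (A \<union> A'))" if "finite A" "finite A'" "A \<inter> A' = {}" for A A'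
    proof -
      have "D A * D A' \<le> D (A \<union> A')"
      proof (rule le[OF tendsto_mult[OF D(2)[OF that(1)] D(2)[OF that(2)]] D(2)[of "A \<union> A'"]])
        fix \<gamma> :: real assume g: "0 < \<gamma>"
        have "sqrt \<gamma> ^ card A * dirichlet_sum \<gamma> A * (sqrt \<gamma> ^ card A' * dirichlet_sum \<gamma> A') =
           sqrt \<gamma> ^ card (A \<union> A') * (dirichlet_sum \<gamma> A * dirichlet_sum \<gamma> A')"
          using that by (simp add: card_Un_disjoint power_add)
        also have "\<dots> \<le> sqrt \<gamma> ^ card (A \<union> A') * dirichlet_sum \<gamma> (A \<union> A')"
          using g dirichlet_sum_superadditive[OF that g] by (intro mult_left_mono) auto
        finally show "sqrt \<gamma> ^ card A * dirichlet_sum \<gamma> A * (sqrt \<gamma> ^ card A' * dirichlet_sum \<gamma> A') \<le> sqrt \<gamma> ^ card (A \<union> A') * dirichlet_sum \<gamma> (A \<union> A')" .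
      qed (use that in auto)
      then show ?thesis using D(1) that by (subst ln_mult_pos[symmetric]) (auto intro!: ln_mono)
    qed
    have "((\<lambda>\<gamma>. sqrt \<gamma> ^ card {} * dirichlet_sum \<gamma> {}) \<longlongrightarrow> 1) (at_right 0)"
      by (simp add: dirichlet_sum_def dirichlet.discrete_gaussian_def int_forms_empty dirichlet.zero_left)
    then have "D {} = 1" using D(2)[of "{}"] by (intro tendsto_unique[of "at_right 0"]) auto
    then show "ln (D {}) = 0" by simp
    show "ln (D (translate t ` A)) = ln (D A)" if A: "finite A" for A t
    proof -
      have "card (translate t ` A) = card A"
        using card_image[OF inj_on_subset[OF bij_is_inj[OF bij_translate]], of A t] by simp
      then have "((\<lambda>\<gamma>. sqrt \<gamma> ^ card A * dirichlet_sum \<gamma> A) \<longlongrightarrow> D (translate t ` A)) (at_right 0)"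
        using D(2)[of "translate t ` A"] A by (simp add: dirichlet_sum_translate)
      then have "D (translate t ` A) = D A" using D(2)[OF A] by (intro tendsto_unique[of "at_right 0"]) auto
      then show ?thesis by simp
    qed
    show "ln (D A) \<le> ln K * real (card A)" if A: "finite A" for A
    proof -
      have "D A \<le> K ^ card A"
      proof (rule le[OF D(2)[OF A] tendsto_power[OF K(2)]])
        fix \<gamma> :: real assume g: "0 < \<gamma>"
        then show "sqrt \<gamma> ^ card A * dirichlet_sum \<gamma> A \<le> (sqrt \<gamma> * theta \<gamma>) ^ card A"
          unfolding power_mult_distrib using dirichlet_sum_le[OF A g] by (intro mult_left_mono) auto
      qed
      then have "ln (D A) \<le> ln (K ^ card A)" using D(1)[OF A] by (intro ln_mono) auto
      then show ?thesis using K(1) by (simp add: ln_realpow mult.commute)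
    qed
    show "ln (F (Suc n)) \<le> ln (D (lattice_box n)) + (8 * real n + 7) * ln K" for n
    proof -
      have "F (Suc n) \<le> K ^ (8 * n + 7) * D (lattice_box n)"
      proof (rule le[OF F(3) tendsto_mult[OF tendsto_power[OF K(2)] D(2)[OF finite_lattice_box]]])
        fix \<gamma> :: real assume g: "0 < \<gamma>"
        have NN: "N (Suc n) = (8 * n + 7) + card (lattice_box n)"
          by (simp add: N card_lattice_box power2_eq_square algebra_simps)
        have "sqrt \<gamma> ^ N (Suc n) * ?Z (Suc n) \<gamma>
          \<le> sqrt \<gamma> ^ N (Suc n) * (theta \<gamma> ^ (8 * n + 7) * dirichlet_sum \<gamma> (lattice_box n))"
          unfolding Z_IV_eq using g free_le_dirichlet[OF v g] by (intro mult_left_mono) auto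
        also have "\<dots> = (sqrt \<gamma> * theta \<gamma>) ^ (8 * n + 7) * (sqrt \<gamma> ^ card (lattice_box n) * dirichlet_sum \<gamma> (lattice_box n))"
          unfolding NN power_add power_mult_distrib by (simp only: mult_ac)
        finally show "sqrt \<gamma> ^ N (Suc n) * ?Z (Suc n) \<gamma>
          \<le> (sqrt \<gamma> * theta \<gamma>) ^ (8 * n + 7) * (sqrt \<gamma> ^ card (lattice_box n) * dirichlet_sum \<gamma> (lattice_box n))" .
      qed
      then have "ln (F (Suc n)) \<le> ln (K ^ (8 * n + 7) * D (lattice_box n))" using F(1) by (intro ln_mono) auto
      also have "\<dots> = (8 * real n + 7) * ln K + ln (D (lattice_box n))"
        using K(1) D(1)[OF finite_lattice_box] by (simp add: ln_mult_pos ln_realpow)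
      finally show ?thesis by simp
    qed
    show "ln (D (lattice_box n)) \<le> ln K + ln (F n)" for n
    proof -
      have "D (lattice_box n) \<le> K * F n"
      proof (rule le[OF D(2)[OF finite_lattice_box] tendsto_mult[OF K(2) F(3)]])
        fix \<gamma> :: real assume g: "0 < \<gamma>"
        have NN: "card (lattice_box n) = Suc (N n)" by (simp add: N card_lattice_box)
        have "sqrt \<gamma> ^ card (lattice_box n) * dirichlet_sum \<gamma> (lattice_box n) \<le>
           sqrt \<gamma> ^ card (lattice_box n) * (theta \<gamma> * ?Z n \<gamma>)"
          unfolding Z_IV_eq using g dirichlet_le_free[OF v g] by (intro mult_left_mono) auto
        also have "\<dots> = sqrt \<gamma> * theta \<gamma> * (sqrt \<gamma> ^ N n * ?Z n \<gamma>)"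
          unfolding NN power_Suc by (simp only: mult_ac)
        finally show "sqrt \<gamma> ^ card (lattice_box n) * dirichlet_sum \<gamma> (lattice_box n) \<le>
           sqrt \<gamma> * theta \<gamma> * (sqrt \<gamma> ^ N n * ?Z n \<gamma>)" .
      qed
      then show ?thesis using D(1)[OF finite_lattice_box] F(1) K(1) by (subst ln_mult_pos[symmetric]) (auto intro!: ln_mono)
    qed
    fix l assume l: "(\<lambda>n. ln (F n) / real (card (lattice_box n))) \<longlonglongrightarrow> l"
    have "box_free_energy Z_GFF v0 \<gamma> \<longlonglongrightarrow> l - ln \<gamma> / 2" if g: "0 < \<gamma>" for \<gamma>
    proof -
      have eq: "box_free_energy Z_GFF v0 \<gamma> = (\<lambda>n. ln (F n) / real (card (lattice_box n)) - ln \<gamma> / 2 * (real (N n) / real (card (lattice_box n))))"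
        using g F(1) by (intro ext) (simp add: box_free_energy_def F(1,2) less_imp_neq[OF F(1), symmetric] ln_div ln_realpow ln_sqrt diff_divide_distrib)
      have lim: "(\<lambda>n. real (N n) / real (card (lattice_box n))) \<longlonglongrightarrow> 1"
      proof -
        have "real (N n) / real (card (lattice_box n)) = ((2 * real n + 1)\<^sup>2 - 1) / (2 * real n + 1)\<^sup>2" for n
          by (simp add: N card_lattice_box of_nat_diff add.commute)
        then show ?thesis by simp real_asymp
      qed
      show ?thesis
        unfolding eq using tendsto_diff[OF l tendsto_mult[OF tendsto_const[of "ln \<gamma> / 2"] lim]] by simp
    qed
    then show ?thesis using that by blast
  qed
qed

section \<open>The lower bound for the Coulomb gas\<close>

context quadratic_form
begin

lemma green_add:
  assumes A: "finite A" "pos_def A"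
  shows "green A (\<lambda>x. f x + g x) = (\<lambda>x. green A f x + green A g x)"
proof (rule green_eqI[OF A(2)])
  show "is_green A (\<lambda>x. f x + g x) (\<lambda>x. green A f x + green A g x)"
    using green[OF A, of f] green[OF A, of g]
    by (simp add: is_green_def add_left real_forms_add form_inner_def sum.distrib distrib_right)
qed

lemma green_scale:
  assumes A: "finite A" "pos_def A"
  shows "green A (\<lambda>x. c * f x) = (\<lambda>x. c * green A f x)"
proof (rule green_eqI[OF A(2)])
  show "is_green A (\<lambda>x. c * f x) (\<lambda>x. c * green A f x)"
    using green[OF A, of f]
    by (simp add: is_green_def scale_left real_forms_scale form_inner_def sum_distrib_left mult.assoc)
qed

text \<open>
  This makes \<open>sum_exp_superadditive\<close> available for charges in place of heights.
\<close>

lemma coulomb_form: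
  assumes A: "finite A" "pos_def A"
  shows "quadratic_form (\<lambda>f g. form_inner A f (green A g))"
proof
  fix f g h :: "'a \<Rightarrow> real" and c :: real
  have "form_inner A f (green A g) = B (green A f) (green A g)" for f g
    using green[OF A, of f] green[OF A, of g] by (simp add: is_green_def)
  then show "form_inner A f (green A g) = form_inner A g (green A f)" using sym by metis
  show "form_inner A (\<lambda>x. f x + g x) (green A h) = form_inner A f (green A h) + form_inner A g (green A h)"
    by (simp add: form_inner_def distrib_right sum.distrib)
  show "form_inner A (\<lambda>x. c * f x) (green A h) = c * form_inner A f (green A h)"
    by (simp add: form_inner_def sum_distrib_left mult.assoc)
qed

lemma coulomb_uminus:
  assumes A: "finite A" "pos_def A"
  shows "coulomb A (\<lambda>x. - q x) = coulomb A q"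
  using green_scale[OF A, of "- 1" q] by (simp add: coulomb_def form_inner_def)

definition coulomb_sum :: "real \<Rightarrow> 'a set \<Rightarrow> 'a set \<Rightarrow> real" where
  "coulomb_sum c A W = (\<Sum>\<^sub>\<infinity>q\<in>int_forms W. exp (- c * coulomb A q))"

lemma int_forms_mono: "W \<subseteq> A \<Longrightarrow> int_forms W \<subseteq> int_forms A"
  by (auto simp: int_forms_def real_forms_def)

lemma summable_coulomb_subset:
  assumes A: "finite A" "pos_def A" and c: "0 < c" and W: "W \<subseteq> A"
  shows "(\<lambda>q. exp (- c * coulomb A q)) summable_on int_forms W"
  using summable_coulomb[OF A c] int_forms_mono[OF W] by (rule summable_on_subset)

lemma coulomb_sum_mono:
  assumes A: "finite A" "pos_def A" and c: "0 < c" and W: "W \<subseteq> A"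
  shows "coulomb_sum c A W \<le> coulomb_sum c A A"
  unfolding coulomb_sum_def
  using summable_coulomb_subset[OF A c] W int_forms_mono[OF W] by (intro infsum_mono_neutral) auto

lemma coulomb_sum_superadditive:
  assumes A: "finite A" "pos_def A" and c: "0 < c" and W: "W1 \<union> W2 \<subseteq> A" "W1 \<inter> W2 = {}"
  shows "coulomb_sum c A W1 * coulomb_sum c A W2 \<le> coulomb_sum c A (W1 \<union> W2)"
proof -
  interpret C: quadratic_form "\<lambda>f g. form_inner A f (green A g)" by (rule coulomb_form[OF A])
  show ?thesis
    using C.sum_exp_superadditive[OF W(2), of c] summable_coulomb_subset[OF A c W(1)]
    unfolding coulomb_sum_def coulomb_def by blast
qed

lemma coulomb_sum_ge_dipole:
  assumes A: "finite A" "pos_def A" and c: "0 < c" and W: "W \<subseteq> A" and q: "q \<in> int_forms W" "q \<noteq> (\<lambda>x. 0)"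
  shows "1 + 2 * exp (- c * coulomb A q) \<le> coulomb_sum c A W"
proof -
  have ne: "(\<lambda>x. - q x) \<noteq> q" "(\<lambda>x. - q x) \<noteq> (\<lambda>x. 0)"
  proof -
    obtain x where "q x \<noteq> 0" using q(2) by auto
    then have "- q x \<noteq> q x" "- q x \<noteq> 0" by auto
    then show "(\<lambda>x. - q x) \<noteq> q" "(\<lambda>x. - q x) \<noteq> (\<lambda>x. 0)" by metis+
  qed
  have "(\<Sum>r\<in>{\<lambda>x. 0, q, \<lambda>x. - q x}. exp (- c * coulomb A r)) \<le> coulomb_sum c A W"
    unfolding coulomb_sum_def using q int_forms_uminus[OF q(1)]
    by (intro finite_sum_le_infsum summable_coulomb_subset[OF A c W]) (auto simp: int_forms_zero)
  moreover have "(\<Sum>r\<in>{\<lambda>x. 0, q, \<lambda>x. - q x}. exp (- c * coulomb A r)) = 1 + 2 * exp (- c * coulomb A q)"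
    using ne q(2) coulomb_zero[OF A] coulomb_uminus[OF A, of q] by (subst sum.insert; simp)+
  ultimately show ?thesis by simp
qed

end

text \<open>
  A charge that would sit outside \<open>A\<close>, at the marked vertex, is dropped: it does not interact.
\<close>

definition dipole :: "'v set \<Rightarrow> 'v \<times> 'v \<Rightarrow> 'v \<Rightarrow> real" where
  "dipole A e = extend_zero A (\<lambda>x. delta (snd e) x - delta (fst e) x)"

lemma dipole_eq: "dipole A e = (\<lambda>x. extend_zero A (delta (snd e)) x + (- 1) * extend_zero A (delta (fst e)) x)"
  by (auto simp: dipole_def extend_zero_def fun_eq_iff)

lemma dipole_int_forms: "dipole A e \<in> int_forms ({fst e, snd e} \<inter> A)"
  by (auto simp: dipole_def extend_zero_def int_forms_def real_forms_def delta_def)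

text \<open>
  The energy of a unit dipole is the effective resistance between the two ends of the edge.
\<close>

definition resistance :: "('v \<times> 'v) set \<Rightarrow> 'v set \<Rightarrow> 'v \<times> 'v \<Rightarrow> real" where
  "resistance E A e = dirichlet.coulomb E A (dipole A e)"

lemma resistance_nonneg:
  assumes "finite A" "dirichlet.pos_def E A"
  shows "0 \<le> resistance E A e"
proof (cases "dipole A e = (\<lambda>x. 0)")
  case True
  then show ?thesis using dirichlet.coulomb_zero[OF assms] by (simp add: resistance_def)
next
  case False
  have "dipole A e \<in> real_forms A"
    using int_forms_real_forms[OF dipole_int_forms[of A e]] by (rule real_forms_mono[rotated]) auto
  then show ?thesis using dirichlet.coulomb_pos[OF assms _ False] by (simp add: resistance_def less_imp_le)
qed

text \<open>
  Foster's theorem: with \<open>G x\<close> the potential of a unit charge at \<open>x\<close>, the resistances and the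
  constants \<open>dirichlet_form E (G x) (delta x) = 1\<close> for \<open>x\<close> in \<open>A\<close> are two ways of arranging the same
  double sum over edges and their ends.
\<close>

lemma foster:
  fixes E :: "('v \<times> 'v) set"
  assumes A: "finite A" and E: "finite E" and pd: "dirichlet.pos_def E A"
  shows "(\<Sum>e\<in>E. resistance E A e) = real (card A)"
proof -
  define G where "G x = dirichlet.green E A (extend_zero A (delta x))" for x
  have ext: "extend_zero A (delta x) = delta x" if "x \<in> A" for x
    using that by (auto simp: extend_zero_def delta_def fun_eq_iff)
  have ext0: "extend_zero A (delta x) = (\<lambda>y. 0)" if "x \<notin> A" for x
    using that by (auto simp: extend_zero_def delta_def fun_eq_iff)
  have G0: "G x = (\<lambda>y. 0)" if "x \<notin> A" for x
    using dirichlet.green_scale[OF A pd, of 0 "\<lambda>y. 0"] by (simp add: G_def ext0[OF that])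
  have gd: "dirichlet.green E A (dipole A e) = (\<lambda>x. G (snd e) x + (- 1) * G (fst e) x)" for e
    unfolding dipole_eq G_def dirichlet.green_add[OF A pd] dirichlet.green_scale[OF A pd] ..
  have pair: "form_inner A (dipole A e) \<phi> = grad \<phi> e" if "\<phi> \<in> real_forms A" for \<phi> e
  proof -
    have "form_inner A (dipole A e) \<phi> = form_inner A \<phi> (delta (snd e)) - form_inner A \<phi> (delta (fst e))"
      by (simp add: form_inner_def dipole_def extend_zero_def algebra_simps sum_subtractf)
    also have "\<dots> = grad \<phi> e"
      using that by (auto simp: form_inner_delta[OF A] grad_def real_forms_def)
    finally show ?thesis .
  qed
  have res: "resistance E A e = grad (G (snd e)) e - grad (G (fst e)) e" for e
  proof -
    have "dirichlet.green E A (dipole A e) \<in> real_forms A"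
      using dirichlet.green[OF A pd, of "dipole A e"] by (simp add: dirichlet.is_green_def)
    then have "resistance E A e = grad (dirichlet.green E A (dipole A e)) e"
      unfolding resistance_def dirichlet.coulomb_def by (rule pair)
    then show ?thesis unfolding gd by (simp add: grad_def)
  qed
  have "real (card A) = (\<Sum>x\<in>A. form_inner A (delta x) (delta x))"
    using A by (simp add: form_inner_delta) (simp add: delta_def)
  also have "\<dots> = (\<Sum>x\<in>A. dirichlet_form E (G x) (delta x))"
  proof (rule sum.cong[OF refl])
    fix x assume x: "x \<in> A"
    show "form_inner A (delta x) (delta x) = dirichlet_form E (G x) (delta x)"
      using dirichlet.green[OF A pd, of "delta x"] real_forms_delta[OF x] by (simp add: G_def ext[OF x] dirichlet.is_green_def)
  qed
  also have "\<dots> = (\<Sum>x\<in>A. \<Sum>e\<in>E. grad (G x) e * (delta x (snd e) - delta x (fst e)))"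
    by (simp add: dirichlet_form_def form_inner_def grad_def)
  also have "\<dots> = (\<Sum>e\<in>E. \<Sum>x\<in>A. grad (G x) e * (delta x (snd e) - delta x (fst e)))"
    by (rule sum.swap)
  also have "\<dots> = (\<Sum>e\<in>E. grad (G (snd e)) e - grad (G (fst e)) e)"
  proof (rule sum.cong[OF refl])
    fix e :: "'v \<times> 'v" assume "e \<in> E"
    have pick: "(\<Sum>x\<in>A. grad (G x) e * delta x y) = grad (G y) e" for y
    proof -
      have "(\<Sum>x\<in>A. grad (G x) e * delta x y) = (\<Sum>x\<in>A. if y = x then grad (G x) e else 0)"
        by (rule sum.cong) (auto simp: delta_def)
      then show ?thesis using A G0[of y] by (simp add: sum.delta' grad_def)
    qed
    show "(\<Sum>x\<in>A. grad (G x) e * (delta x (snd e) - delta x (fst e))) = grad (G (snd e)) e - grad (G (fst e)) e"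
      by (simp add: right_diff_distrib sum_subtractf pick)
  qed
  finally show ?thesis by (simp add: res)
qed

lemma one_plus_ge_exp:
  fixes y :: real
  assumes "0 \<le> y" "y \<le> 1"
  shows "exp (2 / 3 * y) \<le> 1 + 2 * y"
proof -
  have "exp (- (2 / 3 * y)) \<ge> 1 + - (2 / 3 * y)" by (rule exp_ge_add_one_self)
  then have "1 - 2 / 3 * y \<le> 1 / exp (2 / 3 * y)" by (simp add: exp_minus inverse_eq_divide)
  then have "(1 - 2 / 3 * y) * exp (2 / 3 * y) \<le> 1" by (simp add: pos_le_divide_eq)
  moreover have "1 \<le> (1 - 2 / 3 * y) * (1 + 2 * y)"
  proof -
    have "y * y \<le> y * 1" using assms by (intro mult_left_mono) auto
    then show ?thesis by (simp add: algebra_simps)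
  qed
  ultimately have "(1 - 2 / 3 * y) * exp (2 / 3 * y) \<le> (1 - 2 / 3 * y) * (1 + 2 * y)" by simp
  moreover have "0 < 1 - 2 / 3 * y" using assms by simp
  ultimately show ?thesis by (simp only: mult_le_cancel_left_pos)
qed

text \<open>
  The edges of a matching occupy disjoint pairs of vertices, so superadditivity makes their dipoles
  independent as far as lower bounds go.  Each pair contributes at least the empty charge and the two
  orientations of the dipole.
\<close>

lemma coulomb_sum_ge_matching:
  fixes E :: "('v \<times> 'v) set"
  assumes A: "finite A" and pd: "dirichlet.pos_def E A" and c: "0 < c"
    and M: "finite M" and dip: "\<And>e. e \<in> M \<Longrightarrow> dipole A e \<noteq> (\<lambda>x. 0)"
    and dis: "\<And>e e'. e \<in> M \<Longrightarrow> e' \<in> M \<Longrightarrow> e \<noteq> e' \<Longrightarrow> {fst e, snd e} \<inter> {fst e', snd e'} = {}"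
  shows "exp (2 / 3 * (\<Sum>e\<in>M. exp (- c * resistance E A e))) \<le> dirichlet.coulomb_sum E c A A"
proof -
  define W where "W M = (\<Union>e\<in>M. {fst e, snd e}) \<inter> A" for M :: "('v \<times> 'v) set"
  have "exp (2 / 3 * (\<Sum>e\<in>M. exp (- c * resistance E A e))) \<le> dirichlet.coulomb_sum E c A (W M)"
    using M dip dis
  proof (induction M)
    case empty
    have "dirichlet.coulomb_sum E c A {} = 1"
      by (simp add: dirichlet.coulomb_sum_def int_forms_empty dirichlet.coulomb_zero[OF A pd])
    then show ?case by (simp add: W_def)
  next
    case (insert e M)
    have IH: "exp (2 / 3 * (\<Sum>e\<in>M. exp (- c * resistance E A e))) \<le> dirichlet.coulomb_sum E c A (W M)"
      using insert.prems by (intro insert.IH) auto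
    have y: "0 \<le> exp (- c * resistance E A e)" "exp (- c * resistance E A e) \<le> 1"
      using c resistance_nonneg[OF A pd, of e] by auto
    have "exp (2 / 3 * exp (- c * resistance E A e)) \<le> 1 + 2 * exp (- c * resistance E A e)"
      by (rule one_plus_ge_exp[OF y])
    also have "\<dots> \<le> dirichlet.coulomb_sum E c A ({fst e, snd e} \<inter> A)"
      unfolding resistance_def using insert.prems(1)[of e]
      by (intro dirichlet.coulomb_sum_ge_dipole[OF A pd c] dipole_int_forms) auto
    finally have 1: "exp (2 / 3 * exp (- c * resistance E A e)) \<le> dirichlet.coulomb_sum E c A ({fst e, snd e} \<inter> A)" .
    have "exp (2 / 3 * (\<Sum>e\<in>insert e M. exp (- c * resistance E A e))) =
        exp (2 / 3 * exp (- c * resistance E A e)) * exp (2 / 3 * (\<Sum>e\<in>M. exp (- c * resistance E A e)))"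
      using insert.hyps by (simp add: distrib_left exp_add)
    also have "\<dots> \<le> dirichlet.coulomb_sum E c A ({fst e, snd e} \<inter> A) * dirichlet.coulomb_sum E c A (W M)"
      using order_trans[OF exp_ge_zero 1] by (intro mult_mono 1 IH) auto
    also have "\<dots> \<le> dirichlet.coulomb_sum E c A (({fst e, snd e} \<inter> A) \<union> W M)"
    proof (rule dirichlet.coulomb_sum_superadditive[OF A pd c])
      have "{fst e, snd e} \<inter> {fst e', snd e'} = {}" if "e' \<in> M" for e'
        using insert.prems(2)[of e e'] insert.hyps(2) that by auto
      then show "({fst e, snd e} \<inter> A) \<inter> W M = {}" unfolding W_def by blast
    qed (auto simp: W_def)
    also have "({fst e, snd e} \<inter> A) \<union> W M = W (insert e M)" by (auto simp: W_def)
    finally show ?case .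
  qed
  also have "\<dots> \<le> dirichlet.coulomb_sum E c A A"
    by (rule dirichlet.coulomb_sum_mono[OF A pd c]) (auto simp: W_def)
  finally show ?thesis .
qed

text \<open>
  Jensen's inequality, by the tangent of the exponential at the mean.
\<close>

lemma sum_exp_ge_mean:
  fixes r :: "'e \<Rightarrow> real"
  assumes "finite E"
  shows "real (card E) * exp (- c * ((\<Sum>e\<in>E. r e) / real (card E))) \<le> (\<Sum>e\<in>E. exp (- c * r e))"
proof (cases "E = {}")
  case False
  define m where "m = (\<Sum>e\<in>E. r e) / real (card E)"
  have sm: "(\<Sum>e\<in>E. r e) = real (card E) * m" using assms False by (simp add: m_def)
  have "exp (- c * m) * (1 + (- c * (r e - m))) \<le> exp (- c * r e)" for e
  proof -
    have "exp (- c * m) * (1 + (- c * (r e - m))) \<le> exp (- c * m) * exp (- c * (r e - m))"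
      by (intro mult_left_mono exp_ge_add_one_self) auto
    then show ?thesis by (simp add: algebra_simps flip: exp_add)
  qed
  then have "(\<Sum>e\<in>E. exp (- c * m) * (1 + (- c * (r e - m)))) \<le> (\<Sum>e\<in>E. exp (- c * r e))"
    by (intro sum_mono)
  also have "(\<Sum>e\<in>E. exp (- c * m) * (1 + (- c * (r e - m)))) = exp (- c * m) * (real (card E) - c * ((\<Sum>e\<in>E. r e) - real (card E) * m))"
    by (simp add: sum_distrib_left[symmetric] sum.distrib sum_subtractf algebra_simps flip: sum_distrib_right)
  finally show ?thesis by (simp add: sm m_def[symmetric] mult.commute sum_nonneg)
qed simp

lemma card_box_edges: "card (box_edges n) = 4 * n * (2 * n + 1)"
proof -
  define I J where "I = {- int n..int n}" and "J = {- int n..<int n}"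
  define h where "h = (\<lambda>(a::int, b::int). ((a, b), (a + 1, b)))"
  define v where "v = (\<lambda>(b::int, a::int). ((a, b), (a, b + 1)))"
  have "box_edges n = h ` (J \<times> I) \<union> v ` (J \<times> I)"
    by (auto simp: box_edges_def lattice_box_def h_def v_def I_def J_def image_iff split_paired_Ex)
  moreover have "h ` (J \<times> I) \<inter> v ` (J \<times> I) = {}" by (auto simp: h_def v_def)
  moreover have "inj_on h (J \<times> I)" "inj_on v (J \<times> I)" by (auto simp: inj_on_def h_def v_def)
  moreover have "card (J \<times> I) = 2 * n * (2 * n + 1)"
    by (simp add: card_cartesian_product I_def J_def) (simp add: nat_add_distrib nat_mult_distrib)
  ultimately show ?thesis
    by (simp add: card_Un_disjoint card_image I_def J_def)
qed

text \<open>
  The edges of a box fall into four matchings, according to direction and the parity of the coordinate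
  along the edge.  Adding up the bounds for the four of them makes the sum over all edges appear, where
  the mean resistance is known.
\<close>

lemma Coul_lower_bound:
  assumes v: "v \<in> lattice_box n" and b: "0 < \<beta>"
  shows "real (card (box_edges n)) / 6 * exp (- (2 * pi\<^sup>2 * \<beta>) * (real (card (lattice_box n) - 1) / real (card (box_edges n))))
    \<le> ln (Z_Coul (lattice_box n) (box_edges n) v \<beta>)"
proof -
  define E where "E = box_edges n"
  define A where "A = lattice_box n - {v}"
  define c where "c = 2 * pi\<^sup>2 * \<beta>"
  have c: "0 < c" using b by (simp add: c_def)
  have A: "finite A" by (simp add: A_def finite_lattice_box)
  have E: "finite E" by (simp add: E_def finite_box_edges)
  have pd: "dirichlet.pos_def E A" unfolding E_def A_def by (rule pos_def_box[OF v])
  define Z where "Z = Z_Coul (lattice_box n) (box_edges n) v \<beta>"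
  have Z: "Z = dirichlet.coulomb_sum E c A A"
    unfolding Z_def E_def A_def c_def dirichlet.coulomb_sum_def
    by (rule Z_Coul_eq[OF finite_lattice_box box_edges_subset pos_def_box[OF v]])
  define cl :: "site \<times> site \<Rightarrow> int" where
    "cl e = (if snd (fst e) = snd (snd e) then fst (fst e) mod 2 else 2 + snd (fst e) mod 2)" for e
  define M where "M i = {e \<in> E. cl e = i}" for i
  have dip: "dipole A e \<noteq> (\<lambda>x. 0)" if "e \<in> E" for e
  proof -
    have e: "fst e \<noteq> snd e" "fst e \<in> lattice_box n" "snd e \<in> lattice_box n"
      using that by (auto simp: E_def box_edges_def)
    then have "dipole A e (fst e) \<noteq> 0 \<or> dipole A e (snd e) \<noteq> 0"
      by (auto simp: dipole_def extend_zero_def A_def delta_def)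
    then show ?thesis by metis
  qed
  have ge: "2 / 3 * (\<Sum>e\<in>M i. exp (- c * resistance E A e)) \<le> ln Z" for i
  proof -
    have "exp (2 / 3 * (\<Sum>e\<in>M i. exp (- c * resistance E A e))) \<le> Z"
      unfolding Z
    proof (rule coulomb_sum_ge_matching[OF A pd c])
      show "finite (M i)" using E by (simp add: M_def)
      show "dipole A e \<noteq> (\<lambda>x. 0)" if "e \<in> M i" for e using dip that by (simp add: M_def)
      fix e e' assume ee: "e \<in> M i" "e' \<in> M i" "e \<noteq> e'"
      obtain x1 y1 x2 y2 where e: "e = ((x1, y1), (x2, y2))" by (metis prod.collapse)
      obtain x1' y1' x2' y2' where e': "e' = ((x1', y1'), (x2', y2'))" by (metis prod.collapse)
      have 1: "x2 = x1 + 1 \<and> y2 = y1 \<or> x2 = x1 \<and> y2 = y1 + 1" "x2' = x1' + 1 \<and> y2' = y1' \<or> x2' = x1' \<and> y2' = y1' + 1"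
        using ee by (auto simp: M_def E_def box_edges_def e e')
      have 2: "cl e = cl e'" using ee by (simp add: M_def)
      have par: "z' \<noteq> z + 1 \<and> z \<noteq> z' + 1" if "z mod 2 = z' mod 2" for z z' :: int
        using that by presburger
      have m: "0 \<le> z mod 2 \<and> z mod 2 < 2" for z :: int by simp
      show "{fst e, snd e} \<inter> {fst e', snd e'} = {}"
      proof (cases "y1 = y2")
        case True
        then have x2: "x2 = x1 + 1" and ce: "cl e = x1 mod 2" using 1(1) by (auto simp: cl_def e)
        have "y1' = y2'"
        proof (rule ccontr)
          assume "y1' \<noteq> y2'"
          then have "cl e' = 2 + y1' mod 2" by (simp add: cl_def e')
          then show False using 2 ce m[of x1] m[of y1'] by linarith
        qed
        then have "x2' = x1' + 1" "cl e' = x1' mod 2" using 1(2) by (auto simp: cl_def e')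
        then show ?thesis using par[of x1 x1'] 2 ce x2 True \<open>y1' = y2'\<close> ee(3) by (auto simp: e e')
      next
        case False
        then have x2: "x2 = x1" "y2 = y1 + 1" and ce: "cl e = 2 + y1 mod 2" using 1(1) by (auto simp: cl_def e)
        have ne: "y1' \<noteq> y2'"
        proof
          assume "y1' = y2'"
          then have "cl e' = x1' mod 2" by (simp add: cl_def e')
          then show False using 2 ce m[of y1] m[of x1'] by linarith
        qed
        then have "x2' = x1'" "y2' = y1' + 1" "cl e' = 2 + y1' mod 2" using 1(2) by (auto simp: cl_def e')
        then show ?thesis using par[of y1 y1'] 2 ce x2 ee(3) by (auto simp: e e')
      qed
    qed
    then have "ln (exp (2 / 3 * (\<Sum>e\<in>M i. exp (- c * resistance E A e)))) \<le> ln Z"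
      by (intro ln_mono) (auto intro: less_le_trans[OF exp_gt_zero])
    then show ?thesis by simp
  qed
  have "cl ` E \<subseteq> {0..3}" by (auto simp: cl_def)
  then have "(\<Sum>e\<in>E. exp (- c * resistance E A e)) = (\<Sum>i\<in>{0..3}. \<Sum>e\<in>M i. exp (- c * resistance E A e))"
    unfolding M_def using E by (intro sum.group[symmetric]) auto
  also have "\<dots> = 3 / 2 * (\<Sum>i\<in>{0..3::int}. 2 / 3 * (\<Sum>e\<in>M i. exp (- c * resistance E A e)))"
    by (simp add: sum_distrib_left)
  also have "\<dots> \<le> 3 / 2 * (\<Sum>i\<in>{0..3::int}. ln Z)"
    by (intro mult_left_mono sum_mono ge) auto
  also have "\<dots> = 6 * ln Z" by simp
  finally have "(\<Sum>e\<in>E. exp (- c * resistance E A e)) \<le> 6 * ln Z" .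
  moreover have "real (card E) * exp (- c * (real (card A) / real (card E))) \<le> (\<Sum>e\<in>E. exp (- c * resistance E A e))"
    using sum_exp_ge_mean[OF E, of c "resistance E A"] by (simp add: foster[OF A E pd])
  moreover have "card A = card (lattice_box n) - 1" using v finite_lattice_box by (simp add: A_def)
  ultimately show ?thesis by (simp add: Z_def E_def c_def)
qed

lemma Coul_free_energy_lower_bound:
  assumes v: "\<And>n. v0 n \<in> lattice_box n" and b: "0 < \<beta>" and l: "box_free_energy Z_Coul v0 \<beta> \<longlonglongrightarrow> l"
  shows "exp (- (pi\<^sup>2 * \<beta>)) / 3 \<le> l"
proof -
  define c where "c = 2 * pi\<^sup>2 * \<beta>"
  define L where "L n = (4 * real n * (2 * real n + 1)) / (2 * real n + 1)\<^sup>2 / 6 * exp (- c * (((2 * real n + 1)\<^sup>2 - 1) / (4 * real n * (2 * real n + 1))))" for n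
  have "L n \<le> box_free_energy Z_Coul v0 \<beta> n" for n
  proof -
    have "real (card (box_edges n)) / 6 * exp (- c * (real (card (lattice_box n) - 1) / real (card (box_edges n)))) / real (card (lattice_box n))
       \<le> box_free_energy Z_Coul v0 \<beta> n"
      unfolding box_free_energy_def c_def using Coul_lower_bound[OF v b, of n] by (intro divide_right_mono) auto
    moreover have "real (card (lattice_box n) - 1) = (2 * real n + 1)\<^sup>2 - 1"
      by (simp add: card_lattice_box of_nat_diff add.commute)
    moreover have "real (card (lattice_box n)) = (2 * real n + 1)\<^sup>2" "real (card (box_edges n)) = 4 * real n * (2 * real n + 1)"
      by (simp_all add: card_lattice_box card_box_edges algebra_simps)
    ultimately show ?thesis by (simp add: L_def)
  qed
  moreover have "L \<longlonglongrightarrow> 1 / 3 * exp (- c * (1 / 2))"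
  proof -
    have 1: "(\<lambda>n. (4 * real n * (2 * real n + 1)) / (2 * real n + 1)\<^sup>2 / 6) \<longlonglongrightarrow> 1 / 3" by real_asymp
    have 2: "(\<lambda>n. ((2 * real n + 1)\<^sup>2 - 1) / (4 * real n * (2 * real n + 1))) \<longlonglongrightarrow> 1 / 2" by real_asymp
    show ?thesis unfolding L_def by (intro tendsto_intros 1 2)
  qed
  ultimately have "1 / 3 * exp (- c * (1 / 2)) \<le> l"
    using l by (intro LIMSEQ_le) auto
  then show ?thesis by (simp add: c_def)
qed

section \<open>The Villain model as a sum over integer flows\<close>

interpretation edge: quadratic_form "form_inner E" for E :: "'e set"
  by standard (simp_all add: form_inner_def algebra_simps sum.distrib sum_distrib_left)

lemma pos_def_form_inner:
  fixes E :: "'e set"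
  assumes E: "finite E"
  shows "edge.pos_def E E"
  unfolding edge.pos_def_def
proof (intro ballI impI)
  fix f :: "'e \<Rightarrow> real" assume f: "f \<in> real_forms E" "f \<noteq> (\<lambda>x. 0)"
  obtain e where fe: "f e \<noteq> 0" using f(2) by auto
  then have "e \<in> E" using f(1) by (auto simp: real_forms_def)
  have "0 < f e * f e" using fe by (simp add: zero_less_mult_iff linorder_neq_iff) linarith
  also have "\<dots> \<le> form_inner E f f"
    unfolding form_inner_def using E \<open>e \<in> E\<close> by (intro member_le_sum) auto
  finally show "0 < form_inner E f f" .
qed

lemma green_form_inner: "finite E \<Longrightarrow> f \<in> real_forms E \<Longrightarrow> edge.green E E f = f"
  by (rule edge.green_eqI[OF pos_def_form_inner]) (auto simp: edge.is_green_def)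

text \<open>
  Poisson summation for the standard form on the edges, with the variables rescaled by \<open>2 * pi\<close>.
\<close>

lemma poisson_edges:
  fixes a :: "'e \<Rightarrow> real"
  assumes E: "finite E" and b: "0 < \<beta>"
  shows "(\<lambda>k. exp (- (1 / \<beta>) / 2 * form_inner E k k)) summable_on int_forms E"
    and "of_real (\<Sum>\<^sub>\<infinity>m\<in>int_forms E. exp (- \<beta> / 2 * form_inner E (\<lambda>e. a e + 2 * pi * m e) (\<lambda>e. a e + 2 * pi * m e))) =
      (1 / sqrt (2 * pi * \<beta>) ^ card E) *\<^sub>R (\<Sum>\<^sub>\<infinity>k\<in>int_forms E. exp (- (1 / \<beta>) / 2 * form_inner E k k) *\<^sub>R cis (form_inner E k a))"
proof -
  obtain C where G: "edge.gaussian_data E E C" and P: "\<And>\<gamma>. 0 < \<gamma> \<Longrightarrow> edge.poisson_data E \<gamma> E (C / sqrt \<gamma> ^ card E)"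
    using edge.gaussian_poisson_data[OF E pos_def_form_inner[OF E]] by metis
  interpret L: product_sigma_finite "\<lambda>_::'e. lborel :: real measure" by standard
  have C0: "0 < C" using G by (simp add: edge.gaussian_data_def)
  have "ennreal C = (\<integral>\<^sup>+\<phi>. ennreal (exp (- 1 / 2 * form_inner E (extend_zero E \<phi>) (extend_zero E \<phi>))) \<partial>(\<Pi>\<^sub>M x\<in>E. lborel))"
    using G real_forms_zero[of E] unfolding edge.gaussian_data_def by (auto dest!: spec[of _ 1] bspec[of _ _ "\<lambda>x. 0"])
  also have "\<dots> = (\<integral>\<^sup>+\<phi>. (\<Prod>e\<in>E. ennreal (exp (- 1 / 2 * (\<phi> e + 0)\<^sup>2))) \<partial>(\<Pi>\<^sub>M x\<in>E. lborel))"
    using E by (intro nn_integral_cong)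
      (simp add: prod_ennreal exp_sum[symmetric] form_inner_def extend_zero_def sum_negf sum_divide_distrib power2_eq_square)
  also have "\<dots> = (\<Prod>e\<in>E. \<integral>\<^sup>+y. ennreal (exp (- 1 / 2 * (y + 0)\<^sup>2)) \<partial>lborel)"
    by (rule L.product_nn_integral_prod[OF E]) simp
  also have "\<dots> = ennreal (sqrt (2 * pi) ^ card E)"
    unfolding nn_integral_gaussian[OF zero_less_one] by (simp add: prod_constant ennreal_power)
  finally have C: "C = sqrt (2 * pi) ^ card E" using C0 by simp
  define \<gamma> where "\<gamma> = 4 * pi\<^sup>2 * \<beta>"
  have g: "0 < \<gamma>" using b by (simp add: \<gamma>_def)
  have K: "C / sqrt \<gamma> ^ card E = 1 / sqrt (2 * pi * \<beta>) ^ card E"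
  proof -
    have "sqrt \<gamma> = sqrt (2 * pi) * sqrt (2 * pi * \<beta>)"
      unfolding \<gamma>_def real_sqrt_mult[symmetric] by (simp add: power2_eq_square)
    then show ?thesis unfolding C by (simp add: power_mult_distrib)
  qed
  have w: "exp (- 2 * pi\<^sup>2 / \<gamma> * edge.coulomb E E k) = exp (- (1 / \<beta>) / 2 * form_inner E k k)" if "k \<in> int_forms E" for k
  proof -
    have "edge.coulomb E E k = form_inner E k k"
      by (simp add: edge.coulomb_def green_form_inner[OF E int_forms_real_forms[OF that]])
    then show ?thesis using b by (simp add: \<gamma>_def)
  qed
  show "(\<lambda>k. exp (- (1 / \<beta>) / 2 * form_inner E k k)) summable_on int_forms E"
  proof -
    have "(\<lambda>k. exp (- 2 * pi\<^sup>2 / \<gamma> * edge.coulomb E E k)) summable_on int_forms E"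
      using P[OF g] unfolding edge.poisson_data_def by blast
    then show ?thesis by (subst (asm) summable_on_cong[OF w])
  qed
  define a' where "a' e = extend_zero E a e / (2 * pi)" for e
  have a': "a' \<in> real_forms E" by (simp add: a'_def real_forms_def extend_zero_def)
  have 1: "exp (- \<gamma> / 2 * form_inner E (\<lambda>e. m e + a' e) (\<lambda>e. m e + a' e)) =
     exp (- \<beta> / 2 * form_inner E (\<lambda>e. a e + 2 * pi * m e) (\<lambda>e. a e + 2 * pi * m e))" for m
  proof -
    have "form_inner E (\<lambda>e. a e + 2 * pi * m e) (\<lambda>e. a e + 2 * pi * m e) = form_inner E (\<lambda>e. 2 * pi * (m e + a' e)) (\<lambda>e. 2 * pi * (m e + a' e))"
      by (rule form_inner_cong) (simp_all add: a'_def extend_zero_def algebra_simps)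
    also have "\<dots> = 4 * pi\<^sup>2 * form_inner E (\<lambda>e. m e + a' e) (\<lambda>e. m e + a' e)"
      by (simp add: form_inner_def sum_distrib_left power2_eq_square algebra_simps)
    finally show ?thesis by (simp add: \<gamma>_def)
  qed
  have 2: "2 * pi * form_inner E k a' = form_inner E k a" for k
    by (simp add: form_inner_def a'_def extend_zero_def sum_distrib_left)
  have "of_real (\<Sum>\<^sub>\<infinity>m\<in>int_forms E. exp (- \<gamma> / 2 * form_inner E (\<lambda>e. m e + a' e) (\<lambda>e. m e + a' e))) =
     (C / sqrt \<gamma> ^ card E) *\<^sub>R (\<Sum>\<^sub>\<infinity>q\<in>int_forms E. exp (- 2 * pi\<^sup>2 / \<gamma> * edge.coulomb E E q) *\<^sub>R cis (2 * pi * form_inner E q a'))"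
    using P[OF g] a' by (simp add: edge.poisson_data_def)
  also have "(\<Sum>\<^sub>\<infinity>q\<in>int_forms E. exp (- 2 * pi\<^sup>2 / \<gamma> * edge.coulomb E E q) *\<^sub>R cis (2 * pi * form_inner E q a')) =
     (\<Sum>\<^sub>\<infinity>k\<in>int_forms E. exp (- (1 / \<beta>) / 2 * form_inner E k k) *\<^sub>R cis (form_inner E k a))"
    by (rule infsum_cong) (simp only: w 2)
  finally show "of_real (\<Sum>\<^sub>\<infinity>m\<in>int_forms E. exp (- \<beta> / 2 * form_inner E (\<lambda>e. a e + 2 * pi * m e) (\<lambda>e. a e + 2 * pi * m e))) =
      (1 / sqrt (2 * pi * \<beta>) ^ card E) *\<^sub>R (\<Sum>\<^sub>\<infinity>k\<in>int_forms E. exp (- (1 / \<beta>) / 2 * form_inner E k k) *\<^sub>R cis (form_inner E k a))"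
    by (simp only: 1 K)
qed

definition divergence :: "('v \<times> 'v) set \<Rightarrow> ('v \<times> 'v \<Rightarrow> real) \<Rightarrow> 'v \<Rightarrow> real" where
  "divergence E k x = form_inner E k (grad (delta x))"

lemma form_inner_grad:
  assumes "finite A"
  shows "form_inner E k (grad (extend_zero A \<theta>)) = (\<Sum>x\<in>A. \<theta> x * divergence E k x)"
proof -
  have g: "grad (extend_zero A \<theta>) e = (\<Sum>x\<in>A. \<theta> x * grad (delta x) e)" for e
  proof -
    have "extend_zero A \<theta> y = (\<Sum>x\<in>A. \<theta> x * delta x y)" for y
    proof -
      have "(\<Sum>x\<in>A. \<theta> x * delta x y) = (\<Sum>x\<in>A. if y = x then \<theta> x else 0)"
        by (rule sum.cong) (auto simp: delta_def)
      then show ?thesis using assms by (simp add: sum.delta' extend_zero_def)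
    qed
    then show ?thesis by (simp add: grad_def right_diff_distrib sum_subtractf)
  qed
  show ?thesis
    unfolding divergence_def form_inner_def g sum_distrib_left
    by (subst sum.swap) (simp add: mult_ac)
qed

lemma divergence_Ints: "k \<in> int_forms E \<Longrightarrow> divergence E k x \<in> \<int>"
  unfolding divergence_def form_inner_def
  by (intro Ints_sum Ints_mult) (auto simp: int_forms_def grad_def delta_def)

lemma integral_character:
  fixes d :: "'v \<Rightarrow> real"
  assumes A: "finite A" and d: "\<And>x. x \<in> A \<Longrightarrow> d x \<in> \<int>"
  shows "integrable (\<Pi>\<^sub>M x\<in>A. lborel) (\<lambda>\<theta>. indicator (\<Pi>\<^sub>E x\<in>A. {0..<2 * pi}) \<theta> *\<^sub>R cis (\<Sum>x\<in>A. \<theta> x * d x))"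
    and "(\<integral>\<theta>. indicator (\<Pi>\<^sub>E x\<in>A. {0..<2 * pi}) \<theta> *\<^sub>R cis (\<Sum>x\<in>A. \<theta> x * d x) \<partial>(\<Pi>\<^sub>M x\<in>A. lborel)) =
      of_real (if \<forall>x\<in>A. d x = 0 then (2 * pi) ^ card A else 0)"
proof -
  interpret L: product_sigma_finite "\<lambda>_::'v. lborel :: real measure" by standard
  define f where "f x t = indicator {0..<2 * pi} t *\<^sub>R cis (t * d x)" for x t
  have f_eq: "indicator (\<Pi>\<^sub>E x\<in>A. {0..<2 * pi}) \<theta> *\<^sub>R cis (\<Sum>x\<in>A. \<theta> x * d x) = (\<Prod>x\<in>A. f x (\<theta> x))"
    if "\<theta> \<in> space (\<Pi>\<^sub>M x\<in>A. lborel)" for \<theta> :: "'v \<Rightarrow> real"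
  proof -
    have ext: "\<theta> \<in> extensional A" using that by (simp add: space_PiM PiE_def)
    have c: "cis (\<Sum>x\<in>A. \<theta> x * d x) = (\<Prod>x\<in>A. cis (\<theta> x * d x))"
      by (simp add: cis_conv_exp sum_distrib_left exp_sum[OF A])
    show ?thesis
    proof (cases "\<theta> \<in> (\<Pi>\<^sub>E x\<in>A. {0..<2 * pi})")
      case True
      then have "f x (\<theta> x) = cis (\<theta> x * d x)" if "x \<in> A" for x
        using that by (auto simp: f_def PiE_def Pi_def)
      then show ?thesis using True by (simp add: c)
    next
      case False
      then obtain x where "x \<in> A" "\<theta> x \<notin> {0..<2 * pi}" using ext by (auto simp: PiE_def Pi_def)
      then have "f x (\<theta> x) = 0" by (simp add: f_def)
      then show ?thesis using False A \<open>x \<in> A\<close> by (metis indicator_simps(2) prod_zero scaleR_zero_left)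
    qed
  qed
  have fm: "(\<lambda>t. cis (t * d x)) \<in> borel_measurable borel" for x
    by (intro borel_measurable_continuous_onI continuous_intros)
  have fi: "integrable lborel (f x)" for x
  proof (rule Bochner_Integration.integrable_bound[where f = "indicator {0..<2 * pi} :: real \<Rightarrow> real"])
    show "integrable lborel (indicator {0..<2 * pi} :: real \<Rightarrow> real)" by simp
    show "f x \<in> borel_measurable lborel" unfolding f_def using fm[of x] by measurable
  qed (auto simp: f_def)
  show "integrable (\<Pi>\<^sub>M x\<in>A. lborel) (\<lambda>\<theta>. indicator (\<Pi>\<^sub>E x\<in>A. {0..<2 * pi}) \<theta> *\<^sub>R cis (\<Sum>x\<in>A. \<theta> x * d x))"
    using L.product_integrable_prod[OF A, of f] fi by (subst Bochner_Integration.integrable_cong[OF refl f_eq]) auto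
  have "(\<integral>\<theta>. indicator (\<Pi>\<^sub>E x\<in>A. {0..<2 * pi}) \<theta> *\<^sub>R cis (\<Sum>x\<in>A. \<theta> x * d x) \<partial>(\<Pi>\<^sub>M x\<in>A. lborel)) =
     (\<integral>\<theta>. (\<Prod>x\<in>A. f x (\<theta> x)) \<partial>(\<Pi>\<^sub>M x\<in>A. lborel))"
    by (rule Bochner_Integration.integral_cong[OF refl f_eq])
  also have "\<dots> = (\<Prod>x\<in>A. \<integral>t. f x t \<partial>lborel)"
    using fi by (intro L.product_integral_prod[OF A])
  also have "\<dots> = (\<Prod>x\<in>A. if d x = 0 then of_real (2 * pi) else 0)"
  proof (rule prod.cong[OF refl])
    fix x assume "x \<in> A"
    then obtain j :: int where j: "d x = of_int j" using d by (metis Ints_cases)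
    have e: "f x t = indicator {0..<2 * pi} t *\<^sub>R cis (2 * pi * of_int j * t / (2 * pi))" for t
      by (simp add: f_def j mult.commute)
    show "(\<integral>t. f x t \<partial>lborel) = (if d x = 0 then of_real (2 * pi) else 0)"
      unfolding e using integral_cis_int[of "2 * pi" j] by (simp add: j)
  qed
  also have "\<dots> = of_real (if \<forall>x\<in>A. d x = 0 then (2 * pi) ^ card A else 0)"
    using A by (auto simp: prod_zero_iff)
  finally show "(\<integral>\<theta>. indicator (\<Pi>\<^sub>E x\<in>A. {0..<2 * pi}) \<theta> *\<^sub>R cis (\<Sum>x\<in>A. \<theta> x * d x) \<partial>(\<Pi>\<^sub>M x\<in>A. lborel)) =
      of_real (if \<forall>x\<in>A. d x = 0 then (2 * pi) ^ card A else 0)" .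
qed

text \<open>
  After Poisson summation on the edges the angle at each vertex \<open>x\<close> enters only through the character
  with frequency \<open>divergence E k x\<close>, and integrating it over a period forces the divergence to vanish.
\<close>

theorem Z_Vil_eq:
  fixes E :: "('v \<times> 'v) set"
  assumes V: "finite V" and E: "finite E" and b: "0 < \<beta>"
  shows "Z_Vil V E v0 \<beta> = (2 * pi) ^ card (V - {v0}) / sqrt (2 * pi * \<beta>) ^ card E *
    (\<Sum>\<^sub>\<infinity>k\<in>{k \<in> int_forms E. \<forall>x\<in>V - {v0}. divergence E k x = 0}. exp (- (1 / \<beta>) / 2 * form_inner E k k))"
proof -
  define A where "A = V - {v0}"
  have A: "finite A" using V by (simp add: A_def)
  define I :: "('v \<Rightarrow> real) \<Rightarrow> real" where "I = indicator (\<Pi>\<^sub>E x\<in>A. {0..<2 * pi})"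
  define w where "w k = exp (- (1 / \<beta>) / 2 * form_inner E k k)" for k
  define K where "K = 1 / sqrt (2 * pi * \<beta>) ^ card E"
  define P where "P = (\<Pi>\<^sub>M x\<in>A. lborel :: real measure)"
  define \<xi> where "\<xi> k \<theta> = I \<theta> *\<^sub>R cis (\<Sum>x\<in>A. \<theta> x * divergence E k x)" for k \<theta>
  define S where "S \<theta> = (\<Sum>\<^sub>\<infinity>m\<in>int_forms E. exp (- \<beta> / 2 * form_inner E (\<lambda>e. grad (extend_zero A \<theta>) e + 2 * pi * m e) (\<lambda>e. grad (extend_zero A \<theta>) e + 2 * pi * m e)))" for \<theta>
  have w0: "0 < w k" for k by (simp add: w_def)
  have sw: "w summable_on int_forms E" unfolding w_def by (rule poisson_edges(1)[OF E b])
  have cI: "countable (int_forms E)"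
  proof -
    have "(\<lambda>k. norm (w k)) summable_on int_forms E" using sw w0 by (simp add: abs_of_pos)
    then have "countable {k \<in> int_forms E. w k \<noteq> 0}" by (rule abs_summable_countable)
    then show ?thesis using w0 by (simp add: less_imp_neq[OF w0, symmetric])
  qed
  have S: "of_real (I \<theta> * S \<theta>) = K *\<^sub>R (\<Sum>\<^sub>\<infinity>k\<in>int_forms E. w k *\<^sub>R \<xi> k \<theta>)" for \<theta>
  proof -
    have "of_real (S \<theta>) = K *\<^sub>R (\<Sum>\<^sub>\<infinity>k\<in>int_forms E. w k *\<^sub>R cis (\<Sum>x\<in>A. \<theta> x * divergence E k x))"
      unfolding S_def K_def w_def form_inner_grad[OF A, symmetric] by (rule poisson_edges(2)[OF E b])
    then have "of_real (I \<theta> * S \<theta>) = K *\<^sub>R (I \<theta> *\<^sub>R (\<Sum>\<^sub>\<infinity>k\<in>int_forms E. w k *\<^sub>R cis (\<Sum>x\<in>A. \<theta> x * divergence E k x)))"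
      by (simp add: scaleR_conv_of_real)
    also have "I \<theta> *\<^sub>R (\<Sum>\<^sub>\<infinity>k\<in>int_forms E. w k *\<^sub>R cis (\<Sum>x\<in>A. \<theta> x * divergence E k x)) = (\<Sum>\<^sub>\<infinity>k\<in>int_forms E. I \<theta> *\<^sub>R (w k *\<^sub>R cis (\<Sum>x\<in>A. \<theta> x * divergence E k x)))"
      by (rule infsum_scaleR_right[symmetric])
    also have "(\<lambda>k. I \<theta> *\<^sub>R (w k *\<^sub>R cis (\<Sum>x\<in>A. \<theta> x * divergence E k x))) = (\<lambda>k. w k *\<^sub>R \<xi> k \<theta>)"
      by (simp add: \<xi>_def mult.commute)
    finally show ?thesis .
  qed
  note ch = integral_character[OF A divergence_Ints, folded I_def P_def]
  have chi_int: "integrable P (\<xi> k)" if "k \<in> int_forms E" for k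
    unfolding \<xi>_def using ch(1)[OF that] .
  have chi_val: "(\<integral>\<theta>. \<xi> k \<theta> \<partial>P) = of_real (if \<forall>x\<in>A. divergence E k x = 0 then (2 * pi) ^ card A else 0)" if "k \<in> int_forms E" for k
    unfolding \<xi>_def using ch(2)[OF that] .
  have nchi: "norm (\<xi> k \<theta>) = I \<theta>" for k \<theta> by (simp add: \<xi>_def I_def)
  have "complex_of_real (Z_Vil V E v0 \<beta>) = of_real (\<integral>\<theta>. I \<theta> * S \<theta> \<partial>P)"
    by (simp add: Z_Vil_def set_lebesgue_integral_def lebesgue_forms_def as_form_eq_extend_zero int_one_forms_eq I_def S_def P_def A_def)
  also have "\<dots> = (\<integral>\<theta>. of_real (I \<theta> * S \<theta>) \<partial>P)" by (rule integral_complex_of_real[symmetric])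
  also have "\<dots> = K *\<^sub>R (\<integral>\<theta>. (\<Sum>\<^sub>\<infinity>k\<in>int_forms E. w k *\<^sub>R \<xi> k \<theta>) \<partial>P)"
    unfolding S by (rule integral_scaleR_right)
  also have "(\<integral>\<theta>. (\<Sum>\<^sub>\<infinity>k\<in>int_forms E. w k *\<^sub>R \<xi> k \<theta>) \<partial>P) = (\<Sum>\<^sub>\<infinity>k\<in>int_forms E. \<integral>\<theta>. w k *\<^sub>R \<xi> k \<theta> \<partial>P)"
  proof (rule integral_infsum[OF cI])
    show "integrable P (\<lambda>\<theta>. w k *\<^sub>R \<xi> k \<theta>)" if "k \<in> int_forms E" for k using chi_int[OF that] by simp
    show "(\<lambda>k. norm (w k *\<^sub>R \<xi> k \<theta>)) summable_on int_forms E" for \<theta>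
      using summable_on_cmult_left[OF sw, of "I \<theta>"] w0 by (simp add: nchi abs_of_pos)
    show "(\<lambda>k. \<integral>\<theta>. norm (w k *\<^sub>R \<xi> k \<theta>) \<partial>P) summable_on int_forms E"
      using summable_on_cmult_left[OF sw, of "\<integral>\<theta>. I \<theta> \<partial>P"] w0 by (simp add: nchi abs_of_pos)
  qed
  also have "\<dots> = (\<Sum>\<^sub>\<infinity>k\<in>{k \<in> int_forms E. \<forall>x\<in>A. divergence E k x = 0}. of_real ((2 * pi) ^ card A * w k))"
    by (rule infsum_cong_neutral) (auto simp: chi_val scaleR_conv_of_real)
  also have "\<dots> = of_real (\<Sum>\<^sub>\<infinity>k\<in>{k \<in> int_forms E. \<forall>x\<in>A. divergence E k x = 0}. (2 * pi) ^ card A * w k)"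
    by (rule infsum_complex_of_real) (intro summable_on_cmult_right summable_on_subset[OF sw], auto)
  also have "K *\<^sub>R \<dots> = of_real (K * ((2 * pi) ^ card A * (\<Sum>\<^sub>\<infinity>k\<in>{k \<in> int_forms E. \<forall>x\<in>A. divergence E k x = 0}. w k)))"
    by (simp add: infsum_cmult_right' scaleR_conv_of_real)
  finally have "Z_Vil V E v0 \<beta> = K * ((2 * pi) ^ card A * (\<Sum>\<^sub>\<infinity>k\<in>{k \<in> int_forms E. \<forall>x\<in>A. divergence E k x = 0}. w k))"
    by (simp only: of_real_eq_iff)
  then show ?thesis by (simp add: K_def A_def w_def)
qed

section \<open>Planar duality on a box\<close>

text \<open>
  A face is named after its lower left corner.
\<close>

definition faces :: "nat \<Rightarrow> site set" where
  "faces n = {- int n..<int n} \<times> {- int n..<int n}"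

abbreviation hor :: "(site \<times> site \<Rightarrow> real) \<Rightarrow> int \<Rightarrow> int \<Rightarrow> real" where
  "hor k a b \<equiv> k ((a, b), (a + 1, b))"

abbreviation ver :: "(site \<times> site \<Rightarrow> real) \<Rightarrow> int \<Rightarrow> int \<Rightarrow> real" where
  "ver k a b \<equiv> k ((a, b), (a, b + 1))"

text \<open>
  The gradient of \<open>\<psi>\<close> rotated by a right angle: the flow through an edge is the difference of the
  values of \<open>\<psi>\<close> on its two sides, upper minus lower or left minus right.
\<close>

definition rot :: "nat \<Rightarrow> (site \<Rightarrow> real) \<Rightarrow> site \<times> site \<Rightarrow> real" where
  "rot n \<psi> e = (if e \<in> box_edges n then
     (if snd (snd e) = snd (fst e) then \<psi> (fst e) - \<psi> (fst (fst e), snd (fst e) - 1)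
      else \<psi> (fst (fst e) - 1, snd (fst e)) - \<psi> (fst e)) else 0)"

text \<open>
  The height of a face recovers from a flow what crosses the vertical segment below the face.
\<close>

definition potential :: "nat \<Rightarrow> (site \<times> site \<Rightarrow> real) \<Rightarrow> site \<Rightarrow> real" where
  "potential n k x = (\<Sum>b\<in>{- int n..snd x}. hor k (fst x) b)"

definition flows :: "nat \<Rightarrow> (site \<times> site \<Rightarrow> real) set" where
  "flows n = {k \<in> int_forms (box_edges n). \<forall>a b. hor k (a - 1) b - hor k a b + ver k a (b - 1) - ver k a b = 0}"

lemma finite_faces: "finite (faces n)"
  by (simp add: faces_def)

lemma divergence_box:
  assumes k: "k \<in> real_forms (box_edges n)"
  shows "divergence (box_edges n) k (a, b) = hor k (a - 1) b - hor k a b + ver k a (b - 1) - ver k a b"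
proof -
  have k0: "k e = 0" if "e \<notin> box_edges n" for e using k that by (simp add: real_forms_def)
  have fin: "finite (box_edges n)" by (rule finite_box_edges)
  have "(\<Sum>e\<in>box_edges n. k e * delta (a, b) (snd e)) = (\<Sum>e\<in>{((a - 1, b), (a, b)), ((a, b - 1), (a, b))}. k e)"
  proof -
    have "(\<Sum>e\<in>box_edges n. k e * delta (a, b) (snd e)) =
        (\<Sum>e\<in>box_edges n \<union> {((a - 1, b), (a, b)), ((a, b - 1), (a, b))}. k e * delta (a, b) (snd e))"
      using fin k0 by (intro sum.mono_neutral_left) auto
    also have "\<dots> = (\<Sum>e\<in>{((a - 1, b), (a, b)), ((a, b - 1), (a, b))}. k e * delta (a, b) (snd e))"
      using fin by (intro sum.mono_neutral_right) (auto simp: delta_def box_edges_def)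
    finally show ?thesis by (simp add: delta_def)
  qed
  moreover have "(\<Sum>e\<in>box_edges n. k e * delta (a, b) (fst e)) = (\<Sum>e\<in>{((a, b), (a + 1, b)), ((a, b), (a, b + 1))}. k e)"
  proof -
    have "(\<Sum>e\<in>box_edges n. k e * delta (a, b) (fst e)) =
        (\<Sum>e\<in>box_edges n \<union> {((a, b), (a + 1, b)), ((a, b), (a, b + 1))}. k e * delta (a, b) (fst e))"
      using fin k0 by (intro sum.mono_neutral_left) auto
    also have "\<dots> = (\<Sum>e\<in>{((a, b), (a + 1, b)), ((a, b), (a, b + 1))}. k e * delta (a, b) (fst e))"
      using fin by (intro sum.mono_neutral_right) (auto simp: delta_def box_edges_def)
    finally show ?thesis by (simp add: delta_def)
  qed
  ultimately show ?thesis
    by (simp add: divergence_def form_inner_def grad_def right_diff_distrib sum_subtractf)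
qed

lemma sum_divergence:
  assumes "finite V" "E \<subseteq> V \<times> V"
  shows "(\<Sum>x\<in>V. divergence E k x) = 0"
proof -
  have "(\<Sum>x\<in>V. divergence E k x) = (\<Sum>e\<in>E. k e * ((\<Sum>x\<in>V. delta x (snd e)) - (\<Sum>x\<in>V. delta x (fst e))))"
    unfolding divergence_def form_inner_def grad_def
    by (subst sum.swap) (simp add: sum_distrib_left sum_subtractf right_diff_distrib)
  also have "\<dots> = 0"
  proof (rule sum.neutral, rule ballI)
    fix e assume "e \<in> E"
    then have "fst e \<in> V" "snd e \<in> V" using assms(2) by auto
    moreover have "(\<Sum>x\<in>V. delta x y) = (if y \<in> V then 1 else 0)" for y
      using assms(1) by (simp add: delta_def sum.delta')
    ultimately show "k e * ((\<Sum>x\<in>V. delta x (snd e)) - (\<Sum>x\<in>V. delta x (fst e))) = 0" by simp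
  qed
  finally show ?thesis .
qed

text \<open>
  The divergences add up to \<open>0\<close>, so the condition at the marked vertex follows from the others.
\<close>

lemma flows_eq:
  assumes v: "v \<in> lattice_box n"
  shows "{k \<in> int_forms (box_edges n). \<forall>x\<in>lattice_box n - {v}. divergence (box_edges n) k x = 0} = flows n"
proof (intro equalityI subsetI)
  fix k assume k: "k \<in> flows n"
  then have "k \<in> real_forms (box_edges n)" by (simp add: flows_def int_forms_def)
  then show "k \<in> {k \<in> int_forms (box_edges n). \<forall>x\<in>lattice_box n - {v}. divergence (box_edges n) k x = 0}"
    using k divergence_box[of k n] by (auto simp: flows_def)
next
  fix k assume "k \<in> {k \<in> int_forms (box_edges n). \<forall>x\<in>lattice_box n - {v}. divergence (box_edges n) k x = 0}"
  then have k: "k \<in> int_forms (box_edges n)" "\<And>x. x \<in> lattice_box n - {v} \<Longrightarrow> divergence (box_edges n) k x = 0" by auto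
  have "0 = (\<Sum>x\<in>lattice_box n. divergence (box_edges n) k x)"
    by (rule sum_divergence[OF finite_lattice_box box_edges_subset(1), symmetric])
  also have "\<dots> = divergence (box_edges n) k v"
    using v k(2) finite_lattice_box by (simp add: sum.remove[of _ v])
  finally have dv: "divergence (box_edges n) k x = 0" if "x \<in> lattice_box n" for x
    using k(2)[of x] that by (cases "x = v") auto
  have kr: "k \<in> real_forms (box_edges n)" using k(1) by (rule int_forms_real_forms)
  have "hor k (a - 1) b - hor k a b + ver k a (b - 1) - ver k a b = 0" for a b
  proof (cases "(a, b) \<in> lattice_box n")
    case True
    then show ?thesis using dv divergence_box[OF kr, of a b] by simp
  next
    case False
    then have "((a - 1, b), (a - 1 + 1, b)) \<notin> box_edges n" "((a, b), (a + 1, b)) \<notin> box_edges n"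
      "((a, b - 1), (a, b - 1 + 1)) \<notin> box_edges n" "((a, b), (a, b + 1)) \<notin> box_edges n"
      using box_edges_subset(1)[of n] by auto
    then show ?thesis using kr by (simp add: real_forms_def)
  qed
  then show "k \<in> flows n" using k(1) by (simp add: flows_def)
qed

lemma rot_hor:
  assumes "\<psi> \<in> real_forms (faces n)"
  shows "hor (rot n \<psi>) a b = \<psi> (a, b) - \<psi> (a, b - 1)"
proof (cases "((a, b), (a + 1, b)) \<in> box_edges n")
  case True
  then show ?thesis by (simp add: rot_def)
next
  case False
  then have "(a, b) \<notin> faces n" "(a, b - 1) \<notin> faces n" by (auto simp: box_edges_def lattice_box_def faces_def)
  then have "\<psi> (a, b) = 0" "\<psi> (a, b - 1) = 0" using assms unfolding real_forms_def by blast+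
  then show ?thesis using False by (simp add: rot_def)
qed

lemma rot_ver:
  assumes "\<psi> \<in> real_forms (faces n)"
  shows "ver (rot n \<psi>) a b = \<psi> (a - 1, b) - \<psi> (a, b)"
proof (cases "((a, b), (a, b + 1)) \<in> box_edges n")
  case True
  then show ?thesis by (simp add: rot_def)
next
  case False
  then have "(a - 1, b) \<notin> faces n" "(a, b) \<notin> faces n" by (auto simp: box_edges_def lattice_box_def faces_def)
  then have "\<psi> (a - 1, b) = 0" "\<psi> (a, b) = 0" using assms unfolding real_forms_def by blast+
  then show ?thesis using False by (simp add: rot_def)
qed

lemma sum_int_atLeastAtMost_Suc:
  fixes f :: "int \<Rightarrow> real"
  assumes "a \<le> b + 1"
  shows "(\<Sum>i\<in>{a..b + 1}. f i) = (\<Sum>i\<in>{a..b}. f i) + f (b + 1)"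
proof -
  have "{a..b + 1} = insert (b + 1) {a..b}" using assms by auto
  then show ?thesis by simp
qed

lemma potential_rot:
  assumes p: "\<psi> \<in> real_forms (faces n)"
  shows "potential n (rot n \<psi>) = \<psi>"
proof
  fix x :: site
  obtain a b where x: "x = (a, b)" by (cases x)
  have z: "\<psi> (a, b) = 0" if "b < - int n" for b
    using p that unfolding real_forms_def faces_def by auto
  show "potential n (rot n \<psi>) x = \<psi> x"
  proof (cases "b < - int n")
    case True
    then show ?thesis using z[of b] by (simp add: potential_def x)
  next
    case False
    then have "- int n - 1 \<le> b" by simp
    then have "(\<Sum>i\<in>{- int n..b}. hor (rot n \<psi>) a i) = \<psi> (a, b)"
    proof (induction b rule: int_ge_induct)
      case base
      then show ?case using z[of "- int n - 1"] by simp
    next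
      case (step i)
      then show ?case
        using sum_int_atLeastAtMost_Suc[of "- int n" i "\<lambda>i. hor (rot n \<psi>) a i"] rot_hor[OF p, of a "i + 1"] by simp
    qed
    then show ?thesis by (simp add: potential_def x)
  qed
qed

text \<open>
  Differences in the vertical direction hold by definition; the horizontal ones follow by induction
  upwards from the vanishing of the divergence.  Above the box the horizontal differences are \<open>0\<close>, so
  there \<open>potential\<close> is constant along each row and vanishes, as it does to the left of the box.
\<close>

lemma
  assumes k: "k \<in> flows n"
  shows potential_hor: "potential n k (a, b) - potential n k (a, b - 1) = hor k a b"
    and potential_ver: "potential n k (a - 1, b) - potential n k (a, b) = ver k a b"
    and potential_int_forms: "potential n k \<in> int_forms (faces n)"
proof -
  have k0: "k e = 0" if "e \<notin> box_edges n" for e using k that by (simp add: flows_def int_forms_def real_forms_def)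
  have div: "hor k (a - 1) b - hor k a b + ver k a (b - 1) - ver k a b = 0" for a b
    using k by (simp add: flows_def)
  have h0: "hor k a b = 0" if "a < - int n \<or> int n \<le> a \<or> b < - int n \<or> int n < b" for a b
    using that by (intro k0) (auto simp: box_edges_def lattice_box_def)
  have v0: "ver k a b = 0" if "a < - int n \<or> int n < a \<or> b < - int n \<or> int n \<le> b" for a b
    using that by (intro k0) (auto simp: box_edges_def lattice_box_def)
  show ph: "potential n k (a, b) - potential n k (a, b - 1) = hor k a b" for a b
  proof (cases "b < - int n")
    case True
    then show ?thesis using h0[of a b] by (simp add: potential_def)
  next
    case False
    then show ?thesis
      using sum_int_atLeastAtMost_Suc[of "- int n" "b - 1" "\<lambda>i. hor k a i"] by (simp add: potential_def)
  qed
  show pv: "potential n k (a - 1, b) - potential n k (a, b) = ver k a b" for a b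
  proof (cases "b < - int n")
    case True
    then show ?thesis by (simp add: potential_def v0)
  next
    case False
    then have "- int n - 1 \<le> b" by simp
    then show ?thesis
    proof (induction b rule: int_ge_induct)
      case base
      then show ?case using v0[of a "- int n - 1"] by (simp add: potential_def)
    next
      case (step i)
      then show ?case
        using ph[of a "i + 1"] ph[of "a - 1" "i + 1"] div[of a "i + 1"] by simp
    qed
  qed
  have zero: "potential n k (a, b) = 0" if out: "(a, b) \<notin> faces n" for a b
  proof -
    consider "a < - int n \<or> int n \<le> a" | "b < - int n" | "- int n \<le> a" "int n \<le> b"
      using out by (cases "- int n \<le> a") (auto simp: faces_def)
    then show ?thesis
    proof cases
      case 1
      then show ?thesis by (auto simp: potential_def h0 intro!: sum.neutral)
    next
      case 2
      then show ?thesis by (simp add: potential_def)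
    next
      case 3
      then have "- int n - 1 \<le> a" by simp
      then show ?thesis
      proof (induction a rule: int_ge_induct)
        case base
        then show ?case using h0[of "- int n - 1"] by (auto simp: potential_def intro!: sum.neutral)
      next
        case (step i)
        then show ?case using pv[of "i + 1" b] v0[of "i + 1" b] 3 by simp
      qed
    qed
  qed
  have "potential n k x \<in> \<int>" for x
    using k unfolding potential_def flows_def int_forms_def by (intro Ints_sum) auto
  then show "potential n k \<in> int_forms (faces n)"
    using zero by (auto simp: int_forms_def real_forms_def)
qed

lemma rot_potential:
  assumes k: "k \<in> flows n"
  shows "rot n (potential n k) = k"
proof
  fix e :: "site \<times> site"
  have p: "potential n k \<in> real_forms (faces n)" using potential_int_forms[OF k] by (rule int_forms_real_forms)
  show "rot n (potential n k) e = k e"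
  proof (cases "e \<in> box_edges n")
    case True
    then obtain a b where "e = ((a, b), (a + 1, b)) \<or> e = ((a, b), (a, b + 1))" by (auto simp: box_edges_def)
    then show ?thesis
      using rot_hor[OF p, of a b] rot_ver[OF p, of a b] potential_hor[OF k, of a b] potential_ver[OF k, of a b] by auto
  next
    case False
    then show ?thesis using k by (simp add: rot_def flows_def int_forms_def real_forms_def)
  qed
qed

lemma rot_flows:
  assumes "\<psi> \<in> int_forms (faces n)"
  shows "rot n \<psi> \<in> flows n"
proof -
  have p: "\<psi> \<in> real_forms (faces n)" using assms by (rule int_forms_real_forms)
  have "rot n \<psi> \<in> int_forms (box_edges n)"
    using assms by (auto simp: int_forms_def real_forms_def rot_def)
  moreover have "hor (rot n \<psi>) (a - 1) b - hor (rot n \<psi>) a b + ver (rot n \<psi>) a (b - 1) - ver (rot n \<psi>) a b = 0" for a b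
    unfolding rot_hor[OF p] rot_ver[OF p] by simp
  ultimately show ?thesis by (simp add: flows_def)
qed

text \<open>
  Every edge of the box is crossed by exactly one edge between faces, where the outer faces count as
  height \<open>0\<close>.
\<close>

lemma energy_rot:
  assumes p: "\<psi> \<in> real_forms (faces n)"
  shows "form_inner (box_edges n) (rot n \<psi>) (rot n \<psi>) = dirichlet_form (lattice_edges (faces n)) \<psi> \<psi>"
proof -
  define i :: "site \<times> site \<Rightarrow> site \<times> site" where
    "i e = (if snd (snd e) = snd (fst e) then ((fst (fst e), snd (fst e) - 1), fst e) else ((fst (fst e) - 1, snd (fst e)), fst e))" for e
  define j :: "site \<times> site \<Rightarrow> site \<times> site" where
    "j e = (if snd (fst e) = snd (snd e) then (snd e, (fst (snd e), snd (snd e) + 1)) else (snd e, (fst (snd e) + 1, snd (snd e))))" for e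
  have "(\<Sum>e\<in>box_edges n. (rot n \<psi> e)\<^sup>2) = (\<Sum>e\<in>lattice_edges (faces n). (grad \<psi> e)\<^sup>2)"
  proof (rule sum.reindex_bij_witness[where j = i and i = j])
    fix e assume e: "e \<in> box_edges n"
    then obtain a b where eq: "e = ((a, b), (a + 1, b)) \<or> e = ((a, b), (a, b + 1))" by (auto simp: box_edges_def)
    then show "j (i e) = e" by (auto simp: i_def j_def)
    show "i e \<in> lattice_edges (faces n)"
      using e eq by (auto simp: i_def box_edges_def lattice_box_def lattice_edges_def faces_def)
    show "(grad \<psi> (i e))\<^sup>2 = (rot n \<psi> e)\<^sup>2"
      using e eq by (auto simp: i_def rot_def grad_def power2_commute)
  next
    fix e assume e: "e \<in> lattice_edges (faces n)"
    then obtain a b where eq: "e = ((a - 1, b), (a, b)) \<or> e = ((a, b - 1), (a, b))"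
      by (auto simp: lattice_edges_def) (metis add_diff_cancel_right')+
    then show "i (j e) = e" by (auto simp: i_def j_def)
    show "j e \<in> box_edges n"
      using e eq by (auto simp: j_def box_edges_def lattice_box_def lattice_edges_def faces_def)
  qed
  then show ?thesis by (simp add: form_inner_def dirichlet_form_self power2_eq_square)
qed

theorem Z_Vil_box:
  assumes v: "v \<in> lattice_box n" and b: "0 < \<beta>"
  shows "Z_Vil (lattice_box n) (box_edges n) v \<beta> =
    (2 * pi) ^ card (lattice_box n - {v}) / sqrt (2 * pi * \<beta>) ^ card (box_edges n) * dirichlet_sum (1 / \<beta>) (faces n)"
proof -
  have bij: "bij_betw (rot n) (int_forms (faces n)) (flows n)"
    by (rule bij_betw_byWitness[where f' = "potential n"])
       (auto simp: potential_rot int_forms_real_forms rot_potential rot_flows potential_int_forms)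
  have "(\<Sum>\<^sub>\<infinity>k\<in>flows n. exp (- (1 / \<beta>) / 2 * form_inner (box_edges n) k k)) =
     (\<Sum>\<^sub>\<infinity>\<psi>\<in>int_forms (faces n). exp (- (1 / \<beta>) / 2 * form_inner (box_edges n) (rot n \<psi>) (rot n \<psi>)))"
    by (rule infsum_reindex_bij_betw[OF bij, symmetric])
  also have "\<dots> = dirichlet_sum (1 / \<beta>) (faces n)"
    unfolding dirichlet_sum_def dirichlet.discrete_gaussian_def
    by (intro infsum_cong) (simp only: energy_rot[OF int_forms_real_forms])
  finally show ?thesis
    unfolding Z_Vil_eq[OF finite_lattice_box finite_box_edges b] flows_eq[OF v] by simp
qed

lemma faces_sandwich: "faces n \<subseteq> lattice_box n" "lattice_box n \<subseteq> faces (Suc n)"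
  by (auto simp: faces_def lattice_box_def)

text \<open>
  The set of faces lies between two consecutive boxes, so the zero boundary conditions on the faces have
  the same limit as on the boxes.  There are asymptotically one angle and two edges for each vertex, which
  gives the term \<open>- ln \<beta>\<close>.
\<close>

lemma Vil_box_limit:
  assumes v: "\<And>n. v0 n \<in> lattice_box n" and b: "0 < \<beta>"
    and l: "(\<lambda>n. ln (dirichlet_sum (1 / \<beta>) (lattice_box n)) / real (card (lattice_box n))) \<longlonglongrightarrow> l"
  shows "box_free_energy Z_Vil v0 \<beta> \<longlonglongrightarrow> l - ln \<beta>"
proof -
  define g where "g A = ln (dirichlet_sum (1 / \<beta>) A)" for A
  define V where "V n = (2 * real n + 1)\<^sup>2" for n
  have card: "real (card (lattice_box n)) = V n" for n by (simp add: card_lattice_box V_def)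
  have Vpos: "0 < V n" for n by (simp add: V_def)
  have b': "0 < 1 / \<beta>" using b by simp
  have D: "1 \<le> dirichlet_sum (1 / \<beta>) A" if "finite A" for A using dirichlet_sum_ge_1[OF that b'] .
  have gmono: "g A \<le> g A'" if "finite A'" "A \<subseteq> A'" for A A'
  proof -
    have "finite A" using that finite_subset by blast
    then show ?thesis
      unfolding g_def using dirichlet_sum_mono[OF that b'] D[of A] by (intro ln_mono) auto
  qed
  have lim: "(\<lambda>n. g (lattice_box n) / V n) \<longlonglongrightarrow> l" using l by (simp add: g_def card)
  have "(\<lambda>n. g (faces (Suc n)) / V (Suc n)) \<longlonglongrightarrow> l"
  proof (rule tendsto_sandwich)
    show "\<forall>\<^sub>F n in sequentially. (g (lattice_box n) / V n) * (V n / V (Suc n)) \<le> g (faces (Suc n)) / V (Suc n)"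
    proof (intro always_eventually allI)
      fix n
      have "g (lattice_box n) / V (Suc n) \<le> g (faces (Suc n)) / V (Suc n)"
        using gmono[OF finite_faces faces_sandwich(2)] Vpos[of "Suc n"] by (intro divide_right_mono) auto
      then show "(g (lattice_box n) / V n) * (V n / V (Suc n)) \<le> g (faces (Suc n)) / V (Suc n)"
        using Vpos[of n] by simp
    qed
    show "\<forall>\<^sub>F n in sequentially. g (faces (Suc n)) / V (Suc n) \<le> g (lattice_box (Suc n)) / V (Suc n)"
      using gmono[OF finite_lattice_box faces_sandwich(1)] Vpos by (intro always_eventually allI divide_right_mono) (auto simp: less_imp_le)
    have "(\<lambda>n. V n / V (Suc n)) \<longlonglongrightarrow> 1" unfolding V_def by real_asymp
    then show "(\<lambda>n. (g (lattice_box n) / V n) * (V n / V (Suc n))) \<longlonglongrightarrow> l"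
      using tendsto_mult[OF lim] by fastforce
    show "(\<lambda>n. g (lattice_box (Suc n)) / V (Suc n)) \<longlonglongrightarrow> l" by (rule LIMSEQ_Suc[OF lim])
  qed
  then have flim: "(\<lambda>n. g (faces n) / V n) \<longlonglongrightarrow> l" by (rule LIMSEQ_imp_Suc)
  have ln_prod: "ln (x ^ i / y ^ j * d) = real i * ln x - real j * ln y + ln d" if "0 < x" "0 < y" "0 < d" for x y d :: real and i j
    using that by (simp add: ln_mult_pos ln_div ln_realpow)
  have frac: "(a * x - b * y + z) / v = a / v * x - b / v * y + z / v" for a b x y z v :: real
    by (simp add: add_divide_distrib diff_divide_distrib)
  have eq: "box_free_energy Z_Vil v0 \<beta> = (\<lambda>n. ((2 * real n + 1)\<^sup>2 - 1) / V n * ln (2 * pi)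
      - 4 * real n * (2 * real n + 1) / V n * (ln (2 * pi * \<beta>) / 2) + g (faces n) / V n)"
  proof
    fix n
    have c1: "real (card (lattice_box n - {v0 n})) = (2 * real n + 1)\<^sup>2 - 1"
      using v[of n] finite_lattice_box by (simp add: card_lattice_box of_nat_diff add.commute)
    have c2: "real (card (box_edges n)) = 4 * real n * (2 * real n + 1)"
      by (simp add: card_box_edges algebra_simps)
    have pos: "0 < 2 * pi" "0 < sqrt (2 * pi * \<beta>)" "0 < dirichlet_sum (1 / \<beta>) (faces n)"
      using b D[OF finite_faces, of n] by auto
    have "ln (Z_Vil (lattice_box n) (box_edges n) (v0 n) \<beta>) =
       real (card (lattice_box n - {v0 n})) * ln (2 * pi) - real (card (box_edges n)) * ln (sqrt (2 * pi * \<beta>)) + g (faces n)"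
      unfolding Z_Vil_box[OF v b] g_def by (rule ln_prod[OF pos])
    also have "ln (sqrt (2 * pi * \<beta>)) = ln (2 * pi * \<beta>) / 2"
      using b by (simp add: ln_sqrt)
    finally show "box_free_energy Z_Vil v0 \<beta> n = ((2 * real n + 1)\<^sup>2 - 1) / V n * ln (2 * pi)
      - 4 * real n * (2 * real n + 1) / V n * (ln (2 * pi * \<beta>) / 2) + g (faces n) / V n"
      unfolding box_free_energy_def card c1 c2 by (simp only: frac)
  qed
  have 1: "(\<lambda>n. ((2 * real n + 1)\<^sup>2 - 1) / V n) \<longlonglongrightarrow> 1" unfolding V_def by real_asymp
  have 2: "(\<lambda>n. 4 * real n * (2 * real n + 1) / V n) \<longlonglongrightarrow> 2" unfolding V_def by real_asymp
  have "box_free_energy Z_Vil v0 \<beta> \<longlonglongrightarrow> 1 * ln (2 * pi) - 2 * (ln (2 * pi * \<beta>) / 2) + l"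
    unfolding eq by (intro tendsto_intros 1 2 flim)
  moreover have "1 * ln (2 * pi) - 2 * (ln (2 * pi * \<beta>) / 2) + l = l - ln \<beta>"
    using b by (simp add: ln_mult_pos field_simps)
  ultimately show ?thesis by (simp only:)
qed

section \<open>Free energies\<close>

theorem theorem1p11:
  fixes v0 :: "nat \<Rightarrow> int \<times> int"
  assumes "\<And>n. v0 n \<in> lattice_box n"
  shows "(\<forall>\<beta>>0. \<forall>Z\<in>{Z_GFF, Z_IV, Z_Coul, Z_Vil}. convergent (box_free_energy Z v0 \<beta>)) \<and>
    (\<exists>\<epsilon> :: real \<Rightarrow> real. (\<epsilon> \<longlongrightarrow> 0) at_top \<and>
      (\<forall>\<^sub>F \<beta> in at_top. exp (- (pi\<^sup>2 * \<beta> * (1 + \<epsilon> \<beta>))) \<le> free_energy Z_Coul v0 \<beta>)) \<and>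
    (\<forall>\<beta>>0.
      free_energy Z_Coul v0 \<beta> = free_energy Z_IV v0 (inverse \<beta>) - free_energy Z_GFF v0 (inverse \<beta>) \<and>
      free_energy Z_IV v0 (inverse \<beta>) - free_energy Z_GFF v0 (inverse \<beta>)
        = free_energy Z_Vil v0 \<beta> - free_energy Z_GFF v0 \<beta>)"
proof -
  obtain L where L: "\<And>\<gamma>. 0 < \<gamma> \<Longrightarrow> box_free_energy Z_GFF v0 \<gamma> \<longlonglongrightarrow> L - ln \<gamma> / 2"
    by (rule GFF_box_limit[OF assms]) blast
  have "\<exists>l. 0 < \<gamma> \<longrightarrow> (\<lambda>n. ln (dirichlet_sum \<gamma> (lattice_box n)) / real (card (lattice_box n))) \<longlonglongrightarrow> l \<and>
     box_free_energy Z_IV v0 \<gamma> \<longlonglongrightarrow> l" for \<gamma>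
  proof (cases "0 < \<gamma>")
    case True
    show ?thesis by (rule IV_box_limit[OF assms True]) blast
  qed simp
  then obtain l where l: "\<And>\<gamma>. 0 < \<gamma> \<Longrightarrow> (\<lambda>n. ln (dirichlet_sum \<gamma> (lattice_box n)) / real (card (lattice_box n))) \<longlonglongrightarrow> l \<gamma>"
     "\<And>\<gamma>. 0 < \<gamma> \<Longrightarrow> box_free_energy Z_IV v0 \<gamma> \<longlonglongrightarrow> l \<gamma>"
    by metis
  have Vil: "box_free_energy Z_Vil v0 \<beta> \<longlonglongrightarrow> l (inverse \<beta>) - ln \<beta>" if "0 < \<beta>" for \<beta>
    using Vil_box_limit[OF assms that] l(1)[of "inverse \<beta>"] that by (simp add: inverse_eq_divide)
  have Coul: "box_free_energy Z_Coul v0 \<beta> \<longlonglongrightarrow> l (inverse \<beta>) - (L + ln \<beta> / 2)" if b: "0 < \<beta>" for \<beta>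
  proof -
    have "box_free_energy Z_Coul v0 \<beta> n = box_free_energy Z_IV v0 (inverse \<beta>) n - box_free_energy Z_GFF v0 (inverse \<beta>) n" for n
    proof (rule box_partition_functions[OF assms[of n]])
      fix C assume C: "0 < C" "\<And>\<gamma>. 0 < \<gamma> \<Longrightarrow> Z_GFF (lattice_box n) (box_edges n) (v0 n) \<gamma> = C / sqrt \<gamma> ^ card (lattice_box n - {v0 n})"
        and IV: "\<And>\<beta>. 0 < \<beta> \<Longrightarrow> Z_IV (lattice_box n) (box_edges n) (v0 n) (inverse \<beta>) =
          Z_GFF (lattice_box n) (box_edges n) (v0 n) (inverse \<beta>) * Z_Coul (lattice_box n) (box_edges n) (v0 n) \<beta>"
      have ib: "0 < inverse \<beta>" using b by simp
      have G: "0 < Z_GFF (lattice_box n) (box_edges n) (v0 n) (inverse \<beta>)"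
        using C ib by simp
      have "0 < Z_IV (lattice_box n) (box_edges n) (v0 n) (inverse \<beta>)"
        unfolding Z_IV_eq using dirichlet.discrete_gaussian_ge_1[OF _ pos_def_box[OF assms] ib, of n] finite_lattice_box
        by (simp add: less_le_trans[OF zero_less_one])
      then have "0 < Z_Coul (lattice_box n) (box_edges n) (v0 n) \<beta>"
        using G unfolding IV[OF b] by (simp add: zero_less_mult_iff)
      then show ?thesis
        unfolding box_free_energy_def IV[OF b] using G by (simp add: ln_mult_pos add_divide_distrib)
    qed
    then have "box_free_energy Z_Coul v0 \<beta> = (\<lambda>n. box_free_energy Z_IV v0 (inverse \<beta>) n - box_free_energy Z_GFF v0 (inverse \<beta>) n)"
      by (rule ext)
    moreover have "(\<lambda>n. box_free_energy Z_IV v0 (inverse \<beta>) n - box_free_energy Z_GFF v0 (inverse \<beta>) n) \<longlonglongrightarrow> l (inverse \<beta>) - (L - ln (inverse \<beta>) / 2)"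
      using b by (intro tendsto_diff l(2) L) auto
    ultimately show ?thesis using b by (simp add: ln_inverse)
  qed
  have fe: "free_energy Z_GFF v0 \<beta> = L - ln \<beta> / 2" "free_energy Z_IV v0 \<beta> = l \<beta>"
    "free_energy Z_Coul v0 \<beta> = l (inverse \<beta>) - (L + ln \<beta> / 2)" "free_energy Z_Vil v0 \<beta> = l (inverse \<beta>) - ln \<beta>" if "0 < \<beta>" for \<beta>
    using L[OF that] l(2)[OF that] Coul[OF that] Vil[OF that] by (simp_all add: free_energy_def limI)
  have "\<forall>\<beta>>0. \<forall>Z\<in>{Z_GFF, Z_IV, Z_Coul, Z_Vil}. convergent (box_free_energy Z v0 \<beta>)"
    using convergentI[OF L] convergentI[OF l(2)] convergentI[OF Coul] convergentI[OF Vil] by auto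
  moreover have "\<exists>\<epsilon> :: real \<Rightarrow> real. (\<epsilon> \<longlongrightarrow> 0) at_top \<and>
      (\<forall>\<^sub>F \<beta> in at_top. exp (- (pi\<^sup>2 * \<beta> * (1 + \<epsilon> \<beta>))) \<le> free_energy Z_Coul v0 \<beta>)"
  proof (intro exI conjI)
    \<comment> \<open>This correction turns the factor \<open>1/3\<close> of \<open>Coul_free_energy_lower_bound\<close> into part of the exponent.\<close>
    show "((\<lambda>\<beta>. ln 3 / (pi\<^sup>2 * \<beta>)) \<longlongrightarrow> 0) at_top" by real_asymp
    show "\<forall>\<^sub>F \<beta> in at_top. exp (- (pi\<^sup>2 * \<beta> * (1 + ln 3 / (pi\<^sup>2 * \<beta>)))) \<le> free_energy Z_Coul v0 \<beta>"
      using eventually_gt_at_top[of 0]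
    proof eventually_elim
      case (elim \<beta>)
      have "pi\<^sup>2 * \<beta> * (1 + ln 3 / (pi\<^sup>2 * \<beta>)) = pi\<^sup>2 * \<beta> + ln 3"
        using elim by (simp add: field_simps)
      then have "exp (- (pi\<^sup>2 * \<beta> * (1 + ln 3 / (pi\<^sup>2 * \<beta>)))) = exp (- (pi\<^sup>2 * \<beta>)) / 3"
        by (simp add: exp_diff)
      also have "\<dots> \<le> free_energy Z_Coul v0 \<beta>"
        using Coul_free_energy_lower_bound[OF assms elim Coul[OF elim]] fe(3)[OF elim] by simp
      finally show ?case .
    qed
  qed
  moreover have "\<forall>\<beta>>0.
      free_energy Z_Coul v0 \<beta> = free_energy Z_IV v0 (inverse \<beta>) - free_energy Z_GFF v0 (inverse \<beta>) \<and>
      free_energy Z_IV v0 (inverse \<beta>) - free_energy Z_GFF v0 (inverse \<beta>)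
        = free_energy Z_Vil v0 \<beta> - free_energy Z_GFF v0 \<beta>"
  proof (intro allI impI)
    fix \<beta> :: real assume b: "0 < \<beta>"
    have "ln (inverse \<beta>) = - ln \<beta>" using b by (simp add: ln_inverse)
    then show "free_energy Z_Coul v0 \<beta> = free_energy Z_IV v0 (inverse \<beta>) - free_energy Z_GFF v0 (inverse \<beta>) \<and>
      free_energy Z_IV v0 (inverse \<beta>) - free_energy Z_GFF v0 (inverse \<beta>)
        = free_energy Z_Vil v0 \<beta> - free_energy Z_GFF v0 \<beta>"
      using b by (simp add: fe)
  qed
  ultimately show ?thesis by blast
qed

end
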